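(* Fix integers $d_2 \ge d_1 \ge 4$ and $k \ge 1$ such that $(d_1+1)(d_2+1) = 3(k+1)$. Then a general $(d_1,d_2)$ partially symmetric tensor in $\mathbb{P}^{2^{d_1+d_2}-1}$ can be expressed in $\nu \ge 2$ ways as a sum of $k+1$ decomposable tensors.
   Context: We work over an algebraically closed field of characteristic zero. Let $\Sigma \subset \mathbb{P}^N$, $N = (d_1+1)(d_2+1)-1$, be the image of $\mathbb{P}^1\times\mathbb{P}^1$ under the embedding given by the complete linear system $|\mathcal{O}(d_1,d_2)|$ (Segre-Veronese variety). The space $\mathbb{P}^N$ is viewed inside $\mathbb{P}^{2^{d_1+d_2}-1}$ (the projective space of tensors of order $d_1+d_2$ on a $2$-dimensional vector space) as the space of tensors invariant under the natural actions of the symmetric groups $S_{d_1}$ and $S_{d_2}$ permuting the first $d_1$ and the last $d_2$ tensor factors respectively. The points of $\mathbb{P}^N$ are called $(d_1,d_2)$ partially symmetric tensors, and the points of $\Sigma$ are the decomposable ones. "General" means: in a dense Zariski open subset of $\mathbb{P}^N$. Ways of expressing a general tensor as a sum of $k+1$ decomposable tensors are counted up to the order of the summands; $\nu$ is the number of $k$-dimensional linear spaces spanned by $k+1$ points of $\Sigma$ passing through a general point of $\mathbb{P}^N$. *)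

theory Defs
  imports
    "HOL-Analysis.Analysis"
    "HOL-Library.Function_Algebras"
    "HOL-Library.Multiset"
    "HOL-Combinatorics.Permutations"
    "HOL-Computational_Algebra.Polynomial"
begin

text \<open>
  The two-dimensional vector space is \<^typ>\<open>bool \<Rightarrow> 'a\<close>. A tensor of order \<open>n\<close> on it is given by its
  \<open>2 ^ n\<close> coordinates, indexed by the boolean lists of length \<open>n\<close>, and extended by \<open>0\<close> to the lists
  of any other length.
\<close>

type_synonym 'a tensor = "bool list \<Rightarrow> 'a"

definition tscale :: "'a::field \<Rightarrow> 'a tensor \<Rightarrow> 'a tensor" where
  "tscale c T = (\<lambda>xs. c * T xs)"

global_interpretation tensor: vector_space "tscale :: 'a::field \<Rightarrow> _"
  by unfold_locales (auto simp: tscale_def algebra_simps fun_eq_iff)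

definition tensor_space :: "nat \<Rightarrow> 'a::field tensor set" where
  "tensor_space n = {T. \<forall>xs. length xs \<noteq> n \<longrightarrow> T xs = 0}"

definition part_sym_tensors :: "nat \<Rightarrow> nat \<Rightarrow> 'a::field tensor set" where
  "part_sym_tensors d1 d2 = {T \<in> tensor_space (d1 + d2).
     \<forall>\<pi>. \<pi> permutes {..<d1} \<or> \<pi> permutes {d1..<d1 + d2} \<longrightarrow>
       (\<forall>xs. length xs = d1 + d2 \<longrightarrow> T (permute_list \<pi> xs) = T xs)}"

definition tensor_product :: "(bool \<Rightarrow> 'a) list \<Rightarrow> 'a::field tensor" where
  "tensor_product vs =
     (\<lambda>xs. if length xs = length vs then \<Prod>i<length vs. (vs ! i) (xs ! i) else 0)"


text \<open>Projective points are represented by one-dimensional subspaces.\<close>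

definition line :: "'a::field tensor \<Rightarrow> 'a tensor set" where
  "line T = tensor.span {T}"

definition proj_space :: "'a::field tensor set \<Rightarrow> 'a tensor set set" where
  "proj_space V = line ` (V - {0})"

text \<open>
  The coordinates of \<open>v \<otimes> \<dots> \<otimes> v \<otimes> w \<otimes> \<dots> \<otimes> w\<close> are the monomials of bidegree \<open>(d1, d2)\<close> in the coordinates
  of \<open>v\<close> and \<open>w\<close>, so that the following set is the image of \<open>P\<^sup>1 \<times> P\<^sup>1\<close> under the complete linear
  system of \<open>O(d1, d2)\<close>, inside \<open>proj_space (part_sym_tensors d1 d2)\<close>.
\<close>

definition segre_veronese :: "nat \<Rightarrow> nat \<Rightarrow> 'a::field tensor set set" where
  "segre_veronese d1 d2 =
     {line (tensor_product (replicate d1 v @ replicate d2 w)) | v w. v \<noteq> 0 \<and> w \<noteq> 0}"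

definition decomposable_tensors :: "nat \<Rightarrow> nat \<Rightarrow> 'a::field tensor set" where
  "decomposable_tensors d1 d2 = {T. T \<noteq> 0 \<and> line T \<in> segre_veronese d1 d2}"


inductive homogeneous_poly_fun :: "nat \<Rightarrow> ('a::field tensor \<Rightarrow> 'a) \<Rightarrow> bool" where
  const: "homogeneous_poly_fun 0 (\<lambda>T. c)"
| coord: "homogeneous_poly_fun 1 (\<lambda>T. T xs)"
| add: "homogeneous_poly_fun m f \<Longrightarrow> homogeneous_poly_fun m g \<Longrightarrow>
    homogeneous_poly_fun m (\<lambda>T. f T + g T)"
| mult: "homogeneous_poly_fun m f \<Longrightarrow> homogeneous_poly_fun n g \<Longrightarrow>
    homogeneous_poly_fun (m + n) (\<lambda>T. f T * g T)"

text \<open>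
  The Zariski topology is generated by the nonvanishing loci of homogeneous polynomials; these form
  a basis, so that the closed sets are the common zero loci of families of homogeneous polynomials.
\<close>

definition zariski_topology :: "'a::field tensor set \<Rightarrow> 'a tensor set topology" where
  "zariski_topology V = topology_generated_by
     {{p \<in> proj_space V. \<exists>T\<in>p. f T \<noteq> 0} | f m. homogeneous_poly_fun m f}"

lemma topspace_zariski_topology: "topspace (zariski_topology V) = proj_space V"
proof (rule antisym)
  show "topspace (zariski_topology V) \<subseteq> proj_space V"
    unfolding zariski_topology_def topology_generated_by_topspace by blast
  show "proj_space V \<subseteq> topspace (zariski_topology V)"
    unfolding zariski_topology_def topology_generated_by_topspace
  proof (rule Union_upper, rule CollectI, intro exI conjI)
    show "homogeneous_poly_fun 0 (\<lambda>T :: 'a tensor. 1)"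
      by (rule homogeneous_poly_fun.const)
    have "p \<noteq> {}" if "p \<in> proj_space V" for p
      using that tensor.span_zero by (fastforce simp: proj_space_def line_def)
    then show "proj_space V = {p \<in> proj_space V. \<exists>T\<in>p. (1::'a) \<noteq> 0}"
      by auto
  qed
qed

definition for_general_point ::
    "'a::field tensor set \<Rightarrow> ('a tensor set \<Rightarrow> bool) \<Rightarrow> bool" where
  "for_general_point V P \<longleftrightarrow>
     (\<exists>U. openin (zariski_topology V) U \<and>
          zariski_topology V closure_of U = topspace (zariski_topology V) \<and>
          (\<forall>p\<in>U. P p))"


text \<open>A summand absorbs its coefficient; multisets disregard the order of the summands.\<close>

definition decompositions :: "nat \<Rightarrow> nat \<Rightarrow> nat \<Rightarrow> 'a::field tensor \<Rightarrow> 'a tensor multiset set" where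
  "decompositions d1 d2 r T =
     {M. size M = r \<and> set_mset M \<subseteq> decomposable_tensors d1 d2 \<and> \<Sum>\<^sub># M = T}"

text \<open>A \<open>k\<close>-dimensional projective linear space is a vector subspace of dimension \<open>k + 1\<close>.\<close>

definition secant_spaces_through ::
    "nat \<Rightarrow> nat \<Rightarrow> nat \<Rightarrow> 'a::field tensor set \<Rightarrow> 'a tensor set set" where
  "secant_spaces_through d1 d2 k p =
     {L. (\<exists>A \<subseteq> segre_veronese d1 d2. card A = k + 1 \<and> L = tensor.span (\<Union>A)) \<and>
         tensor.dim L = k + 1 \<and> p \<subseteq> L}"

end

theory Submission
  imports
    Defs
    "HOL-Algebra.Algebraic_Closure_Type"
    "HOL-Computational_Algebra.Formal_Laurent_Series"
    "Jordan_Normal_Form.Determinant"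
begin

text \<open>
  Put \<open>r = k + 1\<close>. In affine coordinates a sum of \<open>r\<close> decomposable tensors is a family of power sums
  \<open>(\<Sum>i<r. c i * x i ^ a * y i ^ b)\<close>, where \<open>(a, b)\<close> ranges over \<open>{0..d1} \<times> {0..d2}\<close>: a polynomial map between
  affine spaces of the same dimension \<open>3 * r\<close>. It suffices to find one value with two different preimages
  at which the Jacobian does not vanish. Indeed, the existence of two preimages is a constructible
  condition, hence holds either generically or generically not; lifting the two preimages along a
  line, with the parameter of the line as an infinitesimal, excludes the second alternative.

  Such a double point is found by degeneration. If a line cuts the set of exponents into two parts, then
  weighting the points by powers of an infinitesimal decouples the two parts, so that by Hensel's
  lemma a double point for one part and a nondegenerate point for the other give a double
  point for the union over a field of Puiseux type, which descends to the ground field by quantifier elimination.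
  Cutting off triangles, which are nondegenerate, reduces the rectangle to a hexad of exponents
  with an explicit double point.

  Since an image of a hypersurface is not dense, a general tensor has no decomposition with points
  at infinity, with vanishing coefficients or with points failing to impose independent conditions on
  forms of bidegree \<open>(d1 - 1, d2)\<close> and \<open>(d1, d2 - 1)\<close>. By the last property a secant space meets the surface only in
  the points spanning it, so that secant spaces correspond to decompositions.
\<close>

hide_const (open) Module.smult UnivPoly.monom UnivPoly.coeff Polynomials.degree Divisibility.prime

no_notation Matrix.vec_index (infixl "$" 100)
no_notation vec_nth (infixl "$" 90)

section \<open>Quantifier elimination\<close>

text \<open>A constructible condition is carried as a pair of predicates, one over the ground field
  and one over \<open>'a fls alg_closure\<close>, both defined by one quantifier-free formula. The
  extension must be algebraically closed, because the elimination step rests on a one-variable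
  Nullstellensatz in either field; Laurent series alone would not do. Dimension theory is replaced
  by counting monomials: n + 1 polynomials in n variables are algebraically dependent. This yields
  both the bound on general fibres and the fact that a hypersurface of parameters misses the general
  tensor. The number \<nu> is then the largest m for which having m different solutions is generic.
  A triangle of exponents matches the three parameters of one point, so cutting off a triangle
  removes one summand. What shapes the base cases is parity: blocks of size 2 x 3 hold six
  exponents, hence a rectangle with both sides odd cannot be grown by such blocks from one with an
  even number of exponents.\<close>

datatype ('v, 'a) pexp =
  PC 'a | PV 'v | PAdd "('v, 'a) pexp" "('v, 'a) pexp" | PMul "('v, 'a) pexp" "('v, 'a) pexp"

text \<open>The map \<open>\<iota>\<close> carries the coefficients along, so that one expression
  can be evaluated in the ground field, in power series over it and in the algebraic closure of the
  Laurent series.\<close>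

primrec pev :: "('a \<Rightarrow> 'b::comm_ring_1) \<Rightarrow> ('v \<Rightarrow> 'b) \<Rightarrow> ('v, 'a) pexp \<Rightarrow> 'b" where
  "pev \<iota> e (PC c) = \<iota> c"
| "pev \<iota> e (PV v) = e v"
| "pev \<iota> e (PAdd p q) = pev \<iota> e p + pev \<iota> e q"
| "pev \<iota> e (PMul p q) = pev \<iota> e p * pev \<iota> e q"

primrec pvars :: "('v, 'a) pexp \<Rightarrow> 'v set" where
  "pvars (PC c) = {}"
| "pvars (PV v) = {v}"
| "pvars (PAdd p q) = pvars p \<union> pvars q"
| "pvars (PMul p q) = pvars p \<union> pvars q"

lemma finite_pvars [simp]: "finite (pvars p)"
  by (induction p) auto

lemma pev_cong: "(\<And>v. v \<in> pvars p \<Longrightarrow> e v = e' v) \<Longrightarrow> pev \<iota> e p = pev \<iota> e' p"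
  by (induction p) auto

primrec psubst :: "('v \<Rightarrow> ('w, 'a) pexp) \<Rightarrow> ('v, 'a) pexp \<Rightarrow> ('w, 'a) pexp" where
  "psubst \<sigma> (PC c) = PC c"
| "psubst \<sigma> (PV v) = \<sigma> v"
| "psubst \<sigma> (PAdd p q) = PAdd (psubst \<sigma> p) (psubst \<sigma> q)"
| "psubst \<sigma> (PMul p q) = PMul (psubst \<sigma> p) (psubst \<sigma> q)"

lemma pev_psubst: "pev \<iota> e (psubst \<sigma> p) = pev \<iota> (\<lambda>v. pev \<iota> e (\<sigma> v)) p"
  by (induction p) auto

lemma pvars_psubst: "pvars (psubst \<sigma> p) = (\<Union>v\<in>pvars p. pvars (\<sigma> v))"
  by (induction p) auto

lemma (in comm_ring_hom) hom_pev: "hom (pev \<iota> e p) = pev (\<lambda>x. hom (\<iota> x)) (\<lambda>v. hom (e v)) p"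
  by (induction p) (auto simp: hom_distribs)

primrec ladd :: "('v, 'a) pexp list \<Rightarrow> ('v, 'a) pexp list \<Rightarrow> ('v, 'a) pexp list" where
  "ladd [] ys = ys"
| "ladd (x # xs) ys = (case ys of [] \<Rightarrow> x # xs | y # ys' \<Rightarrow> PAdd x y # ladd xs ys')"

primrec lmul :: "('v, 'a::zero) pexp list \<Rightarrow> ('v, 'a) pexp list \<Rightarrow> ('v, 'a) pexp list" where
  "lmul [] ys = []"
| "lmul (x # xs) ys = ladd (map (PMul x) ys) (PC 0 # lmul xs ys)"

primrec upoly :: "('a \<Rightarrow> 'b::comm_ring_1) \<Rightarrow> ('v \<Rightarrow> 'b) \<Rightarrow> ('v, 'a) pexp list \<Rightarrow> 'b poly" where
  "upoly \<iota> e [] = 0"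
| "upoly \<iota> e (c # cs) = pCons (pev \<iota> e c) (upoly \<iota> e cs)"

text \<open>Coefficients of an expression read as a polynomial in \<open>v\<close>, lowest first.
  Nothing is normalised: the last entries may evaluate to 0, depending on the parameters, which is
  why the elimination branches on leading coefficients.\<close>

primrec ucoef :: "'v \<Rightarrow> ('v, 'a::zero_neq_one) pexp \<Rightarrow> ('v, 'a) pexp list" where
  "ucoef v (PC c) = [PC c]"
| "ucoef v (PV w) = (if w = v then [PC 0, PC 1] else [PV w])"
| "ucoef v (PAdd p q) = ladd (ucoef v p) (ucoef v q)"
| "ucoef v (PMul p q) = lmul (ucoef v p) (ucoef v q)"

lemma upoly_ladd [simp]: "upoly \<iota> e (ladd xs ys) = upoly \<iota> e xs + upoly \<iota> e ys"
  by (induction xs arbitrary: ys) (auto split: list.splits)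

lemma length_ladd [simp]: "length (ladd xs ys) = max (length xs) (length ys)"
  by (induction xs arbitrary: ys) (auto split: list.splits)

lemma upoly_map_PMul [simp]: "upoly \<iota> e (map (PMul x) ys) = smult (pev \<iota> e x) (upoly \<iota> e ys)"
  by (induction ys) auto

lemma upoly_snoc: "upoly \<iota> e (xs @ [l]) = upoly \<iota> e xs + monom (pev \<iota> e l) (length xs)"
  by (induction xs) (auto simp: monom_Suc monom_0)

lemma upoly_eq_0_iff: "upoly \<iota> e xs = 0 \<longleftrightarrow> (\<forall>c\<in>set xs. pev \<iota> e c = 0)"
  by (induction xs) auto

lemma degree_upoly_less: "xs \<noteq> [] \<Longrightarrow> degree (upoly \<iota> e xs) < length xs"
proof (induction xs)
  case (Cons a xs)
  then show ?case by (cases "xs = []") (auto simp: degree_pCons_eq_if)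
qed auto

context comm_ring_hom
begin

lemma upoly_lmul [simp]: "upoly hom e (lmul xs ys) = upoly hom e xs * upoly hom e ys"
  by (induction xs) auto

lemma upoly_shift: "upoly hom e (replicate k (PC 0) @ xs) = monom 1 k * upoly hom e xs"
  by (induction k) (auto simp: monom_Suc monom_0)

lemma poly_ucoef: "poly (upoly hom e (ucoef v p)) x = pev hom (e(v := x)) p"
  by (induction p) auto

end

text \<open>One step of pseudo-division of \<open>qs @ [m]\<close> by \<open>ps @ [l]\<close>: the leading terms of
  \<open>l * q\<close> and \<open>m * X ^ (length qs - length ps) * p\<close> cancel and are left out.\<close>

definition pred_step :: "('v, 'a::comm_ring_1) pexp list \<Rightarrow> ('v, 'a) pexp \<Rightarrow> ('v, 'a) pexp list \<Rightarrow>
    ('v, 'a) pexp \<Rightarrow> ('v, 'a) pexp list" where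
  "pred_step ps l qs m = ladd (map (PMul l) qs)
     (map (PMul (PMul (PC (-1)) m)) (replicate (length qs - length ps) (PC 0) @ ps))"

lemma length_pred_step: "length ps \<le> length qs \<Longrightarrow> length (pred_step ps l qs m) = length qs"
  by (simp add: pred_step_def)

lemma (in comm_ring_hom) upoly_pred_step:
  assumes "length ps \<le> length qs"
  shows "upoly hom e (pred_step ps l qs m) = smult (pev hom e l) (upoly hom e (qs @ [m]))
     - smult (pev hom e m) (monom 1 (length qs - length ps) * upoly hom e (ps @ [l]))"
proof -
  have eq: "length qs = (length qs - length ps) + length ps"
    using assms by simp
  have "monom (pev hom e m) (length qs) =
      smult (pev hom e m) (monom 1 (length qs - length ps) * monom 1 (length ps))"
    by (subst eq) (simp add: mult_monom smult_monom)
  then show ?thesis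
    unfolding pred_step_def upoly_ladd upoly_map_PMul upoly_shift upoly_snoc
    using eq by (simp add: hom_distribs algebra_simps smult_monom mult_monom smult_add_right)
qed

section \<open>Quantifier-free formulas and their normal form in one variable\<close>

datatype ('v, 'a) qf = QZ "('v, 'a) pexp" | QAnd "('v, 'a) qf" "('v, 'a) qf" | QNot "('v, 'a) qf"

primrec qsat :: "('a \<Rightarrow> 'b::comm_ring_1) \<Rightarrow> ('v \<Rightarrow> 'b) \<Rightarrow> ('v, 'a) qf \<Rightarrow> bool" where
  "qsat \<iota> e (QZ p) \<longleftrightarrow> pev \<iota> e p = 0"
| "qsat \<iota> e (QAnd \<phi> \<psi>) \<longleftrightarrow> qsat \<iota> e \<phi> \<and> qsat \<iota> e \<psi>"
| "qsat \<iota> e (QNot \<phi>) \<longleftrightarrow> \<not> qsat \<iota> e \<phi>"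

primrec qvars :: "('v, 'a) qf \<Rightarrow> 'v set" where
  "qvars (QZ p) = pvars p"
| "qvars (QAnd \<phi> \<psi>) = qvars \<phi> \<union> qvars \<psi>"
| "qvars (QNot \<phi>) = qvars \<phi>"

lemma finite_qvars [simp]: "finite (qvars \<phi>)"
  by (induction \<phi>) auto

lemma qsat_cong: "(\<And>v. v \<in> qvars \<phi> \<Longrightarrow> e v = e' v) \<Longrightarrow> qsat \<iota> e \<phi> = qsat \<iota> e' \<phi>"
proof (induction \<phi>)
  case (QZ p)
  then show ?case using pev_cong[of p e e' \<iota>] by simp
qed auto

text \<open>A field homomorphism is injective, so every test for zero has the same outcome on both
  sides.\<close>

lemma (in field_hom) qsat_hom: "qsat hom (\<lambda>v. hom (e v)) \<phi> = qsat (\<lambda>x. x) e \<phi>"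
proof (induction \<phi>)
  case (QZ p)
  then show ?case using hom_pev[of "\<lambda>x. x" e p] by simp (metis hom_0_iff)
qed auto

definition basic_sat :: "('a \<Rightarrow> 'b::comm_ring_1) \<Rightarrow> ('v \<Rightarrow> 'b) \<Rightarrow>
    ('v, 'a) pexp list list \<times> ('v, 'a) pexp list \<Rightarrow> 'b \<Rightarrow> bool" where
  "basic_sat \<iota> e b x \<longleftrightarrow>
     (\<forall>p\<in>set (fst b). poly (upoly \<iota> e p) x = 0) \<and> poly (upoly \<iota> e (snd b)) x \<noteq> 0"

text \<open>The flag selects the formula itself or its negation, so that negations never have to be
  pushed inwards separately. The inequations of a conjunct are multiplied into a single one, there
  being no zero divisors.\<close>

primrec dnf :: "'v \<Rightarrow> ('v, 'a::zero_neq_one) qf \<Rightarrow> bool \<Rightarrow>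
    (('v, 'a) pexp list list \<times> ('v, 'a) pexp list) list" where
  "dnf v (QZ p) = (\<lambda>b. if b then [([ucoef v p], [PC 1])] else [([], ucoef v p)])"
| "dnf v (QAnd \<phi> \<psi>) = (\<lambda>b. if b
     then [(fst c @ fst d, lmul (snd c) (snd d)). c \<leftarrow> dnf v \<phi> True, d \<leftarrow> dnf v \<psi> True]
     else dnf v \<phi> False @ dnf v \<psi> False)"
| "dnf v (QNot \<phi>) = (\<lambda>b. dnf v \<phi> (\<not> b))"

lemma (in field_hom) qsat_dnf:
  "(\<exists>c\<in>set (dnf v \<phi> b). basic_sat hom e c x) \<longleftrightarrow> qsat hom (e(v := x)) \<phi> = b"
proof (induction \<phi> arbitrary: b)
  case (QZ p)
  then show ?case by (simp add: basic_sat_def poly_ucoef fun_upd_def)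
next
  case (QAnd \<phi> \<psi>)
  show ?case
  proof (cases b)
    case True
    have "(\<exists>c\<in>set (dnf v (QAnd \<phi> \<psi>) b). basic_sat hom e c x) \<longleftrightarrow>
        (\<exists>c\<in>set (dnf v \<phi> True). \<exists>d\<in>set (dnf v \<psi> True). basic_sat hom e c x \<and> basic_sat hom e d x)"
      using True by (auto simp: basic_sat_def ball_Un)
    then show ?thesis using QAnd.IH[of True] True by auto
  next
    case False
    then show ?thesis using QAnd.IH[of False] by (auto simp: bex_Un)
  qed
next
  case (QNot \<phi>)
  show ?case using QNot.IH[of "\<not> b"] by auto
qed

text \<open>If the roots of \<open>p\<close> are roots of \<open>q\<close>, every linear factor of
  \<open>p\<close> divides \<open>q\<close>, and \<open>degree p\<close> copies of \<open>q\<close>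
  absorb all of them. Unsolvability of \<open>p = 0\<close>, \<open>q \<noteq> 0\<close> thus
  becomes a divisibility, which pseudo-division tests uniformly in the parameters.\<close>

lemma poly_nullstellensatz:
  fixes p q :: "'b::alg_closed_field poly"
  assumes "p \<noteq> 0"
  shows "(\<forall>x. poly p x = 0 \<longrightarrow> poly q x = 0) \<longleftrightarrow> p dvd q ^ degree p"
proof
  assume "p dvd q ^ degree p"
  then obtain s where "q ^ degree p = p * s" ..
  then have "poly q x ^ degree p = poly p x * poly s x" for x
    by (metis poly_mult poly_power)
  then show "\<forall>x. poly p x = 0 \<longrightarrow> poly q x = 0"
    by (metis mult_zero_left power_eq_0_iff)
next
  assume "\<forall>x. poly p x = 0 \<longrightarrow> poly q x = 0"
  then show "p dvd q ^ degree p"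
    using assms
  proof (induction "degree p" arbitrary: p)
    case 0
    then show ?case using is_unit_iff_degree by auto
  next
    case (Suc n)
    obtain a where a: "poly p a = 0"
      using alg_closed_imp_poly_has_root[of p] Suc.hyps(2) by auto
    then obtain p' where p': "p = [:-a, 1:] * p'" by (metis dvdE poly_eq_0_iff_dvd)
    have "p' \<noteq> 0" using Suc.prems p' by auto
    then have deg: "degree p = Suc (degree p')"
      using p' degree_mult_eq[of "[:-a,1:]" p'] by simp
    have "p' dvd q ^ degree p'"
      using Suc.prems \<open>p' \<noteq> 0\<close> deg Suc.hyps p' by (intro Suc.hyps(1)) auto
    moreover have "[:-a, 1:] dvd q" using Suc.prems a by (simp add: poly_eq_0_iff_dvd[symmetric])
    ultimately have "[:-a, 1:] * p' dvd q * q ^ degree p'" by (rule mult_dvd_mono[rotated])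
    then show ?case using p' deg by simp
  qed
qed

section \<open>Elimination of one variable by pseudo-division\<close>

lemma degree_upoly_snoc:
  "pev h e l \<noteq> 0 \<Longrightarrow> degree (upoly h e (ps @ [l])) = length ps"
  by (cases "ps = []") (simp_all add: upoly_snoc degree_add_eq_right degree_monom_eq degree_upoly_less monom_0)

context field_hom
begin

text \<open>The step multiplies the dividend by the unit \<open>l\<close> and subtracts a multiple
  of the divisor; neither affects divisibility.\<close>

lemma dvd_pred_step_iff:
  assumes "pev hom e l \<noteq> 0" "length ps \<le> length gs"
  shows "upoly hom e (ps @ [l]) dvd upoly hom e (gs @ [m]) \<longleftrightarrow>
     upoly hom e (ps @ [l]) dvd upoly hom e (pred_step ps l gs m)"
proof -
  let ?p = "upoly hom e (ps @ [l])" and ?g = "upoly hom e (gs @ [m])"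
  define k where "k = monom 1 (length gs - length ps) * ?p"
  have "?p dvd smult (pev hom e m) k" unfolding k_def by (rule dvd_smult) (rule dvd_triv_right)
  then have "?p dvd smult (pev hom e l) ?g - smult (pev hom e m) k \<longleftrightarrow> ?p dvd smult (pev hom e l) ?g"
    by (metis add_diff_cancel_right' diff_add_cancel dvd_add dvd_diff)
  also have "\<dots> \<longleftrightarrow> ?p dvd ?g" using assms(1) by (rule dvd_smult_iff)
  finally show ?thesis unfolding upoly_pred_step[OF assms(2)] k_def by simp
qed

lemma upoly_dvd_iff_eq_0:
  assumes "pev hom e l \<noteq> 0" "length g \<le> length ps"
  shows "upoly hom e (ps @ [l]) dvd upoly hom e g \<longleftrightarrow> upoly hom e g = 0"
proof
  assume dvd: "upoly hom e (ps @ [l]) dvd upoly hom e g"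
  show "upoly hom e g = 0"
  proof (rule ccontr)
    assume "upoly hom e g \<noteq> 0"
    then have "length ps \<le> degree (upoly hom e g)" "g \<noteq> []"
      using dvd_imp_degree_le[OF dvd] degree_upoly_snoc[OF assms(1)] by auto
    then show False using degree_upoly_less[of g hom e] assms(2) by simp
  qed
qed auto

lemma basic_sat_pred_step:
  assumes "pev hom e l \<noteq> 0" "length ps \<le> length qs"
  shows "basic_sat hom e ((ps @ [l]) # (qs @ [m]) # rs, d) x \<longleftrightarrow>
     basic_sat hom e ((ps @ [l]) # pred_step ps l qs m # rs, d) x"
  unfolding basic_sat_def using assms by (auto simp: upoly_pred_step)

end

text \<open>Quantifier elimination is carried out simultaneously in the ground field and in an
  extension, which gives the transfer of solvability between the two fields.\<close>

lemma field_hom_ident: "field_hom (\<lambda>x::'a::field. x)"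
  by unfold_locales auto

lemma comm_ring_hom_ident: "comm_ring_hom (\<lambda>x::'a::comm_ring_1. x)"
  by unfold_locales auto

locale ac_extension = field_hom hom
  for hom :: "'a::{alg_closed_field, field_char_0} \<Rightarrow> 'b::{alg_closed_field, field_char_0}"
begin

text \<open>A single formula with coefficients in the ground field has to define \<open>A\<close>
  there and \<open>B\<close> in the extension. Closure of this relation under the logical
  operations, existential quantifiers included, is all that the transfer between the fields
  needs.\<close>

definition dfn :: "(('v \<Rightarrow> 'a) \<Rightarrow> bool) \<Rightarrow> (('v \<Rightarrow> 'b) \<Rightarrow> bool) \<Rightarrow> bool" where
  "dfn A B \<longleftrightarrow> (\<exists>\<psi>. (\<forall>e. A e \<longleftrightarrow> qsat (\<lambda>x. x) e \<psi>) \<and> (\<forall>e. B e \<longleftrightarrow> qsat hom e \<psi>))"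

lemma dfn_qsat: "dfn (\<lambda>e. qsat (\<lambda>x. x) e \<psi>) (\<lambda>e. qsat hom e \<psi>)"
  unfolding dfn_def by (rule exI[of _ \<psi>]) simp

lemma dfn_zero: "dfn (\<lambda>e. pev (\<lambda>x. x) e p = 0) (\<lambda>e. pev hom e p = 0)"
  unfolding dfn_def by (rule exI[of _ "QZ p"]) simp

lemma dfn_not: "dfn A B \<Longrightarrow> dfn (\<lambda>e. \<not> A e) (\<lambda>e. \<not> B e)"
proof -
  assume "dfn A B"
  then obtain \<psi> where "\<And>e. A e \<longleftrightarrow> qsat (\<lambda>x. x) e \<psi>" "\<And>e. B e \<longleftrightarrow> qsat hom e \<psi>"
    unfolding dfn_def by blast
  then show ?thesis unfolding dfn_def by (intro exI[of _ "QNot \<psi>"]) simp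
qed

lemma dfn_and: "dfn A B \<Longrightarrow> dfn A' B' \<Longrightarrow> dfn (\<lambda>e. A e \<and> A' e) (\<lambda>e. B e \<and> B' e)"
proof -
  assume "dfn A B" "dfn A' B'"
  then obtain \<psi> \<psi>' where "\<And>e. A e \<longleftrightarrow> qsat (\<lambda>x. x) e \<psi>" "\<And>e. B e \<longleftrightarrow> qsat hom e \<psi>"
    "\<And>e. A' e \<longleftrightarrow> qsat (\<lambda>x. x) e \<psi>'" "\<And>e. B' e \<longleftrightarrow> qsat hom e \<psi>'"
    unfolding dfn_def by blast
  then show ?thesis unfolding dfn_def by (intro exI[of _ "QAnd \<psi> \<psi>'"]) simp
qed

lemma dfn_or: "dfn A B \<Longrightarrow> dfn A' B' \<Longrightarrow> dfn (\<lambda>e. A e \<or> A' e) (\<lambda>e. B e \<or> B' e)"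
proof -
  assume "dfn A B" "dfn A' B'"
  from dfn_not[OF dfn_and[OF this[THEN dfn_not]]] show ?thesis by simp
qed

lemma dfn_True: "dfn (\<lambda>e. True) (\<lambda>e. True)"
  using dfn_zero[of "PC 0"] by simp

lemma dfn_False: "dfn (\<lambda>e. False) (\<lambda>e. False)"
  using dfn_not[OF dfn_True] by simp

lemma dfn_ball_list:
  "(\<And>x. x \<in> set xs \<Longrightarrow> dfn (A x) (B x)) \<Longrightarrow> dfn (\<lambda>e. \<forall>x\<in>set xs. A x e) (\<lambda>e. \<forall>x\<in>set xs. B x e)"
proof (induction xs)
  case (Cons x xs)
  then show ?case using dfn_and[of "A x" "B x"] by simp
qed (simp add: dfn_True)

lemma dfn_bex_list:
  "(\<And>x. x \<in> set xs \<Longrightarrow> dfn (A x) (B x)) \<Longrightarrow> dfn (\<lambda>e. \<exists>x\<in>set xs. A x e) (\<lambda>e. \<exists>x\<in>set xs. B x e)"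
proof (induction xs)
  case (Cons x xs)
  then show ?case using dfn_or[of "A x" "B x"] by simp
qed (simp add: dfn_False)

lemma dfn_cases:
  assumes "dfn P P'" "dfn Q Q'" "dfn R R'"
    and "\<And>e. P e \<Longrightarrow> S e \<longleftrightarrow> Q e" "\<And>e. \<not> P e \<Longrightarrow> S e \<longleftrightarrow> R e"
    and "\<And>e. P' e \<Longrightarrow> S' e \<longleftrightarrow> Q' e" "\<And>e. \<not> P' e \<Longrightarrow> S' e \<longleftrightarrow> R' e"
  shows "dfn S S'"
proof -
  have "dfn (\<lambda>e. P e \<and> Q e \<or> \<not> P e \<and> R e) (\<lambda>e. P' e \<and> Q' e \<or> \<not> P' e \<and> R' e)"
    using assms(1-3) by (intro dfn_or dfn_and dfn_not)
  moreover have "S = (\<lambda>e. P e \<and> Q e \<or> \<not> P e \<and> R e)" "S' = (\<lambda>e. P' e \<and> Q' e \<or> \<not> P' e \<and> R' e)"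
    using assms(4-) by (intro ext; metis)+
  ultimately show ?thesis by simp
qed

lemma dfn_upoly_eq_0: "dfn (\<lambda>e. upoly (\<lambda>x. x) e g = 0) (\<lambda>e. upoly hom e g = 0)"
  unfolding upoly_eq_0_iff by (intro dfn_ball_list dfn_zero)

text \<open>Pseudo-division shortens \<open>g\<close> until it is no longer than \<open>ps\<close>;
  a multiple of a polynomial of degree \<open>length ps\<close> can then only be 0. The condition on
  \<open>l\<close> is part of both predicates because the reduction is an equivalence only where
  \<open>l\<close> does not vanish.\<close>

lemma dfn_dvd:
  "dfn (\<lambda>e. pev (\<lambda>x. x) e l \<noteq> 0 \<and> upoly (\<lambda>x. x) e (ps @ [l]) dvd upoly (\<lambda>x. x) e g)
     (\<lambda>e. pev hom e l \<noteq> 0 \<and> upoly hom e (ps @ [l]) dvd upoly hom e g)"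
proof (induction "length g" arbitrary: g rule: less_induct)
  case less
  show ?case
  proof (cases "length g \<le> length ps")
    case True
    have "dfn (\<lambda>e. pev (\<lambda>x. x) e l \<noteq> 0 \<and> upoly (\<lambda>x. x) e g = 0)
     (\<lambda>e. pev hom e l \<noteq> 0 \<and> upoly hom e g = 0)"
      by (intro dfn_and dfn_not dfn_zero dfn_upoly_eq_0)
    then show ?thesis
      by (simp cong: conj_cong add: upoly_dvd_iff_eq_0 field_hom.upoly_dvd_iff_eq_0[OF field_hom_ident] True)
  next
    case False
    then obtain gs m where g: "g = gs @ [m]" by (cases g rule: rev_cases) auto
    with False have len: "length ps \<le> length gs" by simp
    have "dfn (\<lambda>e. pev (\<lambda>x. x) e l \<noteq> 0 \<and> upoly (\<lambda>x. x) e (ps @ [l]) dvd upoly (\<lambda>x. x) e (pred_step ps l gs m))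
     (\<lambda>e. pev hom e l \<noteq> 0 \<and> upoly hom e (ps @ [l]) dvd upoly hom e (pred_step ps l gs m))"
      by (rule less) (simp add: g length_pred_step len)
    then show ?thesis
      unfolding g by (simp cong: conj_cong add: dvd_pred_step_iff[OF _ len] field_hom.dvd_pred_step_iff[OF field_hom_ident _ len])
  qed
qed

lemma upoly_power: "upoly h e (rec_nat [PC 1] (\<lambda>_. lmul d) n) = upoly h e d ^ n"
  if "comm_ring_hom h"
proof -
  interpret h: comm_ring_hom h by fact
  show ?thesis by (induction n) (auto simp: one_pCons)
qed

text \<open>By \<open>poly_nullstellensatz\<close> the solvability is the failure of a divisibility.
  Where \<open>l\<close> is nonzero the degree is \<open>length ps\<close>, so the power of
  \<open>d\<close> to be tested is the same for all parameters.\<close>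

lemma dfn_basic_one:
  "dfn (\<lambda>e. pev (\<lambda>x. x) e l \<noteq> 0 \<and> (\<exists>x. basic_sat (\<lambda>x. x) e ([ps @ [l]], d) x))
     (\<lambda>e. pev hom e l \<noteq> 0 \<and> (\<exists>x. basic_sat hom e ([ps @ [l]], d) x))"
proof -
  have eq: "(\<exists>x. basic_sat h e ([ps @ [l]], d) x) \<longleftrightarrow>
     \<not> (pev h e l \<noteq> 0 \<and> upoly h e (ps @ [l]) dvd upoly h e (rec_nat [PC 1] (\<lambda>_. lmul d) (length ps)))"
    if "pev h e l \<noteq> 0" "comm_ring_hom h" for h :: "'a \<Rightarrow> 'b" and e
  proof -
    have "upoly h e (ps @ [l]) \<noteq> 0" using that(1) by (auto simp: upoly_eq_0_iff)
    from poly_nullstellensatz[OF this, of "upoly h e d"] show ?thesis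
      using that by (auto simp: basic_sat_def upoly_power degree_upoly_snoc)
  qed
  have eq': "(\<exists>x. basic_sat h e ([ps @ [l]], d) x) \<longleftrightarrow>
     \<not> (pev h e l \<noteq> 0 \<and> upoly h e (ps @ [l]) dvd upoly h e (rec_nat [PC 1] (\<lambda>_. lmul d) (length ps)))"
    if "pev h e l \<noteq> 0" "comm_ring_hom h" for h :: "'a \<Rightarrow> 'a" and e
  proof -
    have "upoly h e (ps @ [l]) \<noteq> 0" using that(1) by (auto simp: upoly_eq_0_iff)
    from poly_nullstellensatz[OF this, of "upoly h e d"] show ?thesis
      using that by (auto simp: basic_sat_def upoly_power degree_upoly_snoc)
  qed
  let ?g = "rec_nat [PC 1] (\<lambda>_. lmul d) (length ps)"
  have "dfn (\<lambda>e. pev (\<lambda>x. x) e l \<noteq> 0 \<and> \<not> (pev (\<lambda>x. x) e l \<noteq> 0 \<and> upoly (\<lambda>x. x) e (ps @ [l]) dvd upoly (\<lambda>x. x) e ?g))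
     (\<lambda>e. pev hom e l \<noteq> 0 \<and> \<not> (pev hom e l \<noteq> 0 \<and> upoly hom e (ps @ [l]) dvd upoly hom e ?g))"
    by (rule dfn_and[OF dfn_not[OF dfn_zero] dfn_not[OF dfn_dvd]])
  then show ?thesis
    using eq[OF _ comm_ring_hom_axioms] eq'[OF _ comm_ring_hom_ident] by (simp cong: conj_cong)
qed

lemma basic_sat_pop:
  "pev h e l = 0 \<Longrightarrow> basic_sat h e ((ps @ [l]) # rs, d) x \<longleftrightarrow> basic_sat h e (ps # rs, d) x"
  by (simp add: basic_sat_def upoly_snoc)

lemma basic_sat_cong: "set ps = set qs \<Longrightarrow> basic_sat h e (ps, d) x \<longleftrightarrow> basic_sat h e (qs, d) x"
  by (simp add: basic_sat_def)

text \<open>Euclid's algorithm with indeterminate coefficients, applied to a shortest equation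
  \<open>ps @ [l]\<close>. Where \<open>l\<close> vanishes, it is dropped; elsewhere the equation
  reduces another one, until only one equation is left.\<close>

lemma dfn_basic:
  "dfn (\<lambda>e. \<exists>x. basic_sat (\<lambda>x. x) e (Ps, d) x) (\<lambda>e. \<exists>x. basic_sat hom e (Ps, d) x)"
\<comment> \<open>The \<open>Suc\<close> makes the measure drop also when an empty coefficient list,
  that is the equation 0 = 0, is discarded.\<close>
proof (induction "sum_list (map (\<lambda>p. Suc (length p)) Ps)" arbitrary: Ps rule: less_induct)
  case less
  show ?case
  proof (cases Ps)
    case Nil
    have "(\<exists>x. basic_sat h e (Ps, d) x) \<longleftrightarrow> \<not> (\<forall>c\<in>set d. pev h e c = 0)" for h :: "'a \<Rightarrow> 'a" and e
      by (metis Nil basic_sat_def empty_iff fst_conv list.set(1) poly_all_0_iff_0 snd_conv upoly_eq_0_iff)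
    moreover have "(\<exists>x. basic_sat h e (Ps, d) x) \<longleftrightarrow> \<not> (\<forall>c\<in>set d. pev h e c = 0)" for h :: "'a \<Rightarrow> 'b" and e
      by (metis Nil basic_sat_def empty_iff fst_conv list.set(1) poly_all_0_iff_0 snd_conv upoly_eq_0_iff)
    ultimately show ?thesis by (simp only:) (intro dfn_not dfn_ball_list dfn_zero)
  next
    case (Cons p0 Ps0)
    define m where "m = Min (length ` set Ps)"
    obtain p where p: "p \<in> set Ps" "length p = m"
      using Min_in[of "length ` set Ps"] Cons unfolding m_def by fastforce
    have min: "m \<le> length q" if "q \<in> set Ps" for q using that unfolding m_def by simp
    define rest where "rest = remove1 p Ps"
    have perm: "mset Ps = add_mset p (mset rest)" using p(1) by (simp add: rest_def)
    have set: "set Ps = set (p # rest)" using arg_cong[OF perm, of set_mset] by simp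
    have size: "sum_list (map (\<lambda>p. Suc (length p)) Ps) = Suc (length p) + sum_list (map (\<lambda>p. Suc (length p)) rest)"
      using arg_cong[OF perm, of "\<lambda>M. \<Sum>p\<in>#M. Suc (length p)"] by (simp flip: sum_mset_sum_list)
    note eq = basic_sat_cong[OF set]
    show ?thesis
    proof (cases p rule: rev_cases)
      case Nil
      have "dfn (\<lambda>e. \<exists>x. basic_sat (\<lambda>x. x) e (rest, d) x) (\<lambda>e. \<exists>x. basic_sat hom e (rest, d) x)"
        by (rule less) (simp add: size)
      then show ?thesis unfolding eq by (simp add: basic_sat_def Nil)
    next
      case (snoc ps l)
      have zero: "dfn (\<lambda>e. \<exists>x. basic_sat (\<lambda>x. x) e (ps # rest, d) x) (\<lambda>e. \<exists>x. basic_sat hom e (ps # rest, d) x)"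
        by (rule less) (simp add: size snoc)
      have "dfn (\<lambda>e. pev (\<lambda>x. x) e l \<noteq> 0 \<and> (\<exists>x. basic_sat (\<lambda>x. x) e ((ps @ [l]) # rest, d) x))
        (\<lambda>e. pev hom e l \<noteq> 0 \<and> (\<exists>x. basic_sat hom e ((ps @ [l]) # rest, d) x))"
      proof (cases rest)
        case Nil
        then show ?thesis using dfn_basic_one by simp
      next
        case (Cons q rest')
        have "q \<in> set Ps" using set Cons by auto
        then have "length ps < length q" using min p snoc by fastforce
        then obtain qs m' where q: "q = qs @ [m']" "length ps \<le> length qs"
          by (cases q rule: rev_cases) auto
        have "dfn (\<lambda>e. \<exists>x. basic_sat (\<lambda>x. x) e ((ps @ [l]) # pred_step ps l qs m' # rest', d) x)
          (\<lambda>e. \<exists>x. basic_sat hom e ((ps @ [l]) # pred_step ps l qs m' # rest', d) x)"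
          by (rule less) (simp add: size snoc Cons q length_pred_step)
        then have "dfn (\<lambda>e. pev (\<lambda>x. x) e l \<noteq> 0 \<and> (\<exists>x. basic_sat (\<lambda>x. x) e ((ps @ [l]) # pred_step ps l qs m' # rest', d) x))
          (\<lambda>e. pev hom e l \<noteq> 0 \<and> (\<exists>x. basic_sat hom e ((ps @ [l]) # pred_step ps l qs m' # rest', d) x))"
          by (intro dfn_and dfn_not dfn_zero)
        then show ?thesis unfolding Cons q(1)
          by (simp only: basic_sat_pred_step[OF _ q(2)] field_hom.basic_sat_pred_step[OF field_hom_ident _ q(2)] not_False_eq_True cong: conj_cong)
      qed
      then show ?thesis unfolding eq unfolding snoc
        by (rule dfn_cases[OF dfn_zero[of l] zero]) (auto simp: basic_sat_pop)
    qed
  qed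
qed

lemma dfn_ex:
  assumes "dfn A B"
  shows "dfn (\<lambda>e. \<exists>x. A (e(v := x))) (\<lambda>e. \<exists>x. B (e(v := x)))"
proof -
  obtain \<psi> where \<psi>: "\<And>e. A e \<longleftrightarrow> qsat (\<lambda>x. x) e \<psi>" "\<And>e. B e \<longleftrightarrow> qsat hom e \<psi>"
    using assms unfolding dfn_def by blast
  have "dfn (\<lambda>e. \<exists>c\<in>set (dnf v \<psi> True). \<exists>x. basic_sat (\<lambda>x. x) e (fst c, snd c) x)
      (\<lambda>e. \<exists>c\<in>set (dnf v \<psi> True). \<exists>x. basic_sat hom e (fst c, snd c) x)"
    by (intro dfn_bex_list dfn_basic)
  moreover have "(\<exists>x. A (e(v := x))) \<longleftrightarrow> (\<exists>c\<in>set (dnf v \<psi> True). \<exists>x. basic_sat (\<lambda>x. x) e (fst c, snd c) x)" for e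
    using field_hom.qsat_dnf[OF field_hom_ident, of v \<psi> True e] unfolding \<psi> prod.collapse by blast
  moreover have "(\<exists>x. B (e(v := x))) \<longleftrightarrow> (\<exists>c\<in>set (dnf v \<psi> True). \<exists>x. basic_sat hom e (fst c, snd c) x)" for e
    using qsat_dnf[of v \<psi> True e] unfolding \<psi> prod.collapse by blast
  ultimately show ?thesis by simp
qed

lemma ex_override_on_insert:
  "(\<exists>x. P (override_on e x (insert v V))) \<longleftrightarrow> (\<exists>y. \<exists>x. P (override_on (e(v := y)) x V))"
proof
  assume "\<exists>x. P (override_on e x (insert v V))"
  then obtain x where "P (override_on e x (insert v V))" ..
  moreover have "override_on e x (insert v V) = override_on (e(v := x v)) x V"
    by (auto simp: override_on_def)
  ultimately show "\<exists>y. \<exists>x. P (override_on (e(v := y)) x V)" by auto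
next
  assume "\<exists>y. \<exists>x. P (override_on (e(v := y)) x V)"
  then obtain y x where "P (override_on (e(v := y)) x V)" by blast
  moreover have "override_on (e(v := y)) x V = override_on e (\<lambda>w. if w = v \<and> v \<notin> V then y else x w) (insert v V)"
    by (auto simp: override_on_def)
  ultimately show "\<exists>x. P (override_on e x (insert v V))" by auto
qed

lemma dfn_exs:
  assumes "finite V" "dfn A B"
  shows "dfn (\<lambda>e. \<exists>x. A (override_on e x V)) (\<lambda>e. \<exists>x. B (override_on e x V))"
  using assms(1)
proof induction
  case empty
  then show ?case using assms(2) by (simp add: override_on_def)
next
  case (insert v V)
  show ?case
    using dfn_ex[OF insert.IH, of v] by (simp only: ex_override_on_insert[where P = A] ex_override_on_insert[where P = B])
qed

theorem transfer_sat:
  assumes "qsat hom e \<psi>"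
  shows "\<exists>e'. qsat (\<lambda>x. x) e' \<psi>"
proof -
  define A where "A e' = (\<exists>x. qsat (\<lambda>x. x) (override_on e' x (qvars \<psi>)) \<psi>)" for e'
  define B where "B e' = (\<exists>x. qsat hom (override_on e' x (qvars \<psi>)) \<psi>)" for e'
  have "dfn A B" 
    using dfn_exs[OF finite_qvars dfn_qsat, of \<psi> \<psi>] unfolding A_def B_def by simp
  then obtain \<theta> where \<theta>: "\<And>e. A e \<longleftrightarrow> qsat (\<lambda>x. x) e \<theta>" "\<And>e. B e \<longleftrightarrow> qsat hom e \<theta>"
    unfolding dfn_def by blast
  \<comment> \<open>All variables of the formula are bound in \<open>B\<close>, so any environment
    will do. The image of the zero environment is chosen because \<open>qsat_hom\<close> compares
    the two fields there.\<close>
  have "B (\<lambda>v. hom 0)" unfolding B_def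
    using assms qsat_cong[of \<psi> "override_on (\<lambda>v. hom 0) e (qvars \<psi>)" e hom] by auto
  then have "A (\<lambda>v. 0)" unfolding \<theta> qsat_hom .
  then show ?thesis unfolding A_def by blast
qed

end

section \<open>Generic points\<close>

abbreviation pval :: "('v \<Rightarrow> 'a::comm_ring_1) \<Rightarrow> ('v, 'a) pexp \<Rightarrow> 'a" where
  "pval \<equiv> pev (\<lambda>x. x)"

text \<open>Validity on a nonempty basic open set of the affine space with coordinates
  \<open>'v\<close>.\<close>

definition generic :: "(('v \<Rightarrow> 'a::comm_ring_1) \<Rightarrow> bool) \<Rightarrow> bool" where
  "generic P \<longleftrightarrow> (\<exists>Q. (\<exists>e. pval e Q \<noteq> 0) \<and> (\<forall>e. pval e Q \<noteq> 0 \<longrightarrow> P e))"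

lemma poly_pev_line:
  fixes e e' :: "'v \<Rightarrow> 'a::comm_ring_1"
  shows "poly (pev (\<lambda>c. [:c:]) (\<lambda>v. [:e v, e' v - e v:]) p) t = pval (\<lambda>v. e v + t * (e' v - e v)) p"
  by (induction p) auto

text \<open>Irreducibility of affine space. On the line through \<open>e\<close> and
  \<open>e'\<close> both expressions become nonzero polynomials in one variable, and over an
  infinite field their product has a non-root.\<close>

lemma pval_mult_nonzero:
  fixes p q :: "('v, 'a::field_char_0) pexp"
  assumes "pval e p \<noteq> 0" "pval e' q \<noteq> 0"
  shows "\<exists>e''. pval e'' p \<noteq> 0 \<and> pval e'' q \<noteq> 0"
proof -
  let ?l = "pev (\<lambda>c. [:c:]) (\<lambda>v. [:e v, e' v - e v:])"
  have "poly (?l p) 0 \<noteq> 0" "poly (?l q) 1 \<noteq> 0"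
    unfolding poly_pev_line using assms by simp_all
  then have "?l p * ?l q \<noteq> 0" by auto
  then obtain t where "poly (?l p * ?l q) t \<noteq> 0" using poly_all_0_iff_0 by blast
  then show ?thesis by (auto simp: poly_pev_line)
qed

lemma generic_conj:
  fixes P :: "('v \<Rightarrow> 'a::field_char_0) \<Rightarrow> bool"
  assumes "generic P" "generic P'"
  shows "generic (\<lambda>e. P e \<and> P' e)"
proof -
  obtain p q where pq: "\<exists>e. pval e p \<noteq> 0" "\<exists>e. pval e q \<noteq> 0"
    "\<And>e. pval e p \<noteq> 0 \<Longrightarrow> P e" "\<And>e. pval e q \<noteq> 0 \<Longrightarrow> P' e"
    using assms unfolding generic_def by blast
  obtain e where "pval e p \<noteq> 0" "pval e q \<noteq> 0" using pval_mult_nonzero pq(1,2) by blast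
  then have "pval e (PMul p q) \<noteq> 0" by simp
  moreover have "\<forall>e. pval e (PMul p q) \<noteq> 0 \<longrightarrow> P e \<and> P' e" using pq(3,4) by auto
  ultimately show ?thesis unfolding generic_def by blast
qed

lemma generic_mono: "generic P \<Longrightarrow> (\<And>e. P e \<Longrightarrow> P' e) \<Longrightarrow> generic P'"
  unfolding generic_def by blast

lemma generic_True: "generic (\<lambda>e. True)"
  unfolding generic_def by (rule exI[of _ "PC 1"]) simp

lemma generic_nonzero: "pval e Q \<noteq> 0 \<Longrightarrow> generic (\<lambda>e. pval e Q \<noteq> 0)"
  unfolding generic_def by blast

lemma generic_ex: "generic P \<Longrightarrow> \<exists>e. P e"
  unfolding generic_def by blast

lemma generic_ball:
  fixes P :: "'b \<Rightarrow> ('v \<Rightarrow> 'a::field_char_0) \<Rightarrow> bool"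
  assumes "finite I" "\<And>i. i \<in> I \<Longrightarrow> generic (P i)"
  shows "generic (\<lambda>e. \<forall>i\<in>I. P i e)"
  using assms
proof (induction I)
  case (insert i I)
  then have "generic (\<lambda>e. P i e \<and> (\<forall>i\<in>I. P i e))" by (intro generic_conj) auto
  then show ?case by simp
qed (simp add: generic_True)

text \<open>An equation either holds identically or fails generically, and finite conjunctions
  preserve the alternative because generic conditions can be combined.\<close>

lemma generic_dichotomy:
  fixes \<psi> :: "('v, 'a::field_char_0) qf"
  shows "generic (\<lambda>e. qsat (\<lambda>x. x) e \<psi>) \<or> generic (\<lambda>e. \<not> qsat (\<lambda>x. x) e \<psi>)"
proof (induction \<psi>)
  case (QZ p)
  show ?case
  proof (cases "\<exists>e. pval e p \<noteq> 0")
    case True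
    then show ?thesis using generic_nonzero by auto
  next
    case False
    then show ?thesis by (simp add: generic_True)
  qed
next
  case (QAnd \<phi> \<psi>)
  show ?case
  proof (cases "generic (\<lambda>e. qsat (\<lambda>x. x) e \<phi>) \<and> generic (\<lambda>e. qsat (\<lambda>x. x) e \<psi>)")
    case True
    then have "generic (\<lambda>e. qsat (\<lambda>x. x) e \<phi> \<and> qsat (\<lambda>x. x) e \<psi>)"
      by (intro generic_conj) auto
    then show ?thesis by simp
  next
    case False
    then consider "generic (\<lambda>e. \<not> qsat (\<lambda>x. x) e \<phi>)" | "generic (\<lambda>e. \<not> qsat (\<lambda>x. x) e \<psi>)"
      using QAnd by blast
    then have "generic (\<lambda>e. \<not> qsat (\<lambda>x. x) e (QAnd \<phi> \<psi>))"
      by cases (auto elim: generic_mono)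
    then show ?thesis ..
  qed
qed auto

text \<open>The variables outside the range of \<open>f\<close> are frozen at a point
  \<open>e0\<close> where \<open>Q\<close> does not vanish, so that \<open>Q\<close> stays nonzero
  as an expression in the others.\<close>

lemma generic_reindex:
  fixes P :: "('v \<Rightarrow> 'a::field_char_0) \<Rightarrow> bool"
  assumes "generic P" "inj f" "\<And>e. P e \<Longrightarrow> P' (\<lambda>w. e (f w))"
  shows "generic P'"
proof -
  obtain Q e0 where Q: "pval e0 Q \<noteq> 0" "\<And>e. pval e Q \<noteq> 0 \<Longrightarrow> P e"
    using assms(1) unfolding generic_def by blast
  define \<sigma> where "\<sigma> v = (if v \<in> range f then PV (inv_into UNIV f v) else PC (e0 v))" for v
  define ext where "ext e v = (if v \<in> range f then e (inv_into UNIV f v) else e0 v)" for e v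
  have val: "pval e (psubst \<sigma> Q) = pval (ext e) Q" for e
    unfolding pev_psubst by (rule pev_cong) (simp add: \<sigma>_def ext_def)
  have "ext (\<lambda>w. e0 (f w)) = e0" by (auto simp: ext_def f_inv_into_f)
  then have "pval (\<lambda>w. e0 (f w)) (psubst \<sigma> Q) \<noteq> 0" unfolding val using Q(1) by simp
  moreover have "P' e" if "pval e (psubst \<sigma> Q) \<noteq> 0" for e
  proof -
    have "P (ext e)" using that Q(2) unfolding val by blast
    moreover have "(\<lambda>w. ext e (f w)) = e" using assms(2) by (auto simp: ext_def)
    ultimately show ?thesis using assms(3) by fastforce
  qed
  ultimately show ?thesis unfolding generic_def by blast
qed

section \<open>Algebraic dependence of \<open>n + 1\<close> polynomials in \<open>n\<close> variables\<close>

primrec psum :: "('i \<Rightarrow> ('v, 'a::zero) pexp) \<Rightarrow> 'i list \<Rightarrow> ('v, 'a) pexp" where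
  "psum f [] = PC 0"
| "psum f (x # xs) = PAdd (f x) (psum f xs)"

primrec pprod :: "('i \<Rightarrow> ('v, 'a::one) pexp) \<Rightarrow> 'i list \<Rightarrow> ('v, 'a) pexp" where
  "pprod f [] = PC 1"
| "pprod f (x # xs) = PMul (f x) (pprod f xs)"

abbreviation ppow :: "('v, 'a::one) pexp \<Rightarrow> nat \<Rightarrow> ('v, 'a) pexp" where
  "ppow p n \<equiv> pprod (\<lambda>_. p) (replicate n ())"

lemma pvars_psum: "pvars (psum f xs) = (\<Union>x\<in>set xs. pvars (f x))"
  by (induction xs) auto

lemma pvars_pprod: "pvars (pprod f xs) = (\<Union>x\<in>set xs. pvars (f x))"
  by (induction xs) auto

lemma sum_list_upt: "(\<Sum>i\<leftarrow>[0..<n]. f i) = (\<Sum>i<n. f i)"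
  by (induction n) (auto simp: algebra_simps)

lemma prod_list_upt: "(\<Prod>i\<leftarrow>[0..<n]. f i) = (\<Prod>i<n. f i :: 'a::comm_monoid_mult)"
  by (induction n) auto

lemma (in comm_ring_hom) pev_psum: "pev hom e (psum f xs) = (\<Sum>x\<leftarrow>xs. pev hom e (f x))"
  by (induction xs) auto

lemma (in comm_ring_hom) pev_pprod: "pev hom e (pprod f xs) = (\<Prod>x\<leftarrow>xs. pev hom e (f x))"
  by (induction xs) auto

lemma (in comm_ring_hom) pev_ppow: "pev hom e (ppow p n) = pev hom e p ^ n"
  by (induction n) auto

lemmas pval_psum = comm_ring_hom.pev_psum[OF comm_ring_hom_ident]
lemmas pval_pprod = comm_ring_hom.pev_pprod[OF comm_ring_hom_ident]
lemmas pval_ppow = comm_ring_hom.pev_ppow[OF comm_ring_hom_ident]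

section \<open>Polynomial functions of bounded degree in each variable\<close>

definition fscale :: "'a::field \<Rightarrow> ('b \<Rightarrow> 'a) \<Rightarrow> 'b \<Rightarrow> 'a" where
  "fscale c f = (\<lambda>x. c * f x)"

global_interpretation fvs: vector_space "fscale :: 'a::field \<Rightarrow> ('b \<Rightarrow> 'a) \<Rightarrow> _"
  by unfold_locales (auto simp: fscale_def algebra_simps fun_eq_iff)

definition monofun :: "'v set \<Rightarrow> ('v \<Rightarrow> nat) \<Rightarrow> ('v \<Rightarrow> 'a::field) \<Rightarrow> 'a" where
  "monofun V m = (\<lambda>e. \<Prod>v\<in>V. e v ^ m v)"

definition polyspace :: "'v set \<Rightarrow> nat \<Rightarrow> (('v \<Rightarrow> 'a::field) \<Rightarrow> 'a) set" where
  "polyspace V D = fvs.span (monofun V ` (V \<rightarrow>\<^sub>E {..D}))"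

lemma polyspace_mono: "D \<le> D' \<Longrightarrow> polyspace V D \<subseteq> polyspace V D'"
  unfolding polyspace_def by (intro fvs.span_mono image_mono PiE_mono) auto

lemma monofun_in_polyspace: "(\<And>v. v \<in> V \<Longrightarrow> m v \<le> D) \<Longrightarrow> monofun V m \<in> polyspace V D"
proof -
  assume "\<And>v. v \<in> V \<Longrightarrow> m v \<le> D"
  moreover have "monofun V m = monofun V (restrict m V)"
    by (simp add: monofun_def fun_eq_iff)
  ultimately show ?thesis unfolding polyspace_def
    by (auto intro!: fvs.span_base)
qed

lemma polyspace_const: "(\<lambda>e. c) \<in> polyspace V D"
proof -
  have "fscale c (monofun V (\<lambda>_. 0)) \<in> polyspace V D"
    using monofun_in_polyspace[of V "\<lambda>_. 0" D] fvs.span_scale unfolding polyspace_def by blast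
  then show ?thesis by (simp add: fscale_def monofun_def)
qed

lemma polyspace_add: "f \<in> polyspace V D \<Longrightarrow> g \<in> polyspace V D \<Longrightarrow> (\<lambda>e. f e + g e) \<in> polyspace V D"
  using fvs.span_add[of f _ g] unfolding polyspace_def plus_fun_def .

lemma polyspace_mult:
  assumes "f \<in> polyspace V D" "g \<in> polyspace V D'"
  shows "(\<lambda>e. f e * g e) \<in> polyspace V (D + D')"
proof -
  have mono: "(\<lambda>e. monofun V m e * g e) \<in> polyspace V (D + D')" if m: "m \<in> V \<rightarrow>\<^sub>E {..D}" for m
    using assms(2) unfolding polyspace_def
  proof (induction rule: fvs.span_induct_alt)
    case base
    then show ?case using fvs.span_zero by (simp add: zero_fun_def)
  next
    case (step c x y)
    obtain m' where m': "x = monofun V m'" "m' \<in> V \<rightarrow>\<^sub>E {..D'}" using step by auto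
    have "monofun V (\<lambda>v. m v + m' v) \<in> polyspace V (D + D')"
      using m m' by (intro monofun_in_polyspace add_mono) (auto simp: PiE_iff)
    then have "fscale c (monofun V (\<lambda>v. m v + m' v)) + (\<lambda>e. monofun V m e * y e) \<in> polyspace V (D + D')"
      using step fvs.span_scale fvs.span_add unfolding polyspace_def by blast
    moreover have "(\<lambda>e. monofun V m e * (fscale c x + y) e) =
        fscale c (monofun V (\<lambda>v. m v + m' v)) + (\<lambda>e. monofun V m e * y e)"
      unfolding m' by (simp add: fun_eq_iff fscale_def monofun_def power_add prod.distrib algebra_simps)
    ultimately show ?case unfolding polyspace_def by simp
  qed
  show ?thesis using assms(1) unfolding polyspace_def
  proof (induction rule: fvs.span_induct_alt)
    case base
    then show ?case using fvs.span_zero by (simp add: zero_fun_def)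
  next
    case (step c x y)
    have "fscale c (\<lambda>e. x e * g e) + (\<lambda>e. y e * g e) \<in> polyspace V (D + D')"
      using step mono fvs.span_scale fvs.span_add unfolding polyspace_def by blast
    moreover have "(\<lambda>e. (fscale c x + y) e * g e) = fscale c (\<lambda>e. x e * g e) + (\<lambda>e. y e * g e)"
      by (simp add: fun_eq_iff fscale_def algebra_simps)
    ultimately show ?case unfolding polyspace_def by simp
  qed
qed

lemma polyspace_power: "f \<in> polyspace V D \<Longrightarrow> (\<lambda>e. f e ^ k) \<in> polyspace V (k * D)"
  by (induction k) (auto simp: polyspace_const intro: polyspace_mult)

lemma polyspace_prod:
  "(\<And>i. i < (k::nat) \<Longrightarrow> f i \<in> polyspace V D) \<Longrightarrow> (\<lambda>e. \<Prod>i<k. f i e) \<in> polyspace V (k * D)"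
proof (induction k)
  case (Suc k)
  then have "(\<lambda>e. (\<Prod>i<k. f i e) * f k e) \<in> polyspace V (k * D + D)"
    by (intro polyspace_mult) auto
  then show ?case by (simp add: add.commute)
qed (simp add: polyspace_const)

lemma pval_in_polyspace:
  fixes p :: "('v, 'a::field) pexp"
  assumes "finite V" "pvars p \<subseteq> V"
  shows "\<exists>D. (\<lambda>e. pval e p) \<in> polyspace V D"
  using assms(2)
proof (induction p)
  case (PC c)
  then show ?case using polyspace_const by auto
next
  case (PV v)
  have "monofun V (\<lambda>w. if w = v then 1 else 0) = (\<lambda>e :: 'v \<Rightarrow> 'a. e v)"
    using PV assms(1) by (auto simp: monofun_def fun_eq_iff if_distrib[of "power _"] prod.delta cong: if_cong)
  moreover have "monofun V (\<lambda>w. if w = v then 1 else 0) \<in> (polyspace V 1 :: (('v \<Rightarrow> 'a) \<Rightarrow> 'a) set)"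
    by (rule monofun_in_polyspace) simp
  ultimately have "(\<lambda>e :: 'v \<Rightarrow> 'a. e v) \<in> polyspace V 1" by simp
  then show ?case unfolding pev.simps ..
next
  case (PAdd p q)
  then obtain D D' where "(\<lambda>e. pval e p) \<in> polyspace V D" "(\<lambda>e. pval e q) \<in> polyspace V D'" by auto
  then have "(\<lambda>e. pval e p) \<in> polyspace V (max D D')" "(\<lambda>e. pval e q) \<in> polyspace V (max D D')"
    using polyspace_mono[of _ "max D D'"] by (meson max.cobounded1 max.cobounded2 subsetD)+
  then show ?case using polyspace_add by fastforce
next
  case (PMul p q)
  then show ?case using polyspace_mult by fastforce
qed

lemma sum_digits: "(\<Sum>i<k. (m div b ^ i mod b) * b ^ i) = m mod (b::nat) ^ k"
proof (induction k)
  case (Suc k)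
  have "m mod b ^ Suc k = m mod (b ^ k * b)" by (simp add: mult.commute)
  also have "\<dots> = b ^ k * (m div b ^ k mod b) + m mod b ^ k" by (rule mod_mult2_eq)
  finally show ?case using Suc by (simp add: mult.commute del: power_Suc)
qed auto

lemma sum_fun_app: "(\<Sum>i\<in>A. f i) x = (\<Sum>i\<in>A. f i x)"
  by (induction A rule: infinite_finite_induct) auto

text \<open>The products of the n + 1 polynomials with exponents at most \<open>N\<close> are
  indexed by \<open>(N + 1) ^ (n + 1)\<close> vectors but lie in a span of
  \<open>((n + 1) * N * D + 1) ^ n\<close> monomials. For large \<open>N\<close> the latter number
  is smaller, and a linear relation between the products is the polynomial sought.\<close>

lemma algebraically_dependent:
  fixes f :: "nat \<Rightarrow> ('v, 'a::field_char_0) pexp"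
  assumes V: "finite V" and f: "\<And>i. i \<le> card V \<Longrightarrow> pvars (f i) \<subseteq> V"
  shows "\<exists>P. pvars P \<subseteq> {..card V} \<and> (\<exists>e. pval e P \<noteq> 0) \<and> (\<forall>e. pval (\<lambda>i. pval e (f i)) P = 0)"
proof -
  define n where "n = card V"
  have "\<exists>D. \<forall>i\<le>k. (\<lambda>e. pval e (f i)) \<in> polyspace V D" if "k \<le> n" for k
    using that
  proof (induction k)
    case 0
    then show ?case using pval_in_polyspace[OF V f[of 0]] by auto
  next
    case (Suc k)
    then obtain D D' where D: "\<forall>i\<le>k. (\<lambda>e. pval e (f i)) \<in> polyspace V D"
      "(\<lambda>e. pval e (f (Suc k))) \<in> polyspace V D'"
      using pval_in_polyspace[OF V f[of "Suc k"]] unfolding n_def by auto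
    have "(\<lambda>e. pval e (f i)) \<in> polyspace V (max D D')" if "i \<le> Suc k" for i
      using D polyspace_mono[of D "max D D'" V] polyspace_mono[of D' "max D D'" V] that
      by (cases "i = Suc k") auto
    then show ?case by blast
  qed
  then obtain D where D: "\<And>i. i \<le> n \<Longrightarrow> (\<lambda>e. pval e (f i)) \<in> polyspace V D" by blast
  \<comment> \<open>These values give \<open>(Suc n * N * D + 1) ^ n \<le> (C * Suc N) ^ n = N * Suc
    N ^ n < M\<close>, the inequality that the count needs.\<close>
  define C where "C = Suc n * D + 1"
  define N where "N = C ^ n"
  define M where "M = Suc N ^ Suc n"
  \<comment> \<open>The vectors of exponents are numbered by \<open>m < M\<close> through its digits
    in base \<open>Suc N\<close>.\<close>
  define dig where "dig m i = m div Suc N ^ i mod Suc N" for m i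
  define B where "B m = (\<lambda>e. \<Prod>i<Suc n. pval e (f i) ^ dig m i)" for m
  let ?mono = "monofun V ` (V \<rightarrow>\<^sub>E {..Suc n * (N * D)}) :: (('v \<Rightarrow> 'a) \<Rightarrow> 'a) set"
  have B: "B m \<in> fvs.span ?mono" for m
    unfolding B_def polyspace_def[symmetric]
  proof (rule polyspace_prod)
    fix i assume "i < Suc n"
    then have "(\<lambda>e. pval e (f i) ^ dig m i) \<in> polyspace V (dig m i * D)"
      using D by (intro polyspace_power) auto
    moreover have "dig m i \<le> N" unfolding dig_def by (simp add: less_Suc_eq_le[symmetric])
    ultimately show "(\<lambda>e. pval e (f i) ^ dig m i) \<in> polyspace V (N * D)"
      using polyspace_mono[of "dig m i * D" "N * D" V] by auto
  qed
  have fin: "finite ?mono" using V by (intro finite_imageI finite_PiE) auto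
  have "card ?mono \<le> card (V \<rightarrow>\<^sub>E {..Suc n * (N * D)})"
    using V by (intro card_image_le finite_PiE) auto
  also have "\<dots> = Suc (Suc n * (N * D)) ^ n" using V by (simp add: card_PiE n_def)
  also have "\<dots> \<le> (C * Suc N) ^ n" unfolding C_def by (intro power_mono) (auto simp: algebra_simps)
  also have "\<dots> < M" unfolding M_def power_Suc power_mult_distrib N_def[symmetric] by simp
  finally have card: "card ?mono < M" .
  have "\<exists>a. (\<exists>m<M. a m \<noteq> 0) \<and> (\<forall>e. (\<Sum>m<M. a m * B m e) = 0)"
  proof (cases "inj_on B {..<M}")
    case True
    have "fvs.dependent (B ` {..<M})"
    proof (rule ccontr)
      assume "fvs.independent (B ` {..<M})"
      then have "card (B ` {..<M}) \<le> card ?mono"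
        using fvs.independent_span_bound[OF fin, of "B ` {..<M}"] B by blast
      then show False using card True by (simp add: card_image)
    qed
    then obtain u where u: "\<exists>v\<in>B ` {..<M}. u v \<noteq> 0" "(\<Sum>v\<in>B ` {..<M}. fscale (u v) v) = 0"
      using fvs.dependent_finite[of "B ` {..<M}"] by auto
    have "(\<Sum>m<M. fscale (u (B m)) (B m)) = 0"
      using u(2) True by (simp add: sum.reindex)
    then have "(\<Sum>m<M. u (B m) * B m e) = 0" for e
      by (metis (no_types, lifting) fscale_def sum.cong sum_fun_app zero_fun_apply)
    then show ?thesis using u(1) by (intro exI[of _ "\<lambda>m. u (B m)"]) auto
  next
    case False
    then obtain m1 m2 where m: "m1 < M" "m2 < M" "m1 \<noteq> m2" "B m1 = B m2"
      unfolding inj_on_def by auto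
    \<comment> \<open>Two equal products with different exponents are a relation by themselves. The
      set of products does not show the coincidence, so the case is treated apart.\<close>
    define a where "a m = (if m = m1 then 1 else if m = m2 then -1 else 0 :: 'a)" for m
    have "(\<Sum>m<M. a m * B m e) = (\<Sum>m\<in>{m1, m2}. a m * B m e)" for e
      using m by (intro sum.mono_neutral_right) (auto simp: a_def)
    then have "(\<Sum>m<M. a m * B m e) = 0" for e using m by (simp add: a_def)
    then show ?thesis using m by (intro exI[of _ a]) (auto simp: a_def)
  qed
  then obtain a where a: "\<exists>m<M. a m \<noteq> 0" "\<And>e. (\<Sum>m<M. a m * B m e) = 0" by blast
  define P where "P = psum (\<lambda>m. PMul (PC (a m)) (pprod (\<lambda>i. ppow (PV i) (dig m i)) [0..<Suc n])) [0..<M]"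
  have P: "pval e P = (\<Sum>m<M. a m * (\<Prod>i<Suc n. e i ^ dig m i))" for e
    unfolding P_def pval_psum pev.simps pval_pprod pval_ppow sum_list_upt prod_list_upt by simp
  have "pvars P \<subseteq> {..n}" unfolding P_def by (auto simp: pvars_psum pvars_pprod)
  moreover have "pval (\<lambda>i. pval e (f i)) P = 0" for e using a(2) unfolding P B_def by simp
  moreover have "\<exists>e. pval e P \<noteq> 0"
  proof -
    define q where "q = (\<Sum>m<M. monom (a m) m)"
    have "coeff q m = a m" if "m < M" for m
      using that by (simp add: q_def coeff_sum coeff_monom sum.delta)
    then have "q \<noteq> 0" using a(1) by (metis coeff_0)
    then obtain t where t: "poly q t \<noteq> 0" using poly_all_0_iff_0 by blast
    \<comment> \<open>Kronecker substitution: putting \<open>t ^ (Suc N ^ i)\<close> for the i-th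
      variable turns the m-th monomial into \<open>t ^ m\<close>, so distinct monomials cannot
      cancel.\<close>
    have "(\<Prod>i<Suc n. (t ^ (Suc N ^ i)) ^ dig m i) = t ^ m" if "m < M" for m
    proof -
      have "(\<Prod>i<Suc n. (t ^ (Suc N ^ i)) ^ dig m i) = t ^ (\<Sum>i<Suc n. dig m i * Suc N ^ i)"
        by (simp only: power_sum power_mult[symmetric]) (simp only: mult.commute)
      then show ?thesis using that unfolding dig_def sum_digits M_def by simp
    qed
    then have "pval (\<lambda>i. t ^ (Suc N ^ i)) P = poly q t"
      unfolding P q_def by (simp add: poly_sum poly_monom del: prod.lessThan_Suc)
    then show ?thesis using t by metis
  qed
  ultimately show ?thesis unfolding n_def by blast
qed

section \<open>Algebraic equations over n polynomials in n variables\<close>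

lemma pvars_ladd: "\<Union> (pvars ` set (ladd xs ys)) \<subseteq> \<Union> (pvars ` set xs) \<union> \<Union> (pvars ` set ys)"
proof (induction xs arbitrary: ys)
  case IH: (Cons x xs)
  show ?case
  proof (cases ys)
    case (Cons y ys')
    then show ?thesis using IH.IH[of ys'] by auto
  qed simp
qed simp

lemma pvars_lmul: "\<Union> (pvars ` set (lmul xs ys)) \<subseteq> \<Union> (pvars ` set xs) \<union> \<Union> (pvars ` set ys)"
proof (induction xs)
  case (Cons x xs)
  have "\<Union> (pvars ` set (lmul (x # xs) ys)) \<subseteq>
      \<Union> (pvars ` set (map (PMul x) ys)) \<union> \<Union> (pvars ` set (PC 0 # lmul xs ys))"
    unfolding lmul.simps by (rule pvars_ladd)
  also have "\<dots> \<subseteq> \<Union> (pvars ` set (x # xs)) \<union> \<Union> (pvars ` set ys)"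
    using Cons.IH by auto
  finally show ?case .
qed simp

lemma pvars_ucoef: "\<Union> (pvars ` set (ucoef v p)) \<subseteq> pvars p - {v}"
proof (induction p)
  case (PAdd p q)
  have "\<Union> (pvars ` set (ucoef v (PAdd p q))) \<subseteq> (pvars p - {v}) \<union> (pvars q - {v})"
    unfolding ucoef.simps by (rule order_trans[OF pvars_ladd Un_mono[OF PAdd.IH]])
  then show ?case by (simp add: Un_Diff)
next
  case (PMul p q)
  have "\<Union> (pvars ` set (ucoef v (PMul p q))) \<subseteq> (pvars p - {v}) \<union> (pvars q - {v})"
    unfolding ucoef.simps by (rule order_trans[OF pvars_lmul Un_mono[OF PMul.IH]])
  then show ?case by (simp add: Un_Diff)
qed auto

primrec horner :: "'v \<Rightarrow> ('v, 'a::zero) pexp list \<Rightarrow> ('v, 'a) pexp" where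
  "horner v [] = PC 0"
| "horner v (c # cs) = PAdd c (PMul (PV v) (horner v cs))"

lemma pval_horner: "pval e (horner v cs) = poly (upoly (\<lambda>x. x) e cs) (e v)"
  by (induction cs) auto

lemma upoly_drop:
  assumes "\<And>j. j < l \<Longrightarrow> pev h e (cs ! j) = 0" "l \<le> length cs"
  shows "upoly h e cs = monom 1 l * upoly h e (drop l cs)"
  using assms
proof (induction l arbitrary: cs)
  case (Suc l)
  then obtain c cs' where cs: "cs = c # cs'" by (cases cs) auto
  have "upoly h e cs' = monom 1 l * upoly h e (drop l cs')"
    using Suc.prems cs by (intro Suc.IH) force+
  moreover have "pev h e c = 0" using Suc.prems(1)[of 0] cs by simp
  ultimately show ?case by (simp add: cs monom_Suc)
qed (simp add: monom_0 flip: one_pCons)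

text \<open>With \<open>h\<close> at index 0 and the \<open>\<phi> s\<close> at the other indices,
  the dependence is sorted by powers of the variable 0. The result is an equation for
  \<open>h\<close> with coefficients in the \<open>\<phi> s\<close>.\<close>

lemma algebraically_dependent_indexed:
  fixes \<phi> :: "'s \<Rightarrow> ('v, 'a::field_char_0) pexp"
  assumes V: "finite V" and S: "finite S" "card S = card V"
    and \<phi>: "\<And>s. s \<in> S \<Longrightarrow> pvars (\<phi> s) \<subseteq> V" and h: "pvars h \<subseteq> V"
  shows "\<exists>cs. (\<forall>c\<in>set cs. pvars c \<subseteq> S) \<and> (\<exists>c\<in>set cs. \<exists>e. pval e c \<noteq> 0) \<and>
    (\<forall>e. poly (upoly (\<lambda>x. x) (\<lambda>s. pval e (\<phi> s)) cs) (pval e h) = 0)"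
proof -
  obtain \<sigma> where \<sigma>: "bij_betw \<sigma> {1..card V} S"
    using S finite_same_card_bij[of "{1..card V}" S] by auto
  define \<tau> where "\<tau> = inv_into {1..card V} \<sigma>"
  have \<tau>: "\<And>i. i \<in> {1..card V} \<Longrightarrow> \<tau> (\<sigma> i) = i" "\<And>s. s \<in> S \<Longrightarrow> \<tau> s \<in> {1..card V}" "\<And>s. s \<in> S \<Longrightarrow> \<sigma> (\<tau> s) = s"
    using \<sigma> unfolding \<tau>_def bij_betw_def by (auto simp: f_inv_into_f inv_into_into inv_into_f_f)
  define f where "f i = (if i = 0 then h else \<phi> (\<sigma> i))" for i
  have "pvars (f i) \<subseteq> V" if "i \<le> card V" for i
    using that h \<phi>[of "\<sigma> i"] bij_betwE[OF \<sigma>] by (auto simp: f_def)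
  then obtain P where P: "pvars P \<subseteq> {..card V}" "\<exists>e. pval e P \<noteq> 0" "\<And>e. pval (\<lambda>i. pval e (f i)) P = 0"
    using algebraically_dependent[OF V, of f] by blast
  define cs where "cs = map (psubst (\<lambda>i. PV (\<sigma> i))) (ucoef 0 P)"
  have vars: "pvars c \<subseteq> {1..card V}" if "c \<in> set (ucoef 0 P)" for c
    
  proof -
    have "pvars c \<subseteq> {..card V} - {0}" using pvars_ucoef[of 0 P] P(1) that by blast
    then show ?thesis by (auto simp: Suc_le_eq)
  qed
  have up: "upoly (\<lambda>x. x) e (map (psubst (\<lambda>i. PV (\<sigma> i))) xs) = upoly (\<lambda>x. x) (\<lambda>i. e (\<sigma> i)) xs"
    for xs and e :: "'s \<Rightarrow> 'a"
    by (induction xs) (auto simp: pev_psubst)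
  have "\<forall>c\<in>set cs. pvars c \<subseteq> S"
    using vars bij_betwE[OF \<sigma>] unfolding cs_def by (fastforce simp: pvars_psubst)
  moreover have "\<exists>c\<in>set cs. \<exists>e. pval e c \<noteq> 0"
  proof -
    obtain e where e: "pval e P \<noteq> 0" using P(2) by blast
    then have "poly (upoly (\<lambda>x. x) e (ucoef 0 P)) (e 0) \<noteq> 0"
      unfolding comm_ring_hom.poly_ucoef[OF comm_ring_hom_ident] by simp
    then obtain c where c: "c \<in> set (ucoef 0 P)" "pval e c \<noteq> 0"
      using upoly_eq_0_iff by (metis poly_0)
    have "pval (\<lambda>s. e (\<tau> s)) (psubst (\<lambda>i. PV (\<sigma> i)) c) = pval e c"
      unfolding pev_psubst using vars[OF c(1)] \<tau>(1) by (intro pev_cong) auto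
    then have "pval (\<lambda>s. e (\<tau> s)) (psubst (\<lambda>i. PV (\<sigma> i)) c) \<noteq> 0" using c(2) by simp
    then show ?thesis using c(1) unfolding cs_def by auto
  qed
  moreover have "poly (upoly (\<lambda>x. x) (\<lambda>s. pval e (\<phi> s)) cs) (pval e h) = 0" for e
  proof -
    have "upoly (\<lambda>x. x) (\<lambda>i. pval e (\<phi> (\<sigma> i))) (ucoef 0 P) = upoly (\<lambda>x. x) (\<lambda>i. pval e (f i)) (ucoef 0 P)"
    proof -
      have "upoly (\<lambda>x. x) (\<lambda>i. pval e (\<phi> (\<sigma> i))) xs = upoly (\<lambda>x. x) (\<lambda>i. pval e (f i)) xs"
        if "set xs \<subseteq> set (ucoef 0 P)" for xs
        using that
      proof (induction xs)
        case (Cons c xs)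
        then have "0 \<notin> pvars c" using vars[of c] by auto
        then have "pval (\<lambda>i. pval e (\<phi> (\<sigma> i))) c = pval (\<lambda>i. pval e (f i)) c"
          by (intro pev_cong) (auto simp: f_def)
        then show ?case using Cons by simp
      qed simp
      then show ?thesis by blast
    qed
    then have "poly (upoly (\<lambda>x. x) (\<lambda>s. pval e (\<phi> s)) cs) (pval e h)
      = poly (upoly (\<lambda>x. x) (\<lambda>i. pval e (f i)) (ucoef 0 P)) (pval e (f 0))"
      unfolding cs_def up by (simp add: f_def)
    also have "\<dots> = pval (\<lambda>i. pval e (f i)) P"
      unfolding comm_ring_hom.poly_ucoef[OF comm_ring_hom_ident] by (simp add: fun_upd_idem)
    finally show ?thesis using P(3) by simp
  qed
  ultimately show ?thesis by blast
qed

text \<open>After division by a power of \<open>h\<close>, the equation of \<open>h\<close> over the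
  \<open>\<phi> s\<close> has a nonzero constant term. It is a polynomial in the
  \<open>\<phi> s\<close> that vanishes wherever \<open>h\<close> does, so it bounds the image of
  the hypersurface by a proper closed set.\<close>

lemma hypersurface_image:
  fixes \<phi> :: "'s \<Rightarrow> ('v, 'a::field_char_0) pexp"
  assumes V: "finite V" and S: "finite S" "card S = card V"
    and \<phi>: "\<And>s. s \<in> S \<Longrightarrow> pvars (\<phi> s) \<subseteq> V" and h: "pvars h \<subseteq> V" "pval e0 h \<noteq> 0"
  shows "generic (\<lambda>T. \<forall>e. (\<forall>s\<in>S. T s = pval e (\<phi> s)) \<longrightarrow> pval e h \<noteq> 0)"
proof -
  obtain cs where cs: "\<forall>c\<in>set cs. pvars c \<subseteq> S" "\<exists>c\<in>set cs. \<exists>e. pval e c \<noteq> 0"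
    "\<And>e. poly (upoly (\<lambda>x. x) (\<lambda>s. pval e (\<phi> s)) cs) (pval e h) = 0"
    using algebraically_dependent_indexed[OF V S, of \<phi> h] \<phi> h(1) by blast
  define l where "l = (LEAST l. l < length cs \<and> (\<exists>e. pval e (cs ! l) \<noteq> 0))"
  have "\<exists>l. l < length cs \<and> (\<exists>e. pval e (cs ! l) \<noteq> 0)"
    using cs(2) by (auto simp: in_set_conv_nth) blast
  from LeastI_ex[OF this] have l: "l < length cs" "\<exists>e. pval e (cs ! l) \<noteq> 0"
    unfolding l_def[symmetric] by auto
  have less: "pval e (cs ! j) = 0" if "j < l" for j e
    using not_less_Least[of j "\<lambda>l. l < length cs \<and> (\<exists>e. pval e (cs ! l) \<noteq> 0)"] that l(1)
    unfolding l_def[symmetric] by auto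
  define R where "R e = poly (upoly (\<lambda>x. x) (\<lambda>s. pval e (\<phi> s)) (drop l cs)) (pval e h)" for e
  have prod: "pval e h ^ l * R e = 0" for e
    using cs(3)[of e] upoly_drop[of l "\<lambda>x. x" "\<lambda>s. pval e (\<phi> s)" cs] less l(1)
    by (simp add: R_def poly_monom)
  define Rp where "Rp = psubst (\<lambda>s. case s of None \<Rightarrow> h | Some s \<Rightarrow> \<phi> s)
    (horner None (map (psubst (\<lambda>s. PV (Some s))) (drop l cs)))"
  have up: "upoly (\<lambda>x. x) e (map (psubst (\<lambda>s. PV (Some s))) xs) = upoly (\<lambda>x. x) (\<lambda>i. e (Some i)) xs"
    for xs and e :: "'s option \<Rightarrow> 'a"
    by (induction xs) (auto simp: pev_psubst)
  have Rp: "pval e Rp = R e" for e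
    unfolding Rp_def pev_psubst pval_horner up R_def by simp
  \<comment> \<open>\<open>h ^ l * R\<close> vanishes identically and \<open>h\<close> does not; by
    irreducibility \<open>R\<close> vanishes everywhere, in particular on the zero set of
    \<open>h\<close>.\<close>
  have R0: "R e = 0" for e
  proof (rule ccontr)
    assume "R e \<noteq> 0"
    then obtain e' where "pval e' h \<noteq> 0" "pval e' Rp \<noteq> 0"
      using pval_mult_nonzero[of e0 h e Rp] h(2) Rp by auto
    then show False using prod[of e'] Rp by simp
  qed
  have "pval e h \<noteq> 0" if "pval T (cs ! l) \<noteq> 0" "\<forall>s\<in>S. T s = pval e (\<phi> s)" for T e
  proof
    assume "pval e h = 0"
    then have "pval (\<lambda>s. pval e (\<phi> s)) (cs ! l) = 0"
      using R0[of e] l(1) by (simp add: R_def flip: Cons_nth_drop_Suc)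
    moreover have "pvars (cs ! l) \<subseteq> S" using cs(1) l(1) by simp
    then have "pval T (cs ! l) = pval (\<lambda>s. pval e (\<phi> s)) (cs ! l)"
      using that(2) by (intro pev_cong) blast
    ultimately show False using that(1) by simp
  qed
  then show ?thesis unfolding generic_def using l(2) by blast
qed

text \<open>Each coordinate in \<open>V\<close> is a root of an equation over the
  \<open>\<phi> s\<close>, which is a nonzero polynomial for general \<open>T\<close> and so allows
  boundedly many values. The coordinates outside \<open>V\<close>, not constrained by the equations,
  are fixed at 0.\<close>

lemma bounded_fibres:
  fixes \<phi> :: "'s \<Rightarrow> ('v, 'a::field_char_0) pexp"
  assumes V: "finite V" and S: "finite S" "card S = card V"
    and \<phi>: "\<And>s. s \<in> S \<Longrightarrow> pvars (\<phi> s) \<subseteq> V"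
  shows "\<exists>B. generic (\<lambda>T. finite {e. (\<forall>v. v \<notin> V \<longrightarrow> e v = 0) \<and> (\<forall>s\<in>S. T s = pval e (\<phi> s))} \<and>
    card {e. (\<forall>v. v \<notin> V \<longrightarrow> e v = 0) \<and> (\<forall>s\<in>S. T s = pval e (\<phi> s))} \<le> B)"
proof -
  define F where "F T = {e. (\<forall>v. v \<notin> V \<longrightarrow> e v = 0) \<and> (\<forall>s\<in>S. T s = pval e (\<phi> s))}" for T
  have "\<exists>b. generic (\<lambda>T. finite ((\<lambda>e. e v) ` F T) \<and> card ((\<lambda>e. e v) ` F T) \<le> b)" if v: "v \<in> V" for v
  proof -
    have "pvars (PV v) \<subseteq> V" using v by simp
    then obtain cs where cs: "\<forall>c\<in>set cs. pvars c \<subseteq> S" "\<exists>c\<in>set cs. \<exists>e. pval e c \<noteq> 0"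
      "\<And>e. poly (upoly (\<lambda>x. x) (\<lambda>s. pval e (\<phi> s)) cs) (e v) = 0"
      using algebraically_dependent_indexed[OF V S, of \<phi> "PV v"] \<phi> by auto
    obtain c e0 where c: "c \<in> set cs" "pval e0 c \<noteq> 0" using cs(2) by blast
    have "finite ((\<lambda>e. e v) ` F T) \<and> card ((\<lambda>e. e v) ` F T) \<le> length cs" if T: "pval T c \<noteq> 0" for T
    proof -
      let ?p = "upoly (\<lambda>x. x) T cs"
      have nz: "?p \<noteq> 0" using T c(1) by (auto simp: upoly_eq_0_iff)
      have sub: "(\<lambda>e. e v) ` F T \<subseteq> {x. poly ?p x = 0}"
      proof clarify
        fix e assume e: "e \<in> F T"
        have "upoly (\<lambda>x. x) T xs = upoly (\<lambda>x. x) (\<lambda>s. pval e (\<phi> s)) xs" if "set xs \<subseteq> set cs" for xs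
          using that
        proof (induction xs)
          case (Cons c xs)
          then have "pval T c = pval (\<lambda>s. pval e (\<phi> s)) c"
            using cs(1) e unfolding F_def by (intro pev_cong) fastforce
          then show ?case using Cons by simp
        qed simp
        then show "poly ?p (e v) = 0" using cs(3)[of e] by simp
      qed
      have "card ((\<lambda>e. e v) ` F T) \<le> card {x. poly ?p x = 0}"
        using sub nz by (intro card_mono) (auto simp: poly_roots_finite)
      also have "\<dots> \<le> degree ?p" using nz by (rule card_poly_roots_bound)
      also have "\<dots> \<le> length cs" using degree_upoly_less[of cs "\<lambda>x. x" T] c(1) by (cases "cs = []") auto
      finally show ?thesis using finite_subset[OF sub] nz by (auto simp: poly_roots_finite)
    qed
    then show ?thesis using c(2) unfolding generic_def by blast
  qed
  then have "\<forall>v\<in>V. \<exists>b. generic (\<lambda>T. finite ((\<lambda>e. e v) ` F T) \<and> card ((\<lambda>e. e v) ` F T) \<le> b)" by blast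
  from bchoice[OF this] obtain b
    where b: "\<And>v. v \<in> V \<Longrightarrow> generic (\<lambda>T. finite ((\<lambda>e. e v) ` F T) \<and> card ((\<lambda>e. e v) ` F T) \<le> b v)"
    by blast
  have "generic (\<lambda>T. \<forall>v\<in>V. finite ((\<lambda>e. e v) ` F T) \<and> card ((\<lambda>e. e v) ` F T) \<le> b v)"
    using V b by (rule generic_ball)
  then have "generic (\<lambda>T. finite (F T) \<and> card (F T) \<le> (\<Prod>v\<in>V. b v))"
  proof (rule generic_mono)
    fix T assume T: "\<forall>v\<in>V. finite ((\<lambda>e. e v) ` F T) \<and> card ((\<lambda>e. e v) ` F T) \<le> b v"
    let ?P = "PiE V (\<lambda>v. (\<lambda>e. e v) ` F T)"
    have inj: "inj_on (\<lambda>e. restrict e V) (F T)"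
    proof (rule inj_onI)
      fix e e' assume e: "e \<in> F T" "e' \<in> F T" "restrict e V = restrict e' V"
      show "e = e'"
      proof
        fix v show "e v = e' v"
        proof (cases "v \<in> V")
          case True
          then show ?thesis using fun_cong[OF e(3), of v] by (simp add: restrict_def)
        next
          case False
          then show ?thesis using e(1,2) by (simp add: F_def)
        qed
      qed
    qed
    have sub: "(\<lambda>e. restrict e V) ` F T \<subseteq> ?P" by auto
    have fin: "finite ?P" using T V by (intro finite_PiE) auto
    have "card (F T) = card ((\<lambda>e. restrict e V) ` F T)" using inj by (simp add: card_image)
    also have "\<dots> \<le> card ?P" using sub fin by (rule card_mono[rotated])
    also have "\<dots> = (\<Prod>v\<in>V. card ((\<lambda>e. e v) ` F T))" using V by (simp add: card_PiE)
    also have "\<dots> \<le> (\<Prod>v\<in>V. b v)" using T by (intro prod_mono) auto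
    finally show "finite (F T) \<and> card (F T) \<le> (\<Prod>v\<in>V. b v)"
      using finite_imageD[OF finite_subset[OF sub fin] inj] by simp
  qed
  then show ?thesis unfolding F_def by blast
qed

section \<open>Hensel lifting\<close>

text \<open>The derivative at \<open>e\<close> in the direction \<open>d\<close>. Treating the
  Jacobian as a linear map allows nondegeneracy to be stated as injectivity, without
  matrices.\<close>

primrec pdev :: "('a \<Rightarrow> 'b::comm_ring_1) \<Rightarrow> ('v \<Rightarrow> 'b) \<Rightarrow> ('v \<Rightarrow> 'b) \<Rightarrow> ('v, 'a) pexp \<Rightarrow> 'b" where
  "pdev \<iota> e d (PC c) = 0"
| "pdev \<iota> e d (PV v) = d v"
| "pdev \<iota> e d (PAdd p q) = pdev \<iota> e d p + pdev \<iota> e d q"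
| "pdev \<iota> e d (PMul p q) = pdev \<iota> e d p * pev \<iota> e q + pev \<iota> e p * pdev \<iota> e d q"

lemma (in comm_ring_hom) hom_pdev:
  "hom (pdev \<iota> e d p) = pdev (\<lambda>x. hom (\<iota> x)) (\<lambda>v. hom (e v)) (\<lambda>v. hom (d v)) p"
  by (induction p) (auto simp: hom_distribs hom_pev)

lemma pdev_cong: "(\<And>v. v \<in> pvars p \<Longrightarrow> d v = d' v) \<Longrightarrow> pdev \<iota> e d p = pdev \<iota> e d' p"
  by (induction p) auto

lemma pdev_sum: "pdev \<iota> e (\<lambda>v. \<Sum>i\<in>I. a i * d i v) p = (\<Sum>i\<in>I. a i * pdev \<iota> e (d i) p)"
  by (induction p) (auto simp: sum.distrib sum_distrib_left sum_distrib_right algebra_simps)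

text \<open>Injectivity makes the determinant nonzero, and the adjugate then solves the system. The
  determinant is itself a conclusion because its nonvanishing is what passes from constant terms to
  power series.\<close>

lemma solve_square_system:
  fixes A :: "nat \<Rightarrow> nat \<Rightarrow> 'a::field"
  assumes "\<And>u :: nat \<Rightarrow> 'a. (\<And>i. i < n \<Longrightarrow> (\<Sum>j<n. u j * A i j) = 0) \<Longrightarrow> (\<forall>j<n. u j = 0)"
  shows "Determinant.det (Matrix.mat n n (\<lambda>(i, j). A i j)) \<noteq> 0"
    and "\<exists>u. \<forall>i<n. (\<Sum>j<n. u j * A i j) = b i"
proof -
  define M where "M = Matrix.mat n n (\<lambda>(i, j). A i j)"
  have M: "M \<in> carrier_mat n n" unfolding M_def by simp
  have mult: "vec_index (M *\<^sub>v v) i = (\<Sum>j<n. vec_index v j * A i j)" if "v \<in> carrier_vec n" "i < n" for v i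
    using that by (simp add: M_def scalar_prod_def atLeast0LessThan mult.commute)
  show det: "Determinant.det (Matrix.mat n n (\<lambda>(i, j). A i j)) \<noteq> 0"
  proof
    assume "Determinant.det (Matrix.mat n n (\<lambda>(i, j). A i j)) = 0"
    then obtain v where v: "v \<in> carrier_vec n" "v \<noteq> 0\<^sub>v n" "M *\<^sub>v v = 0\<^sub>v n"
      using det_0_iff_vec_prod_zero_field[OF M] unfolding M_def by auto
    have "\<forall>j<n. vec_index v j = 0"
      using v(3) mult[OF v(1)] by (intro assms) (metis index_zero_vec(1))
    then show False using v(1,2) by (metis carrier_vecD eq_vecI index_zero_vec)
  qed
  define u where "u j = vec_index ((1 / Determinant.det M) \<cdot>\<^sub>v (adj_mat M *\<^sub>v Matrix.vec n b)) j" for j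
  have adj: "adj_mat M \<in> carrier_mat n n" "M * adj_mat M = Determinant.det M \<cdot>\<^sub>m 1\<^sub>m n"
    using adj_mat[OF M] by auto
  have w: "(1 / Determinant.det M) \<cdot>\<^sub>v (adj_mat M *\<^sub>v Matrix.vec n b) \<in> carrier_vec n"
    using adj(1) by simp
  have "M *\<^sub>v ((1 / Determinant.det M) \<cdot>\<^sub>v (adj_mat M *\<^sub>v Matrix.vec n b)) =
      (1 / Determinant.det M) \<cdot>\<^sub>v (M *\<^sub>v (adj_mat M *\<^sub>v Matrix.vec n b))"
    using M adj(1) by (intro mult_mat_vec) auto
  also have "M *\<^sub>v (adj_mat M *\<^sub>v Matrix.vec n b) = (M * adj_mat M) *\<^sub>v Matrix.vec n b"
    using M adj(1) by (intro assoc_mult_mat_vec[symmetric]) auto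
  also have "\<dots> = Determinant.det M \<cdot>\<^sub>v Matrix.vec n b"
    unfolding adj(2) by (intro eq_vecI) (auto simp: scalar_prod_def mult.assoc if_distrib[of "\<lambda>x. x * _"] if_distrib[of "(*) _"] cong: if_cong)
  finally have eq: "M *\<^sub>v ((1 / Determinant.det M) \<cdot>\<^sub>v (adj_mat M *\<^sub>v Matrix.vec n b)) = Matrix.vec n b"
    using det unfolding M_def[symmetric] by (simp add: smult_smult_assoc)
  have "(\<Sum>j<n. u j * A i j) = b i" if "i < n" for i
    using mult[OF w that] that unfolding eq u_def by simp
  then show "\<exists>u. \<forall>i<n. (\<Sum>j<n. u j * A i j) = b i" by blast
qed

lemma inj_of_det_nonzero:
  fixes A :: "nat \<Rightarrow> nat \<Rightarrow> 'a::field"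
  assumes "Determinant.det (Matrix.mat n n (\<lambda>(i, j). A i j)) \<noteq> 0"
    and "\<And>i. i < n \<Longrightarrow> (\<Sum>j<n. u j * A i j) = 0" "j < n"
  shows "u j = 0"
proof -
  define M where "M = Matrix.mat n n (\<lambda>(i, j). A i j)"
  have M: "M \<in> carrier_mat n n" unfolding M_def by simp
  have "M *\<^sub>v Matrix.vec n u = 0\<^sub>v n"
    using assms(2) by (intro eq_vecI) (auto simp: M_def scalar_prod_def atLeast0LessThan mult.commute)
  moreover have "\<not> (\<exists>v. v \<in> carrier_vec n \<and> v \<noteq> 0\<^sub>v n \<and> M *\<^sub>v v = 0\<^sub>v n)"
    using det_0_iff_vec_prod_zero_field[OF M] assms(1) unfolding M_def by simp
  ultimately have "Matrix.vec n u = 0\<^sub>v n" by (metis vec_carrier)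
  then show ?thesis using assms(3) by (metis index_vec index_zero_vec(1))
qed

section \<open>Newton iteration in formal power series\<close>

lemma comm_ring_hom_fps_const: "comm_ring_hom (fps_const :: 'a::comm_ring_1 \<Rightarrow> _)"
  by unfold_locales auto

lemma comm_ring_hom_fps_nth_0: "comm_ring_hom (\<lambda>f :: 'a::comm_ring_1 fps. f $ 0)"
  by unfold_locales auto

lemma pev_fps_cong:
  assumes "\<And>v k. v \<in> pvars p \<Longrightarrow> k \<le> N \<Longrightarrow> e v $ k = e' v $ k" "k \<le> N"
  shows "pev fps_const e p $ k = pev fps_const e' p $ k"
  using assms
proof (induction p arbitrary: k)
  case (PMul p q)
  then show ?case by (auto simp: fps_mult_nth intro!: sum.cong arg_cong2[of _ _ _ _ "(*)"])
qed auto

lemma taylor_first_order: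
  fixes e :: "'v \<Rightarrow> 'a::comm_ring_1 fps"
  shows "\<exists>R. pev fps_const (\<lambda>v. e v + fps_X ^ N * fps_const (d v)) p =
    pev fps_const e p + fps_X ^ N * pdev fps_const e (\<lambda>v. fps_const (d v)) p + fps_X ^ N * fps_X ^ N * R"
proof (induction p)
  case (PC c)
  show ?case by (rule exI[of _ 0]) simp
next
  case (PV v)
  show ?case by (rule exI[of _ 0]) simp
next
  case (PAdd p q)
  then obtain R R' where "pev fps_const (\<lambda>v. e v + fps_X ^ N * fps_const (d v)) p =
    pev fps_const e p + fps_X ^ N * pdev fps_const e (\<lambda>v. fps_const (d v)) p + fps_X ^ N * fps_X ^ N * R"
    "pev fps_const (\<lambda>v. e v + fps_X ^ N * fps_const (d v)) q =
    pev fps_const e q + fps_X ^ N * pdev fps_const e (\<lambda>v. fps_const (d v)) q + fps_X ^ N * fps_X ^ N * R'"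
    by blast
  then show ?case by (intro exI[of _ "R + R'"]) (simp add: algebra_simps)
next
  case (PMul p q)
  define x where "x = (fps_X :: 'a fps) ^ N"
  obtain R R' where R: "pev fps_const (\<lambda>v. e v + x * fps_const (d v)) p =
    pev fps_const e p + x * pdev fps_const e (\<lambda>v. fps_const (d v)) p + x * x * R"
    "pev fps_const (\<lambda>v. e v + x * fps_const (d v)) q =
    pev fps_const e q + x * pdev fps_const e (\<lambda>v. fps_const (d v)) q + x * x * R'"
    using PMul unfolding x_def by blast
  define a b a' b' where "a = pev fps_const e p" and "b = pev fps_const e q"
    and "a' = pdev fps_const e (\<lambda>v. fps_const (d v)) p" and "b' = pdev fps_const e (\<lambda>v. fps_const (d v)) q"
  have "(a + x * a' + x * x * R) * (b + x * b' + x * x * R') =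
     a * b + x * (a' * b + a * b') + x * x * (a' * b' + a * R' + R * b + x * (a' * R' + R * b') + x * x * (R * R'))"
    by (simp add: algebra_simps)
  then show ?case
    unfolding x_def[symmetric] pev.simps pdev.simps R a_def[symmetric] b_def[symmetric] a'_def[symmetric] b'_def[symmetric]
    by blast
qed

lemma unit_vector_expansion:
  fixes u :: "nat \<Rightarrow> 'b::comm_ring_1"
  assumes "pvars p \<subseteq> insert None (Some ` {..<n})"
  shows "pdev \<iota> e (case_option 0 u) p = (\<Sum>j<n. u j * pdev \<iota> e (\<lambda>v. if v = Some j then 1 else 0) p)"
proof -
  have "pdev \<iota> e (case_option 0 u) p = pdev \<iota> e (\<lambda>v. \<Sum>j<n. u j * (if v = Some j then 1 else 0)) p"
  proof (rule pdev_cong)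
    fix v assume "v \<in> pvars p"
    then show "case_option 0 u v = (\<Sum>j<n. u j * (if v = Some j then 1 else 0))"
      using assms by (cases v) (auto simp: if_distrib[of "(*) _"] cong: if_cong)
  qed
  then show ?thesis unfolding pdev_sum .
qed

text \<open>\<open>None\<close> is the parameter and \<open>Some j\<close> the unknowns. The
  coefficients are found one after another: a correction of order \<open>Suc N\<close> changes the
  coefficient \<open>Suc N\<close> of the equations by the invertible Jacobian at \<open>y0\<close>,
  and no earlier coefficient.\<close>

theorem hensel_lifting:
  fixes G :: "nat \<Rightarrow> (nat option, 'a::field) pexp" and y0 :: "nat \<Rightarrow> 'a"
  assumes vars: "\<And>i. i < n \<Longrightarrow> pvars (G i) \<subseteq> insert None (Some ` {..<n})"
    and zero: "\<And>i. i < n \<Longrightarrow> pval (case_option 0 y0) (G i) = 0"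
    and inj: "\<And>u. (\<And>i. i < n \<Longrightarrow> pdev (\<lambda>x. x) (case_option 0 y0) (case_option 0 u) (G i) = 0) \<Longrightarrow>
      \<forall>j<n. u j = 0"
  shows "\<exists>Y. (\<forall>j. Y j $ 0 = y0 j) \<and> (\<forall>i<n. pev fps_const (case_option fps_X Y) (G i) = 0)"
proof -
  define A where "A i j = pdev (\<lambda>x. x) (case_option 0 y0) (\<lambda>v. if v = Some j then 1 else 0) (G i)" for i j
  have A: "pdev (\<lambda>x. x) (case_option 0 y0) (case_option 0 u) (G i) = (\<Sum>j<n. u j * A i j)" if "i < n" for i u
    unfolding A_def using unit_vector_expansion[OF vars[OF that]] .
  have solve: "\<exists>u. \<forall>i<n. (\<Sum>j<n. u j * A i j) = b i" for b
    by (rule solve_square_system) (use inj A in auto)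
  define P where "P N Y \<longleftrightarrow> (\<forall>j. Y j $ 0 = y0 j) \<and>
    (\<forall>i<n. \<forall>k\<le>N. pev fps_const (case_option fps_X Y) (G i) $ k = 0)" for N :: nat and Y
  have c0: "pev fps_const e p $ 0 = pval (\<lambda>v. e v $ 0) p" for e and p :: "(nat option, 'a) pexp"
    using comm_ring_hom.hom_pev[OF comm_ring_hom_fps_nth_0, of fps_const e p] by simp
  have env0: "(\<lambda>v. case_option fps_X Y v $ 0) = case_option 0 y0" if "\<forall>j. Y j $ 0 = y0 j" for Y
    using that by (auto split: option.splits)
  have start: "P 0 (\<lambda>j. fps_const (y0 j))"
    unfolding P_def using zero by (auto simp: c0 env0)
  have step: "\<exists>Y'. P (Suc N) Y' \<and> (\<exists>u. \<forall>j. Y' j = Y j + fps_X ^ Suc N * fps_const (u j))" if Y: "P N Y" for N Y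
  proof -
    obtain u where u: "\<And>i. i < n \<Longrightarrow> (\<Sum>j<n. u j * A i j) = - (pev fps_const (case_option fps_X Y) (G i) $ Suc N)"
      using solve[of "\<lambda>i. - (pev fps_const (case_option fps_X Y) (G i) $ Suc N)"] by blast
    define Y' where "Y' j = Y j + fps_X ^ Suc N * fps_const (u j)" for j
    have env: "case_option fps_X Y' = (\<lambda>v. case_option fps_X Y v + fps_X ^ Suc N * fps_const (case_option 0 u v))"
      by (auto simp: Y'_def fun_eq_iff split: option.splits)
    have "pev fps_const (case_option fps_X Y') (G i) $ k = 0" if i: "i < n" and k: "k \<le> Suc N" for i k
    proof -
      let ?d = "pdev fps_const (case_option fps_X Y) (\<lambda>v. fps_const (case_option 0 u v)) (G i)"
      obtain R where R: "pev fps_const (case_option fps_X Y') (G i) = pev fps_const (case_option fps_X Y) (G i)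
        + fps_X ^ Suc N * ?d + fps_X ^ Suc N * fps_X ^ Suc N * R"
        unfolding env using taylor_first_order by blast
      have "?d $ 0 = pdev (\<lambda>x. x) (case_option 0 y0) (case_option 0 u) (G i)"
        using comm_ring_hom.hom_pdev[OF comm_ring_hom_fps_nth_0, of fps_const "case_option fps_X Y" _ "G i"] Y
        by (simp add: env0 P_def)
      then have d0: "?d $ 0 = - (pev fps_const (case_option fps_X Y) (G i) $ Suc N)"
        using A u i by simp
      \<comment> \<open>The Taylor remainder begins at order \<open>2 * Suc N\<close>, which exceeds
        \<open>Suc N\<close>.\<close>
      have high: "(fps_X ^ Suc N * (fps_X ^ Suc N * R)) $ k = 0"
        unfolding fps_X_power_mult_nth using k by (auto simp: not_less_eq le_Suc_eq)
      have "(fps_X ^ Suc N * ?d) $ k = (if k = Suc N then ?d $ 0 else 0)"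
        unfolding fps_X_power_mult_nth using k by auto
      then show ?thesis unfolding R using high d0 Y i k unfolding P_def by (auto simp: mult.assoc le_Suc_eq)
    qed
    moreover have "\<forall>j. Y' j $ 0 = y0 j" using Y by (simp add: P_def Y'_def)
    ultimately have "P (Suc N) Y'" unfolding P_def by blast
    then show ?thesis using Y'_def by blast
  qed
  obtain Y where Y: "\<And>N. P N (Y N)" "\<And>N. \<exists>u. \<forall>j. Y (Suc N) j = Y N j + fps_X ^ Suc N * fps_const (u j)"
    using dependent_nat_choice[of P "\<lambda>N Y Y'. \<exists>u. \<forall>j. Y' j = Y j + fps_X ^ Suc N * fps_const (u j)"] start step
    by (metis (no_types, lifting))
  have stable: "Y (N + m) j $ k = Y N j $ k" if "k \<le> N" for N m j k
  proof (induction m)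
    case (Suc m)
    obtain u where "Y (Suc (N + m)) j = Y (N + m) j + fps_X ^ Suc (N + m) * fps_const (u j)"
      using Y(2) by blast
    then show ?case using Suc that by (simp add: fps_X_power_mult_nth del: power_Suc)
  qed simp
  \<comment> \<open>Coefficient \<open>k\<close> no longer changes from the approximation
    \<open>Y k\<close> on, so the diagonal is the limit.\<close>
  define Z where "Z j = Abs_fps (\<lambda>k. Y k j $ k)" for j
  have Z: "Z j $ k = Y N j $ k" if "k \<le> N" for j k N
    using stable[of k k "N - k" j] that by (simp add: Z_def)
  have "pev fps_const (case_option fps_X Z) (G i) $ k = 0" if "i < n" for i k
  proof -
    have "pev fps_const (case_option fps_X Z) (G i) $ k = pev fps_const (case_option fps_X (Y k)) (G i) $ k"
      by (rule pev_fps_cong[where N = k]) (auto simp: Z split: option.splits)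
    then show ?thesis using Y(1)[of k] that unfolding P_def by auto
  qed
  then have "\<forall>i<n. pev fps_const (case_option fps_X Z) (G i) = 0" by (auto simp: fps_eq_iff)
  moreover have "\<forall>j. Z j $ 0 = y0 j" using Z[of 0 0] Y(1)[of 0] unfolding P_def by auto
  ultimately show ?thesis by blast
qed

section \<open>The field of algebraic functions of a parameter\<close>

definition emb :: "'a::field fps \<Rightarrow> 'a fls alg_closure" where
  "emb f = to_ac (fps_to_fls f)"

definition cemb :: "'a::field \<Rightarrow> 'a fls alg_closure" where
  "cemb c = emb (fps_const c)"

lemma emb_eq_iff [simp]: "emb f = emb g \<longleftrightarrow> f = g"
  by (simp add: emb_def)

lemma emb_0 [simp]: "emb 0 = 0" and emb_1 [simp]: "emb 1 = 1"
  by (simp_all add: emb_def)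

lemma emb_add: "emb (f + g) = emb f + emb g" and emb_mult: "emb (f * g) = emb f * emb g"
  by (simp_all add: emb_def fls_times_fps_to_fls)

lemma emb_power: "emb (f ^ n) = emb f ^ n"
  by (induction n) (auto simp: emb_mult)

lemma comm_ring_hom_emb: "comm_ring_hom (emb :: 'a::field fps \<Rightarrow> _)"
  by unfold_locales (auto simp: emb_add emb_mult)

lemma emb_eq_0_iff [simp]: "emb f = 0 \<longleftrightarrow> f = 0"
  using emb_eq_iff[of f 0] by simp

lemma field_hom_cemb: "field_hom (cemb :: 'a::field \<Rightarrow> _)"
  by unfold_locales (auto simp: cemb_def simp flip: emb_add emb_mult fps_const_add fps_const_mult)

interpretation F: ac_extension "cemb :: 'a::{alg_closed_field, field_char_0} \<Rightarrow> _"
  by (simp add: ac_extension_def field_hom_cemb)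

lemma pev_emb: "emb (pev fps_const e p) = pev cemb (\<lambda>v. emb (e v)) p"
  using comm_ring_hom.hom_pev[OF comm_ring_hom_emb, of fps_const e p] by (simp add: cemb_def[abs_def])

lemma pdev_emb: "emb (pdev fps_const e d p) = pdev cemb (\<lambda>v. emb (e v)) (\<lambda>v. emb (d v)) p"
  using comm_ring_hom.hom_pdev[OF comm_ring_hom_emb, of fps_const e d p] by (simp add: cemb_def[abs_def])

text \<open>The Jacobian determinant along \<open>Y\<close> is a power series whose constant term is
  the determinant at parameter 0. The constant term is nonzero, hence so is the series and its image
  in the larger field.\<close>

lemma generization_inj:
  fixes G :: "nat \<Rightarrow> (nat option, 'a::field) pexp" and Y :: "nat \<Rightarrow> 'a fps"
  assumes vars: "\<And>i. i < n \<Longrightarrow> pvars (G i) \<subseteq> insert None (Some ` {..<n})"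
    and inj: "\<And>u. (\<And>i. i < n \<Longrightarrow>
      pdev (\<lambda>x. x) (case_option 0 (\<lambda>j. fps_nth (Y j) 0)) (case_option 0 u) (G i) = 0) \<Longrightarrow> \<forall>j<n. u j = 0"
    and U: "\<And>i. i < n \<Longrightarrow>
      pdev cemb (case_option (emb fps_X) (\<lambda>j. emb (Y j))) (case_option 0 U) (G i) = 0"
    and j: "j < n"
  shows "U j = 0"
proof -
  define A where "A i j = pdev fps_const (case_option fps_X Y) (\<lambda>v. if v = Some j then 1 else 0) (G i)" for i j
  have env: "(\<lambda>v. fps_nth (case_option fps_X Y v) 0) = case_option 0 (\<lambda>j. fps_nth (Y j) 0)"
    by (auto split: option.splits)
  have A0: "fps_nth (A i j) 0 = pdev (\<lambda>x. x) (case_option 0 (\<lambda>j. fps_nth (Y j) 0)) (\<lambda>v. if v = Some j then 1 else 0) (G i)" for i j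
  proof -
    have unit: "(\<lambda>v. fps_nth (if v = Some j then 1 else 0) 0) = (\<lambda>v. if v = Some j then 1 else 0)" by auto
    show ?thesis unfolding A_def comm_ring_hom.hom_pdev[OF comm_ring_hom_fps_nth_0] env unit by simp
  qed
  have "Determinant.det (Matrix.mat n n (\<lambda>(i, j). fps_nth (A i j) 0)) \<noteq> 0"
  proof (rule solve_square_system(1))
    fix u :: "nat \<Rightarrow> 'a"
    assume u: "\<And>i. i < n \<Longrightarrow> (\<Sum>j<n. u j * fps_nth (A i j) 0) = 0"
    show "\<forall>j<n. u j = 0"
      by (rule inj) (use u in \<open>simp add: unit_vector_expansion[OF vars] A0\<close>)
  qed
  moreover have "Matrix.mat n n (\<lambda>(i, j). fps_nth (A i j) 0) = map_mat (\<lambda>f. fps_nth f 0) (Matrix.mat n n (\<lambda>(i, j). A i j))"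
    by (rule eq_matI) auto
  ultimately have "fps_nth (Determinant.det (Matrix.mat n n (\<lambda>(i, j). A i j))) 0 \<noteq> 0"
    using comm_ring_hom.hom_det[OF comm_ring_hom_fps_nth_0, of "Matrix.mat n n (\<lambda>(i, j). A i j)"] by simp
  then have "emb (Determinant.det (Matrix.mat n n (\<lambda>(i, j). A i j))) \<noteq> 0" by auto
  moreover have "Matrix.mat n n (\<lambda>(i, j). emb (A i j)) = map_mat emb (Matrix.mat n n (\<lambda>(i, j). A i j))"
    by (rule eq_matI) auto
  ultimately have det: "Determinant.det (Matrix.mat n n (\<lambda>(i, j). emb (A i j))) \<noteq> 0"
    using comm_ring_hom.hom_det[OF comm_ring_hom_emb, of "Matrix.mat n n (\<lambda>(i, j). A i j)"] by simp
  have embA: "emb (A i j) = pdev cemb (case_option (emb fps_X) (\<lambda>j. emb (Y j))) (\<lambda>v. if v = Some j then 1 else 0) (G i)" for i j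
  proof -
    have "(\<lambda>v. emb (case_option fps_X Y v)) = case_option (emb fps_X) (\<lambda>j. emb (Y j))"
      by (auto split: option.splits)
    moreover have "(\<lambda>v. emb (if v = Some j then 1 else 0 :: 'a fps)) = (\<lambda>v. if v = Some j then 1 else 0)" by auto
    ultimately show ?thesis unfolding A_def pdev_emb by (simp only:)
  qed
  have "(\<Sum>j<n. U j * emb (A i j)) = 0" if "i < n" for i
    using U[OF that] unfolding unit_vector_expansion[OF vars[OF that]] embA .
  then show ?thesis using inj_of_det_nonzero[OF det _ j] by blast
qed

section \<open>Power sums with prescribed exponents\<close>

text \<open>The entries \<open>z (3 * i)\<close>, \<open>z (3 * i + 1)\<close>, \<open>z (3 * i + 2)\<close> are the coefficient and the
  two affine coordinates of the \<open>i\<close>-th point.\<close>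

definition phi :: "nat \<Rightarrow> (nat \<Rightarrow> 'b::comm_ring_1) \<Rightarrow> nat \<times> nat \<Rightarrow> 'b" where
  "phi r z s = (\<Sum>i<r. z (3 * i) * z (3 * i + 1) ^ fst s * z (3 * i + 2) ^ snd s)"

text \<open>The differential of \<open>phi\<close> at \<open>z\<close>, applied to \<open>u\<close>.
  For exponent 0 the truncated subtraction does no harm, the factor \<open>of_nat 0\<close> removing
  the term.\<close>

definition dphi :: "nat \<Rightarrow> (nat \<Rightarrow> 'b::comm_ring_1) \<Rightarrow> (nat \<Rightarrow> 'b) \<Rightarrow> nat \<times> nat \<Rightarrow> 'b" where
  "dphi r z u s = (\<Sum>i<r. u (3 * i) * z (3 * i + 1) ^ fst s * z (3 * i + 2) ^ snd s
     + z (3 * i) * (of_nat (fst s) * z (3 * i + 1) ^ (fst s - 1) * u (3 * i + 1)) * z (3 * i + 2) ^ snd s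
     + z (3 * i) * z (3 * i + 1) ^ fst s * (of_nat (snd s) * z (3 * i + 2) ^ (snd s - 1) * u (3 * i + 2)))"

definition pphi :: "nat \<Rightarrow> (nat \<Rightarrow> 'v) \<Rightarrow> nat \<times> nat \<Rightarrow> ('v, 'a::comm_ring_1) pexp" where
  "pphi r f s = psum (\<lambda>i. PMul (PMul (PV (f (3 * i))) (ppow (PV (f (3 * i + 1))) (fst s)))
     (ppow (PV (f (3 * i + 2))) (snd s))) [0..<r]"

definition pdphi :: "nat \<Rightarrow> (nat \<Rightarrow> 'v) \<Rightarrow> (nat \<Rightarrow> 'v) \<Rightarrow> nat \<times> nat \<Rightarrow> ('v, 'a::comm_ring_1) pexp" where
  "pdphi r f g s = psum (\<lambda>i. PAdd (PAdd
       (PMul (PMul (PV (g (3 * i))) (ppow (PV (f (3 * i + 1))) (fst s))) (ppow (PV (f (3 * i + 2))) (snd s)))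
       (PMul (PMul (PV (f (3 * i))) (PMul (PMul (PC (of_nat (fst s))) (ppow (PV (f (3 * i + 1))) (fst s - 1)))
          (PV (g (3 * i + 1))))) (ppow (PV (f (3 * i + 2))) (snd s))))
       (PMul (PMul (PV (f (3 * i))) (ppow (PV (f (3 * i + 1))) (fst s)))
          (PMul (PMul (PC (of_nat (snd s))) (ppow (PV (f (3 * i + 2))) (snd s - 1))) (PV (g (3 * i + 2)))))) [0..<r]"

lemma (in comm_ring_hom) pev_pphi: "pev hom e (pphi r f s) = phi r (\<lambda>j. e (f j)) s"
  by (simp add: pphi_def phi_def pev_psum pev_ppow sum_list_upt)

lemma (in comm_ring_hom) pev_pdphi: "pev hom e (pdphi r f g s) = dphi r (\<lambda>j. e (f j)) (\<lambda>j. e (g j)) s"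
  by (simp add: pdphi_def dphi_def pev_psum pev_ppow sum_list_upt hom_distribs)

lemma pdev_psum: "pdev h e d (psum p xs) = (\<Sum>x\<leftarrow>xs. pdev h e d (p x))"
  by (induction xs) auto

lemma (in comm_ring_hom) pdev_ppow:
  "pdev hom e d (ppow p n) = of_nat n * pev hom e p ^ (n - 1) * pdev hom e d p"
proof (induction n)
  case (Suc n)
  then show ?case by (cases n) (simp_all add: pev_ppow algebra_simps)
qed simp

lemma (in comm_ring_hom) pdev_pphi:
  "pdev hom e d (pphi r f s) = dphi r (\<lambda>j. e (f j)) (\<lambda>j. d (f j)) s"
  by (simp add: pphi_def dphi_def pdev_psum pdev_ppow pev_ppow sum_list_upt algebra_simps)

lemma pvars_pphi: "pvars (pphi r f s) \<subseteq> f ` {..<3 * r}"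
  by (auto simp: pphi_def pvars_psum pvars_pprod set_replicate_conv_if split: if_splits intro!: imageI)

lemma pvars_ppow: "pvars (ppow p n) \<subseteq> pvars p"
  by (auto simp: pvars_pprod)

lemma phi_cong: "(\<And>j. j < 3 * r \<Longrightarrow> z j = z' j) \<Longrightarrow> phi r z s = phi r z' s"
  unfolding phi_def by (intro sum.cong) auto

lemma dphi_cong:
  "(\<And>j. j < 3 * r \<Longrightarrow> z j = z' j) \<Longrightarrow> (\<And>j. j < 3 * r \<Longrightarrow> u j = u' j) \<Longrightarrow> dphi r z u s = dphi r z' u' s"
  unfolding dphi_def by (intro sum.cong) auto

lemma sum_lessThan_add: "(\<Sum>i<m + n. f i) = (\<Sum>i<m. f i) + (\<Sum>i<n. f (m + i :: nat) :: 'b::comm_monoid_add)"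
  by (induction n) (auto simp: add.assoc)

lemma phi_add: "phi (r1 + r2) z s = phi r1 z s + phi r2 (\<lambda>j. z (3 * r1 + j)) s"
  unfolding phi_def sum_lessThan_add by (simp add: distrib_left)

lemma dphi_add: "dphi (r1 + r2) z u s = dphi r1 z u s + dphi r2 (\<lambda>j. z (3 * r1 + j)) (\<lambda>j. u (3 * r1 + j)) s"
  unfolding dphi_def sum_lessThan_add by (simp add: distrib_left)

lemma (in comm_ring_hom) hom_phi: "hom (phi r z s) = phi r (\<lambda>j. hom (z j)) s"
  by (simp add: phi_def hom_distribs)

lemma mod3_simps [simp]:
  "(3 * i) mod 3 = (0::nat)" "(3 * i + 1) mod 3 = (1::nat)" "Suc (3 * i) mod 3 = (1::nat)"
  "(3 * i + 2) mod 3 = (2::nat)" "Suc (Suc (3 * i)) mod 3 = (2::nat)"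
  by presburger+

text \<open>Injectivity of the differential; for \<open>card S = 3 * r\<close> this is the
  nonvanishing of the Jacobian determinant.\<close>

definition nondeg :: "nat \<Rightarrow> (nat \<times> nat) set \<Rightarrow> (nat \<Rightarrow> 'b::comm_ring_1) \<Rightarrow> bool" where
  "nondeg r S z \<longleftrightarrow> (\<forall>u. (\<forall>s\<in>S. dphi r z u s = 0) \<longrightarrow> (\<forall>j<3 * r. u j = 0))"

text \<open>Solutions must differ as unordered collections. A point of \<open>z'\<close>,
  coefficient included, that does not occur in \<open>z\<close> expresses this without quantifying
  over permutations.\<close>

definition new_point :: "nat \<Rightarrow> (nat \<Rightarrow> 'b) \<Rightarrow> (nat \<Rightarrow> 'b) \<Rightarrow> bool" where
  "new_point r z z' \<longleftrightarrow> (\<exists>i<r. \<forall>j<r. \<exists>k<3. z' (3 * i + k) \<noteq> z (3 * j + k))"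

text \<open>For \<open>b = False\<close> the two points may coincide, so that one notion covers both
  the part with a double point and the part that is only nondegenerate. Nonzero entries make the
  orders in the parameter comparable after scaling.\<close>

definition witness :: "bool \<Rightarrow> nat \<Rightarrow> (nat \<times> nat) set \<Rightarrow> (nat \<Rightarrow> 'b::comm_ring_1) \<Rightarrow> (nat \<Rightarrow> 'b) \<Rightarrow> bool" where
  "witness b r S z z' \<longleftrightarrow> (\<forall>j<3 * r. z j \<noteq> 0 \<and> z' j \<noteq> 0) \<and> nondeg r S z \<and> nondeg r S z' \<and>
     (\<forall>s\<in>S. phi r z' s = phi r z s) \<and> (b \<longrightarrow> new_point r z z')"

section \<open>Transfer of double points to the ground field\<close>

context ac_extension
begin

lemma dfn_ball:
  assumes "finite I" "\<And>i. i \<in> I \<Longrightarrow> dfn (A i) (B i)"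
  shows "dfn (\<lambda>e. \<forall>i\<in>I. A i e) (\<lambda>e. \<forall>i\<in>I. B i e)"
proof -
  obtain xs where "set xs = I" using finite_list[OF assms(1)] by blast
  then show ?thesis using dfn_ball_list[of xs A B] assms(2) by simp
qed

lemma dfn_bex:
  assumes "finite I" "\<And>i. i \<in> I \<Longrightarrow> dfn (A i) (B i)"
  shows "dfn (\<lambda>e. \<exists>i\<in>I. A i e) (\<lambda>e. \<exists>i\<in>I. B i e)"
proof -
  obtain xs where "set xs = I" using finite_list[OF assms(1)] by blast
  then show ?thesis using dfn_bex_list[of xs A B] assms(2) by simp
qed

lemma dfn_eq: "dfn (\<lambda>e. pev (\<lambda>x. x) e p = pev (\<lambda>x. x) e q) (\<lambda>e. pev hom e p = pev hom e q)"
  using dfn_zero[of "PAdd p (PMul (PC (-1)) q)"] by (simp add: hom_distribs)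

lemma dfn_var_eq: "dfn (\<lambda>e. e v = e w) (\<lambda>e. e v = e w)"
  using dfn_eq[of "PV v" "PV w"] by simp

lemma dfn_phi_eq: "dfn (\<lambda>e. phi r (\<lambda>j. e (f j)) s = phi r (\<lambda>j. e (g j)) s)
    (\<lambda>e. phi r (\<lambda>j. e (f j)) s = phi r (\<lambda>j. e (g j)) s)"
  using dfn_eq[of "pphi r f s" "pphi r g s"]
  by (simp add: pev_pphi comm_ring_hom.pev_pphi[OF comm_ring_hom_ident])

lemma dfn_var_zero: "dfn (\<lambda>e. e v = 0) (\<lambda>e. e v = 0)"
  using dfn_zero[of "PV v"] by simp

lemma dfn_nonzero: "dfn (\<lambda>e. e v \<noteq> 0) (\<lambda>e. e v \<noteq> 0)"
  by (rule dfn_not[OF dfn_var_zero])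

lemma dfn_imp: "dfn A B \<Longrightarrow> dfn A' B' \<Longrightarrow> dfn (\<lambda>e. A e \<longrightarrow> A' e) (\<lambda>e. B e \<longrightarrow> B' e)"
proof -
  assume "dfn A B" "dfn A' B'"
  from dfn_or[OF dfn_not[OF this(1)] this(2)] show ?thesis by (simp only: imp_conv_disj)
qed

text \<open>Nondegeneracy quantifies over tangent vectors. Storing them in the variables with first
  index 2, next to the points with other first indices, gives it the form of a negated block of
  existential quantifiers, to which \<open>dfn_exs\<close> applies.\<close>

lemma nondeg_iff_override_on:
  fixes e :: "nat \<times> nat \<Rightarrow> 'c::comm_ring_1"
  assumes "m \<noteq> 2"
  shows "nondeg r S (\<lambda>j. e (m, j)) \<longleftrightarrow> \<not> (\<exists>x. (\<lambda>e. (\<forall>s\<in>S. dphi r (\<lambda>j. e (m, j)) (\<lambda>j. e (2, j)) s = 0) \<and>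
     \<not> (\<forall>j\<in>{..<3 * r}. e (2, j) = 0)) (override_on e x ({2} \<times> {..<3 * r})))"
proof -
  have z: "(\<lambda>j. override_on e x ({2} \<times> {..<3 * r}) (m, j)) = (\<lambda>j. e (m, j))" for x
    using assms by (auto simp: override_on_def)
  have u: "dphi r z (\<lambda>j. override_on e x ({2} \<times> {..<3 * r}) (2, j)) s = dphi r z (\<lambda>j. x (2, j)) s" for x z s
    by (intro dphi_cong) (auto simp: override_on_def)
  have u': "(\<forall>j\<in>{..<3 * r}. override_on e x ({2} \<times> {..<3 * r}) (2, j) = 0) \<longleftrightarrow> (\<forall>j<3 * r. x (2, j) = 0)" for x
    by (auto simp: override_on_def)
  have "nondeg r S (\<lambda>j. e (m, j)) \<longleftrightarrow>
     (\<forall>x :: nat \<times> nat \<Rightarrow> 'c. (\<forall>s\<in>S. dphi r (\<lambda>j. e (m, j)) (\<lambda>j. x (2, j)) s = 0) \<longrightarrow> (\<forall>j<3 * r. x (2, j) = 0))"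
    unfolding nondeg_def
  proof (intro iffI allI)
    fix u assume *: "\<forall>x :: nat \<times> nat \<Rightarrow> 'c. (\<forall>s\<in>S. dphi r (\<lambda>j. e (m, j)) (\<lambda>j. x (2, j)) s = 0) \<longrightarrow> (\<forall>j<3 * r. x (2, j) = 0)"
    show "(\<forall>s\<in>S. dphi r (\<lambda>j. e (m, j)) u s = 0) \<longrightarrow> (\<forall>j<3 * r. u j = 0)"
      using *[rule_format, of "\<lambda>v. u (snd v)"] by simp
  qed blast
  then show ?thesis by (simp only: z u u') blast
qed

lemma dfn_nondeg:
  assumes "m \<noteq> 2" "finite S"
  shows "dfn (\<lambda>e :: nat \<times> nat \<Rightarrow> 'a. nondeg r S (\<lambda>j. e (m, j))) (\<lambda>e. nondeg r S (\<lambda>j. e (m, j)))"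
proof -
  have "dfn (\<lambda>e. dphi r (\<lambda>j. e (m, j)) (\<lambda>j. e (2, j)) s = 0) (\<lambda>e. dphi r (\<lambda>j. e (m, j)) (\<lambda>j. e (2, j)) s = 0)" for s
    using dfn_zero[of "pdphi r (Pair m) (Pair 2) s"]
    by (simp add: pev_pdphi comm_ring_hom.pev_pdphi[OF comm_ring_hom_ident])
  note eqs = dfn_ball[OF assms(2) this]
  have zero: "dfn (\<lambda>e. \<forall>j\<in>{..<3 * r}. e (2::nat, j) = 0) (\<lambda>e. \<forall>j\<in>{..<3 * r}. e (2, j) = 0)"
    by (rule dfn_ball[OF _ dfn_var_zero]) simp
  have "dfn (\<lambda>e. (\<forall>s\<in>S. dphi r (\<lambda>j. e (m, j)) (\<lambda>j. e (2, j)) s = 0) \<and> \<not> (\<forall>j\<in>{..<3 * r}. e (2::nat, j) = 0))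
     (\<lambda>e. (\<forall>s\<in>S. dphi r (\<lambda>j. e (m, j)) (\<lambda>j. e (2, j)) s = 0) \<and> \<not> (\<forall>j\<in>{..<3 * r}. e (2::nat, j) = 0))"
    by (rule dfn_and[OF eqs dfn_not[OF zero]])
  from dfn_not[OF dfn_exs[OF _ this, of "{2} \<times> {..<3 * r}"]] show ?thesis
    unfolding nondeg_iff_override_on[OF assms(1)] by simp
qed

lemma dfn_witness:
  assumes "finite S"
  shows "dfn (\<lambda>e. witness b r S (\<lambda>j. e (0::nat, j)) (\<lambda>j. e (1, j))) (\<lambda>e. witness b r S (\<lambda>j. e (0, j)) (\<lambda>j. e (1, j)))"
proof -
  have nz: "dfn (\<lambda>e. \<forall>j\<in>{..<3 * r}. e (0::nat, j) \<noteq> 0 \<and> e (1, j) \<noteq> 0) (\<lambda>e. \<forall>j\<in>{..<3 * r}. e (0, j) \<noteq> 0 \<and> e (1, j) \<noteq> 0)"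
    by (intro dfn_ball dfn_and dfn_nonzero) auto
  have eq: "dfn (\<lambda>e. \<forall>s\<in>S. phi r (\<lambda>j. e (1::nat, j)) s = phi r (\<lambda>j. e (0, j)) s) (\<lambda>e. \<forall>s\<in>S. phi r (\<lambda>j. e (1, j)) s = phi r (\<lambda>j. e (0, j)) s)"
    using assms by (intro dfn_ball dfn_phi_eq)
  have np: "dfn (\<lambda>e. \<exists>i\<in>{..<r}. \<forall>j\<in>{..<r}. \<exists>k\<in>{..<3}. e (1::nat, 3 * i + k) \<noteq> e (0, 3 * j + k))
     (\<lambda>e. \<exists>i\<in>{..<r}. \<forall>j\<in>{..<r}. \<exists>k\<in>{..<3}. e (1, 3 * i + k) \<noteq> e (0, 3 * j + k))"
    by (intro dfn_ball dfn_bex dfn_not dfn_var_eq) auto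
  have b: "dfn (\<lambda>e. b) (\<lambda>e. b)" using dfn_True dfn_False by (cases b) auto
  have "dfn (\<lambda>e. (\<forall>j\<in>{..<3 * r}. e (0::nat, j) \<noteq> 0 \<and> e (1, j) \<noteq> 0) \<and> nondeg r S (\<lambda>j. e (0, j)) \<and> nondeg r S (\<lambda>j. e (1, j)) \<and>
     (\<forall>s\<in>S. phi r (\<lambda>j. e (1, j)) s = phi r (\<lambda>j. e (0, j)) s) \<and> (b \<longrightarrow> (\<exists>i\<in>{..<r}. \<forall>j\<in>{..<r}. \<exists>k\<in>{..<3}. e (1, 3 * i + k) \<noteq> e (0, 3 * j + k))))
    (\<lambda>e. (\<forall>j\<in>{..<3 * r}. e (0, j) \<noteq> 0 \<and> e (1, j) \<noteq> 0) \<and> nondeg r S (\<lambda>j. e (0, j)) \<and> nondeg r S (\<lambda>j. e (1, j)) \<and>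
     (\<forall>s\<in>S. phi r (\<lambda>j. e (1, j)) s = phi r (\<lambda>j. e (0, j)) s) \<and> (b \<longrightarrow> (\<exists>i\<in>{..<r}. \<forall>j\<in>{..<r}. \<exists>k\<in>{..<3}. e (1, 3 * i + k) \<noteq> e (0, 3 * j + k))))"
    using assms by (intro dfn_and nz eq dfn_nondeg dfn_imp b np) auto
  then show ?thesis unfolding witness_def new_point_def Ball_def Bex_def by simp
qed

lemma transfer_dfn:
  assumes "dfn A B" "B e"
  shows "\<exists>e. A e"
proof -
  obtain \<psi> where \<psi>: "\<And>e. A e \<longleftrightarrow> qsat (\<lambda>x. x) e \<psi>" "\<And>e. B e \<longleftrightarrow> qsat hom e \<psi>"
    using assms(1) unfolding dfn_def by blast
  then show ?thesis using transfer_sat[of e \<psi>] assms(2) by simp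
qed

lemma transfer_witness:
  fixes z z' :: "nat \<Rightarrow> 'b"
  assumes "finite S" "witness b r S z z'"
  shows "\<exists>z z' :: nat \<Rightarrow> 'a. witness b r S z z'"
proof -
  have "witness b r S (\<lambda>j. (\<lambda>v. if fst v = 0 then z (snd v) else z' (snd v)) (0::nat, j))
      (\<lambda>j. (\<lambda>v. if fst v = 0 then z (snd v) else z' (snd v)) (1::nat, j))"
    using assms(2) by simp
  then show ?thesis
    using transfer_dfn[OF dfn_witness[OF assms(1), of b r], where e = "\<lambda>v. if fst v = 0 then z (snd v) else z' (snd v)"]
    by auto
qed

end

section \<open>Splitting the exponents by a line\<close>

definition weight :: "int \<Rightarrow> int \<Rightarrow> int \<Rightarrow> nat \<Rightarrow> int" where
  "weight w0 w1 w2 j = (if j mod 3 = 0 then w0 else if j mod 3 = 1 then w1 else w2)"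

lemma weight_simps [simp]:
  "weight w0 w1 w2 (3 * i) = w0" "weight w0 w1 w2 (3 * i + 1) = w1" "weight w0 w1 w2 (Suc (3 * i)) = w1"
  "weight w0 w1 w2 (3 * i + 2) = w2" "weight w0 w1 w2 (Suc (Suc (3 * i))) = w2"
  by (simp_all only: weight_def mod3_simps) auto

definition affine :: "int \<Rightarrow> int \<Rightarrow> int \<Rightarrow> nat \<times> nat \<Rightarrow> int" where
  "affine w0 w1 w2 s = w0 + w1 * int (fst s) + w2 * int (snd s)"

lemma powi_mult_nat: "(x powi a) ^ n = x powi (a * int n)" for x :: "'b::field"
  by (simp add: power_int_mult power_int_of_nat)

lemma phi_scale:
  fixes E :: "'b::field"
  assumes "E \<noteq> 0"
  shows "phi r (\<lambda>j. E powi weight w0 w1 w2 j * y j) s = E powi affine w0 w1 w2 s * phi r y s"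
  unfolding phi_def sum_distrib_left
proof (rule sum.cong[OF refl])
  fix i
  have "E powi affine w0 w1 w2 s = E powi w0 * (E powi w1) ^ fst s * (E powi w2) ^ snd s"
    using assms by (simp add: affine_def power_int_add powi_mult_nat)
  then show "E powi weight w0 w1 w2 (3 * i) * y (3 * i) * (E powi weight w0 w1 w2 (3 * i + 1) * y (3 * i + 1)) ^ fst s *
      (E powi weight w0 w1 w2 (3 * i + 2) * y (3 * i + 2)) ^ snd s =
    E powi affine w0 w1 w2 s * (y (3 * i) * y (3 * i + 1) ^ fst s * y (3 * i + 2) ^ snd s)"
    unfolding weight_simps power_mult_distrib by (simp add: mult_ac)
qed

lemma dphi_scale:
  fixes E :: "'b::field"
  assumes "E \<noteq> 0"
  shows "dphi r (\<lambda>j. E powi weight w0 w1 w2 j * y j) (\<lambda>j. E powi weight w0 w1 w2 j * u j) s =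
    E powi affine w0 w1 w2 s * dphi r y u s"
  unfolding dphi_def sum_distrib_left
proof (rule sum.cong[OF refl])
  fix i
  define a b c where "a = E powi w0" and "b = E powi w1" and "c = E powi w2"
  have E: "E powi affine w0 w1 w2 s = a * b ^ fst s * c ^ snd s"
    using assms by (simp add: affine_def power_int_add powi_mult_nat a_def b_def c_def)
  have n: "of_nat n * (x * t) ^ (n - 1) * (x * v) = x ^ n * (of_nat n * t ^ (n - 1) * v)" for n and x t v :: 'b
    by (cases n) (simp_all add: power_mult_distrib mult_ac)
  show "E powi weight w0 w1 w2 (3 * i) * u (3 * i) * (E powi weight w0 w1 w2 (3 * i + 1) * y (3 * i + 1)) ^ fst s *
      (E powi weight w0 w1 w2 (3 * i + 2) * y (3 * i + 2)) ^ snd s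
    + E powi weight w0 w1 w2 (3 * i) * y (3 * i) * (of_nat (fst s) * (E powi weight w0 w1 w2 (3 * i + 1) * y (3 * i + 1)) ^ (fst s - 1) *
        (E powi weight w0 w1 w2 (3 * i + 1) * u (3 * i + 1))) * (E powi weight w0 w1 w2 (3 * i + 2) * y (3 * i + 2)) ^ snd s
    + E powi weight w0 w1 w2 (3 * i) * y (3 * i) * (E powi weight w0 w1 w2 (3 * i + 1) * y (3 * i + 1)) ^ fst s *
        (of_nat (snd s) * (E powi weight w0 w1 w2 (3 * i + 2) * y (3 * i + 2)) ^ (snd s - 1) * (E powi weight w0 w1 w2 (3 * i + 2) * u (3 * i + 2)))
    = E powi affine w0 w1 w2 s * (u (3 * i) * y (3 * i + 1) ^ fst s * y (3 * i + 2) ^ snd s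
     + y (3 * i) * (of_nat (fst s) * y (3 * i + 1) ^ (fst s - 1) * u (3 * i + 1)) * y (3 * i + 2) ^ snd s
     + y (3 * i) * y (3 * i + 1) ^ fst s * (of_nat (snd s) * y (3 * i + 2) ^ (snd s - 1) * u (3 * i + 2)))"
    unfolding weight_simps a_def[symmetric] b_def[symmetric] c_def[symmetric] n E
    unfolding power_mult_distrib distrib_left by (simp only: mult_ac)
qed

text \<open>Comparison of orders at parameter 0: \<open>cemb c\<close> and \<open>emb f\<close> have
  order 0, and the power of the parameter has order \<open>m\<close>.\<close>

lemma emb_scale:
  assumes "emb fps_X powi m * cemb c = emb f" "c \<noteq> 0" "fps_nth f 0 \<noteq> 0"
  shows "m = 0"
proof (cases "m \<ge> 0")
  case True
  then have "emb (fps_X ^ nat m * fps_const c) = emb f"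
    using assms(1) by (simp add: emb_mult emb_power cemb_def power_int_def)
  then have "fps_nth (fps_X ^ nat m * fps_const c) 0 \<noteq> 0" using assms(3) by simp
  then show ?thesis using True by (simp add: fps_X_power_mult_nth split: if_splits)
next
  case False
  have X: "emb fps_X \<noteq> 0" by simp
  have "emb (fps_X ^ nat (- m) * f) = emb fps_X ^ nat (- m) * (emb fps_X powi m * cemb c)"
    using assms(1) by (simp add: emb_mult emb_power)
  also have "\<dots> = cemb c" using False X by (simp add: power_int_def mult.assoc[symmetric] power_mult_distrib[symmetric])
  finally have "fps_X ^ nat (- m) * f = fps_const c" by (simp add: cemb_def)
  then have "fps_nth (fps_X ^ nat (- m) * f) 0 = c" by simp
  then show ?thesis using False assms(2) by (simp add: fps_X_power_mult_nth split: if_splits)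
qed

text \<open>Let \<open>S1\<close> and \<open>S2\<close> be separated by the line \<open>affine = 0\<close>. Scaling the first group of points by powers
  of a parameter \<open>\<epsilon>\<close> decouples the equations for \<open>S1 \<union> S2\<close> at \<open>\<epsilon> = 0\<close> into those for \<open>S1\<close> and \<open>S2\<close>;
  nondegenerate solutions are lifted to power series in \<open>\<epsilon>\<close> and then transferred back to the ground field.\<close>

lemma witness_union:
  fixes z1 z1' z2 z2' :: "nat \<Rightarrow> 'a::{alg_closed_field, field_char_0}"
  assumes fin: "finite S1" "finite S2" and card: "card S1 = 3 * r1" "card S2 = 3 * r2"
    and pos: "\<And>s. s \<in> S1 \<Longrightarrow> affine w0 w1 w2 s > 0" and neg: "\<And>s. s \<in> S2 \<Longrightarrow> affine w0 w1 w2 s < 0"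
    and w1: "witness False r1 S1 z1 z1'" and w2: "witness b r2 S2 z2 z2'"
  shows "\<exists>z z' :: nat \<Rightarrow> 'a. witness b (r1 + r2) (S1 \<union> S2) z z'"
proof -
  define n where "n = 3 * r1 + 3 * r2"
  have disj: "S1 \<inter> S2 = {}" using pos neg by fastforce
  obtain ss where ss: "distinct ss" "set ss = S1 \<union> S2"
    using finite_distinct_list[of "S1 \<union> S2"] fin by auto
  have len: "length ss = n"
    using distinct_card[OF ss(1)] card_Un_disjoint[OF fin disj] card unfolding ss(2) n_def by simp
  define W where "W = affine w0 w1 w2"
  define E :: "'a fls alg_closure" where "E = emb fps_X"
  have E0: "E \<noteq> 0" by (simp add: E_def)
  \<comment> \<open>The equation of \<open>s\<close> is multiplied by \<open>E ^ q s\<close> to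
    clear negative powers, which gives the two groups the weights \<open>E ^ p s\<close> and
    \<open>E ^ q s\<close>. Exactly one of the exponents is positive, so at parameter 0 only one
    group remains.\<close>
  define p q where "p s = nat (- W s)" and "q s = nat (W s)" for s
  have pq: "p s = 0 \<and> q s > 0" if "s \<in> S1" for s using pos[OF that] by (simp add: p_def q_def W_def)
  have pq': "p s > 0 \<and> q s = 0" if "s \<in> S2" for s using neg[OF that] by (simp add: p_def q_def W_def)
  have Epq: "E ^ p s = E ^ q s * E powi (- W s)" for s
    using E0 by (cases "W s \<ge> 0") (auto simp: p_def q_def power_int_def power_inverse field_simps)
  define Gl :: "nat \<Rightarrow> (nat option, 'a) pexp" where
    "Gl i = PAdd (PMul (ppow (PV None) (p (ss ! i))) (pphi r1 Some (ss ! i)))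
      (PMul (ppow (PV None) (q (ss ! i))) (pphi r2 (\<lambda>j. Some (3 * r1 + j)) (ss ! i)))" for i
  define G :: "nat \<Rightarrow> (nat option, 'a) pexp" where
    "G i = PAdd (Gl i) (PMul (PC (-1)) (PAdd (PMul (ppow (PV None) (p (ss ! i))) (PC (phi r1 z1 (ss ! i))))
      (PMul (ppow (PV None) (q (ss ! i))) (PC (phi r2 z2 (ss ! i))))))" for i
  have varsl: "pvars (Gl i) \<subseteq> insert None (Some ` {..<n})" for i
  proof -
    have "pvars (pphi r1 Some (ss ! i)) \<subseteq> Some ` {..<n}"
      by (rule order_trans[OF pvars_pphi]) (auto simp: n_def)
    moreover have "pvars (pphi r2 (\<lambda>j. Some (3 * r1 + j)) (ss ! i)) \<subseteq> Some ` {..<n}"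
      by (rule order_trans[OF pvars_pphi]) (auto simp: n_def)
    moreover have "pvars (ppow (PV None) m) \<subseteq> {None}" for m
      by (rule order_trans[OF pvars_ppow]) simp
    ultimately show ?thesis unfolding Gl_def pvars.simps by blast
  qed
  have vars: "pvars (G i) \<subseteq> insert None (Some ` {..<n})" for i
  proof -
    have "pvars (ppow (PV None) m) \<subseteq> {None}" for m
      by (rule order_trans[OF pvars_ppow]) simp
    then show ?thesis using varsl[of i] unfolding G_def pvars.simps by blast
  qed
  define join :: "(nat \<Rightarrow> 'a) \<Rightarrow> nat \<Rightarrow> 'a" where "join z j = (if j < 3 * r1 then z1 j else z (j - 3 * r1))" for z j
  note ident = comm_ring_hom_ident
  have dGl: "pdev (\<lambda>x. x) (case_option 0 y) (case_option 0 u) (Gl i) =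
      0 ^ p (ss ! i) * dphi r1 y u (ss ! i) + 0 ^ q (ss ! i) * dphi r2 (\<lambda>j. y (3 * r1 + j)) (\<lambda>j. u (3 * r1 + j)) (ss ! i)" for y u i
    by (simp add: Gl_def comm_ring_hom.pdev_ppow[OF ident] comm_ring_hom.pdev_pphi[OF ident]
        comm_ring_hom.pev_ppow[OF ident])
  have dG: "pdev (\<lambda>x. x) (case_option 0 y) (case_option 0 u) (G i) = pdev (\<lambda>x. x) (case_option 0 y) (case_option 0 u) (Gl i)" for y u i
    by (simp add: G_def comm_ring_hom.pdev_ppow[OF ident])
  have inj: "\<forall>j<n. u j = 0"
    if z: "nondeg r2 S2 z" and u: "\<And>i. i < n \<Longrightarrow> pdev (\<lambda>x. x) (case_option 0 (join z)) (case_option 0 u) (Gl i) = 0" for z u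
  proof -
    have u': "0 ^ p s * dphi r1 (join z) u s + 0 ^ q s * dphi r2 (\<lambda>j. join z (3 * r1 + j)) (\<lambda>j. u (3 * r1 + j)) s = 0"
      if s: "s \<in> S1 \<union> S2" for s
    proof -
      obtain i where "i < n" "ss ! i = s" using s ss(2) len in_set_conv_nth[of s ss] by auto
      then show ?thesis using u[of i] unfolding dGl by simp
    qed
    have "dphi r1 z1 u s = 0" if "s \<in> S1" for s
    proof -
      have "dphi r1 z1 u s = dphi r1 (join z) u s" by (rule dphi_cong) (simp_all add: join_def)
      then show ?thesis using u'[of s] pq[OF that] that by (simp add: power_0_left)
    qed
    then have 1: "\<forall>j<3 * r1. u j = 0" using w1 unfolding witness_def nondeg_def by blast
    have "dphi r2 z (\<lambda>j. u (3 * r1 + j)) s = 0" if "s \<in> S2" for s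
      using u'[of s] pq'[OF that] that by (simp add: join_def power_0_left)
    then have 2: "\<forall>j<3 * r2. u (3 * r1 + j) = 0" using z unfolding nondeg_def by blast
    have "u j = 0" if "j < n" for j
      using 1 2[rule_format, of "j - 3 * r1"] that by (cases "j < 3 * r1") (auto simp: n_def)
    then show ?thesis by blast
  qed
  have nd: "nondeg r2 S2 z2" "nondeg r2 S2 z2'" using w2 unfolding witness_def by auto
  \<comment> \<open>Only the second solution needs lifting. The first is the constant family
    \<open>join z2\<close>, since the right-hand sides in \<open>G\<close> are the values taken by
    \<open>z1\<close> and \<open>z2\<close>.\<close>
  have "\<exists>Y. (\<forall>j. fps_nth (Y j) 0 = join z2' j) \<and> (\<forall>i<n. pev fps_const (case_option fps_X Y) (G i) = 0)"
  proof (rule hensel_lifting[OF vars])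
    fix i assume i: "i < n"
    have s: "ss ! i \<in> S1 \<union> S2" using i ss(2) len nth_mem[of i ss] by simp
    have "phi r1 (join z2') s = phi r1 z1 s" for s by (rule phi_cong) (simp add: join_def)
    moreover have "phi r2 (\<lambda>j. join z2' (3 * r1 + j)) s = phi r2 z2' s" for s by (simp add: join_def)
    moreover have "phi r2 z2' s = phi r2 z2 s" if "s \<in> S2" for s using w2 that unfolding witness_def by blast
    ultimately show "pval (case_option 0 (join z2')) (G i) = 0"
      using s pq[of "ss ! i"] pq'[of "ss ! i"]
      by (cases "ss ! i \<in> S1") (simp_all add: G_def Gl_def power_0_left
          comm_ring_hom.pev_ppow[OF ident] comm_ring_hom.pev_pphi[OF ident])
  qed (use inj[OF nd(2)] dG in auto)
  then obtain Y where Y: "\<And>j. fps_nth (Y j) 0 = join z2' j"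
    "\<And>i. i < n \<Longrightarrow> pev fps_const (case_option fps_X Y) (G i) = 0" by blast
  define Zv where "Zv y j = (if j < 3 * r1 then E powi weight (- w0) (- w1) (- w2) j * emb (y j) else emb (y j))"
    for y :: "nat \<Rightarrow> 'a fps" and j
  define Y0 where "Y0 j = fps_const (join z2 j)" for j
  have negW: "affine (- w0) (- w1) (- w2) s = - W s" for s by (simp add: W_def affine_def)
  have phiZ: "phi (r1 + r2) (Zv y) s = E powi (- W s) * phi r1 (\<lambda>j. emb (y j)) s + phi r2 (\<lambda>j. emb (y (3 * r1 + j))) s" for y s
  proof -
    have "phi r1 (Zv y) s = phi r1 (\<lambda>j. E powi weight (- w0) (- w1) (- w2) j * emb (y j)) s"
      by (rule phi_cong) (simp add: Zv_def)
    then show ?thesis unfolding phi_add phi_scale[OF E0] negW by (simp add: Zv_def)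
  qed
  have nondegZ: "nondeg (r1 + r2) (S1 \<union> S2) (Zv y)"
    if z: "nondeg r2 S2 z" and y: "\<And>j. fps_nth (y j) 0 = join z j" for z y
    unfolding nondeg_def
  proof (intro allI impI)
    fix U j assume U: "\<forall>s\<in>S1 \<union> S2. dphi (r1 + r2) (Zv y) U s = 0" and j: "j < 3 * (r1 + r2)"
    \<comment> \<open>Removing the scaling from the tangent vector as well turns the differential at
      \<open>Zv y\<close> into the one of the unscaled system \<open>Gl\<close>, to which
      \<open>generization_inj\<close> applies.\<close>
    define V where "V j = (if j < 3 * r1 then E powi (- weight (- w0) (- w1) (- w2) j) * U j else U j)" for j
    have UV: "U j = E powi weight (- w0) (- w1) (- w2) j * V j" if "j < 3 * r1" for j
      using that E0 by (simp add: V_def power_int_minus)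
    have d: "dphi (r1 + r2) (Zv y) U s = E powi (- W s) * dphi r1 (\<lambda>j. emb (y j)) V s
        + dphi r2 (\<lambda>j. emb (y (3 * r1 + j))) (\<lambda>j. V (3 * r1 + j)) s" for s
    proof -
      have "dphi r1 (Zv y) U s = dphi r1 (\<lambda>j. E powi weight (- w0) (- w1) (- w2) j * emb (y j))
          (\<lambda>j. E powi weight (- w0) (- w1) (- w2) j * V j) s"
        by (rule dphi_cong) (simp_all add: Zv_def UV)
      moreover have "V (3 * r1 + j) = U (3 * r1 + j)" for j by (simp add: V_def)
      ultimately show ?thesis unfolding dphi_add dphi_scale[OF E0] negW by (simp add: Zv_def)
    qed
    have "V j = 0"
    proof (rule generization_inj[OF varsl, where Y = y])
      show "\<forall>j<n. u j = 0"
        if "\<And>i. i < n \<Longrightarrow> pdev (\<lambda>x. x) (case_option 0 (\<lambda>j. fps_nth (y j) 0)) (case_option 0 u) (Gl i) = 0" for u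
        by (rule inj[OF z]) (use that in \<open>simp add: y\<close>)
      fix i assume i: "i < n"
      let ?s = "ss ! i"
      have "?s \<in> S1 \<union> S2" using i ss(2) len nth_mem[of i ss] by simp
      then have "E ^ q ?s * dphi (r1 + r2) (Zv y) U ?s = 0" using U by simp
      then have "E ^ p ?s * dphi r1 (\<lambda>j. emb (y j)) V ?s + E ^ q ?s * dphi r2 (\<lambda>j. emb (y (3 * r1 + j))) (\<lambda>j. V (3 * r1 + j)) ?s = 0"
        unfolding d Epq by (simp add: algebra_simps)
      then show "pdev cemb (case_option (emb fps_X) (\<lambda>j. emb (y j))) (case_option 0 V) (Gl i) = 0"
        by (simp add: Gl_def F.pdev_ppow F.pdev_pphi F.pev_ppow E_def)
    qed (use j in \<open>simp add: n_def\<close>)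
    show "U j = 0"
    proof (cases "j < 3 * r1")
      case True
      then show ?thesis using UV[OF True] \<open>V j = 0\<close> by simp
    next
      case False
      then have "V j = U j" by (simp add: V_def)
      then show ?thesis using \<open>V j = 0\<close> by simp
    qed
  qed
  have eq: "phi (r1 + r2) (Zv Y) s = phi (r1 + r2) (Zv Y0) s" if s: "s \<in> S1 \<union> S2" for s
  proof -
    obtain i where i: "i < n" "ss ! i = s" using s ss(2) len in_set_conv_nth[of s ss] by auto
    have "emb (pev fps_const (case_option fps_X Y) (G i)) = 0" using Y(2)[OF i(1)] by simp
    moreover have "(\<lambda>v. emb (case_option fps_X Y v)) = case_option E (\<lambda>j. emb (Y j))"
      by (auto simp: E_def split: option.splits)
    ultimately have "E ^ p s * phi r1 (\<lambda>j. emb (Y j)) s + E ^ q s * phi r2 (\<lambda>j. emb (Y (3 * r1 + j))) s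
        + (- (E ^ p s * cemb (phi r1 z1 s)) - E ^ q s * cemb (phi r2 z2 s)) = 0"
      unfolding pev_emb by (simp add: G_def Gl_def i F.pev_ppow F.pev_pphi F.hom_uminus)
    moreover have "x = c + d" if "x + (- c - d) = 0" for x c d :: "'a fls alg_closure"
      using that by (simp only: diff_conv_add_uminus flip: minus_add_distrib)
        (simp only: flip: diff_conv_add_uminus add: right_minus_eq)
    ultimately have "E ^ p s * phi r1 (\<lambda>j. emb (Y j)) s + E ^ q s * phi r2 (\<lambda>j. emb (Y (3 * r1 + j))) s
        = E ^ p s * cemb (phi r1 z1 s) + E ^ q s * cemb (phi r2 z2 s)"
      by blast
    then have "E ^ q s * (E powi (- W s) * phi r1 (\<lambda>j. emb (Y j)) s + phi r2 (\<lambda>j. emb (Y (3 * r1 + j))) s)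
        = E ^ q s * (E powi (- W s) * cemb (phi r1 z1 s) + cemb (phi r2 z2 s))"
      unfolding Epq by (simp add: algebra_simps)
    then have "E powi (- W s) * phi r1 (\<lambda>j. emb (Y j)) s + phi r2 (\<lambda>j. emb (Y (3 * r1 + j))) s
        = E powi (- W s) * cemb (phi r1 z1 s) + cemb (phi r2 z2 s)"
      using E0 by simp
    moreover have "phi r1 (\<lambda>j. emb (Y0 j)) s = cemb (phi r1 z1 s)"
      unfolding F.hom_phi by (rule phi_cong) (simp add: Y0_def join_def cemb_def)
    moreover have "phi r2 (\<lambda>j. emb (Y0 (3 * r1 + j))) s = cemb (phi r2 z2 s)"
      unfolding F.hom_phi by (rule phi_cong) (simp add: Y0_def join_def cemb_def)
    ultimately show ?thesis unfolding phiZ by simp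
  qed
  have join_nz: "join z2 j \<noteq> 0 \<and> join z2' j \<noteq> 0" if "j < n" for j
  proof (cases "j < 3 * r1")
    case True
    then show ?thesis using w1 by (simp add: witness_def join_def)
  next
    case False
    then have "j - 3 * r1 < 3 * r2" using that by (simp add: n_def)
    then show ?thesis using w2 False by (simp add: witness_def join_def)
  qed
  have nz: "Zv Y j \<noteq> 0 \<and> Zv Y0 j \<noteq> 0" if "j < 3 * (r1 + r2)" for j
  proof -
    have "Y j \<noteq> 0" using Y(1)[of j] join_nz[of j] that by (auto simp: n_def)
    moreover have "Y0 j \<noteq> 0" using join_nz[of j] that by (auto simp: n_def Y0_def)
    ultimately show ?thesis using E0 by (simp add: Zv_def)
  qed
  have new: "new_point (r1 + r2) (Zv Y0) (Zv Y)" if b: b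
  proof -
    obtain i where i: "i < r2" "\<And>j. j < r2 \<Longrightarrow> \<exists>k<3. z2' (3 * i + k) \<noteq> z2 (3 * j + k)"
      using w2 b unfolding witness_def new_point_def by blast
    have "\<exists>k<3. Zv Y (3 * (r1 + i) + k) \<noteq> Zv Y0 (3 * j + k)" if j: "j < r1 + r2" for j
    proof (cases "j < r1")
      case True
      \<comment> \<open>A constant form cannot separate two nonempty sets, so one of the two
        coordinates is truly rescaled in the first group. There it has nonzero order in the
        parameter, whereas in the second group it has order 0.\<close>
      have "\<exists>k\<in>{1, 2::nat}. weight w0 w1 w2 k \<noteq> 0"
      proof (rule ccontr)
        assume "\<not> ?thesis"
        then have "w1 = 0" "w2 = 0" using weight_simps[of w0 w1 w2 0] by (auto simp: numeral_2_eq_2)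
        moreover have "S1 \<noteq> {}" using True card(1) by auto
        then obtain s1 where "s1 \<in> S1" by blast
        moreover have "S2 \<noteq> {}" using i(1) card(2) by auto
        then obtain s2 where "s2 \<in> S2" by blast
        ultimately show False using pos[of s1] neg[of s2] by (simp add: affine_def)
      qed
      then obtain k where "k \<in> {1, 2}" and k0: "weight w0 w1 w2 k \<noteq> 0" by blast
      then have k: "k < 3" "weight w0 w1 w2 k \<noteq> 0" by auto
      have wk: "weight (- w0) (- w1) (- w2) (3 * j + k) = - weight w0 w1 w2 k"
        using k(1) by (auto simp: weight_def)
      have "Zv Y (3 * (r1 + i) + k) \<noteq> Zv Y0 (3 * j + k)"
      proof
        assume eq: "Zv Y (3 * (r1 + i) + k) = Zv Y0 (3 * j + k)"
        have "3 * j + k < 3 * r1" using True k(1) by simp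
        then have "emb fps_X powi (- weight w0 w1 w2 k) * cemb (z1 (3 * j + k)) = emb (Y (3 * (r1 + i) + k))"
          using eq wk by (simp add: Zv_def Y0_def join_def cemb_def E_def)
        moreover have "z1 (3 * j + k) \<noteq> 0" using w1 \<open>3 * j + k < 3 * r1\<close> unfolding witness_def by blast
        moreover have "fps_nth (Y (3 * (r1 + i) + k)) 0 \<noteq> 0"
          using Y(1) join_nz[of "3 * (r1 + i) + k"] i(1) k(1) by (simp add: n_def)
        ultimately have "- weight w0 w1 w2 k = 0" by (rule emb_scale)
        then show False using k(2) by simp
      qed
      then show ?thesis using k(1) by blast
    next
      case False
      then have "j - r1 < r2" using j by linarith
      \<comment> \<open>Within the second group nothing is scaled, and already the constant terms
        tell the points apart.\<close>
      from i(2)[OF this] obtain k where k: "k < 3" "z2' (3 * i + k) \<noteq> z2 (3 * (j - r1) + k)"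
        by blast
      have "Zv Y (3 * (r1 + i) + k) \<noteq> Zv Y0 (3 * j + k)"
      proof
        assume "Zv Y (3 * (r1 + i) + k) = Zv Y0 (3 * j + k)"
        then have "Y (3 * (r1 + i) + k) = fps_const (z2 (3 * j + k - 3 * r1))"
          using False by (simp add: Zv_def Y0_def join_def)
        then have "join z2' (3 * (r1 + i) + k) = z2 (3 * j + k - 3 * r1)" using Y(1)[of "3 * (r1 + i) + k"] by simp
        then have "z2' (3 * i + k) = z2 (3 * (j - r1) + k)"
          using False by (simp add: join_def diff_mult_distrib2 algebra_simps)
        then show False using k(2) by simp
      qed
      then show ?thesis using k(1) by blast
    qed
    moreover have "r1 + i < r1 + r2" using i(1) by simp
    ultimately show ?thesis unfolding new_point_def by blast
  qed
  have "witness b (r1 + r2) (S1 \<union> S2) (Zv Y0) (Zv Y)"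
    unfolding witness_def
  proof (intro conjI)
    show "nondeg (r1 + r2) (S1 \<union> S2) (Zv Y0)" by (rule nondegZ[OF nd(1)]) (simp add: Y0_def)
    show "nondeg (r1 + r2) (S1 \<union> S2) (Zv Y)" by (rule nondegZ[OF nd(2)]) (rule Y(1))
  qed (use nz eq new in auto)
  then show ?thesis using F.transfer_witness[of "S1 \<union> S2"] fin by blast
qed

section \<open>Two decompositions for rectangular sets of exponents\<close>

definition has_witness :: "'a::field itself \<Rightarrow> bool \<Rightarrow> (nat \<times> nat) set \<Rightarrow> bool" where
  "has_witness TYPE('a) b S \<longleftrightarrow> finite S \<and> (\<exists>r (z :: nat \<Rightarrow> 'a) z'. card S = 3 * r \<and> witness b r S z z')"

lemma has_witness_empty: "has_witness TYPE('a::field) False {}"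
  unfolding has_witness_def witness_def nondeg_def by simp

lemma has_witness_union:
  assumes "has_witness TYPE('a::{alg_closed_field, field_char_0}) False S1" "has_witness TYPE('a) b S2"
    and pos: "\<And>s. s \<in> S1 \<Longrightarrow> affine w0 w1 w2 s > 0" and neg: "\<And>s. s \<in> S2 \<Longrightarrow> affine w0 w1 w2 s < 0"
  shows "has_witness TYPE('a) b (S1 \<union> S2)"
proof -
  obtain r1 and z1 z1' :: "nat \<Rightarrow> 'a" where 1: "finite S1" "card S1 = 3 * r1" "witness False r1 S1 z1 z1'"
    using assms(1) unfolding has_witness_def by blast
  obtain r2 and z2 z2' :: "nat \<Rightarrow> 'a" where 2: "finite S2" "card S2 = 3 * r2" "witness b r2 S2 z2 z2'"
    using assms(2) unfolding has_witness_def by blast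
  have "S1 \<inter> S2 = {}" using pos neg by fastforce
  then have "card (S1 \<union> S2) = 3 * (r1 + r2)" using 1 2 by (simp add: card_Un_disjoint)
  then show ?thesis
    using witness_union[OF 1(1) 2(1) 1(2) 2(2) pos neg 1(3) 2(3)] 1(1) 2(1)
    unfolding has_witness_def by blast
qed

text \<open>The permutation of indices that exchanges the two coordinates in each triple and fixes
  the coefficient; it matches \<open>prod.swap\<close> on exponents.\<close>

definition flip :: "nat \<Rightarrow> nat" where
  "flip j = (if j mod 3 = 1 then j + 1 else if j mod 3 = 2 then j - 1 else j)"

lemma flip_simps: "flip (3 * i) = 3 * i" "flip (3 * i + 1) = 3 * i + 2" "flip (3 * i + 2) = 3 * i + 1"
  unfolding flip_def mod3_simps by simp_all

lemma mod3_cases: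
  fixes j :: nat
  obtains i where "j = 3 * i" | i where "j = 3 * i + 1" | i where "j = 3 * i + 2"
proof -
  have j: "j = 3 * (j div 3) + j mod 3" by simp
  have "j mod 3 < 3" by simp
  then consider "j mod 3 = 0" | "j mod 3 = 1" | "j mod 3 = 2" by linarith
  then show thesis
  proof cases
    case 1
    then show thesis using that(1)[of "j div 3"] j by linarith
  next
    case 2
    then show thesis using that(2)[of "j div 3"] j by linarith
  next
    case 3
    then show thesis using that(3)[of "j div 3"] j by linarith
  qed
qed

lemma flip_less: "j < 3 * r \<Longrightarrow> flip j < 3 * r"
proof (cases j rule: mod3_cases)
  case (2 i)
  moreover assume "j < 3 * r"
  ultimately have "i < r" by linarith
  then show ?thesis unfolding 2 flip_simps by linarith
qed (auto simp only: flip_simps)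

lemma flip_flip: "flip (flip j) = j"
  by (cases j rule: mod3_cases) (simp_all only: flip_simps)

lemma flip_add:
  assumes "k < 3"
  shows "flip (3 * i + k) = 3 * i + flip k" "flip k < 3"
proof -
  consider "k = 0" | "k = 1" | "k = 2" using assms by linarith
  then have "flip (3 * i + k) = 3 * i + flip k \<and> flip k < 3"
    by cases (use flip_simps[of i] flip_simps[of 0] in \<open>auto simp: numeral_2_eq_2\<close>)
  then show "flip (3 * i + k) = 3 * i + flip k" "flip k < 3" by auto
qed

lemma has_witness_swap:
  assumes "has_witness TYPE('a::field) b S"
  shows "has_witness TYPE('a) b (prod.swap ` S)"
proof -
  obtain r and z z' :: "nat \<Rightarrow> 'a" where w: "finite S" "card S = 3 * r" "witness b r S z z'"
    using assms unfolding has_witness_def by blast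
  have phi: "phi r (\<lambda>j. z (flip j)) (prod.swap s) = phi r z s" for z :: "nat \<Rightarrow> 'a" and s
    unfolding phi_def flip_simps by (simp add: mult_ac)
  have dphi: "dphi r (\<lambda>j. z (flip j)) (\<lambda>j. u (flip j)) (prod.swap s) = dphi r z u s" for z u :: "nat \<Rightarrow> 'a" and s
    unfolding dphi_def flip_simps by (simp add: mult_ac add_ac)
  have nd: "nondeg r (prod.swap ` S) (\<lambda>j. z (flip j))" if "nondeg r S z" for z :: "nat \<Rightarrow> 'a"
    unfolding nondeg_def
  proof (intro allI impI)
    fix u :: "nat \<Rightarrow> 'a" and j
    assume u: "\<forall>s\<in>prod.swap ` S. dphi r (\<lambda>j. z (flip j)) u s = 0" and j: "j < 3 * r"
    have "dphi r z (\<lambda>j. u (flip j)) s = 0" if "s \<in> S" for s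
      using dphi[of z "\<lambda>j. u (flip j)" s] u that by (simp add: flip_flip)
    then have "u (flip (flip j)) = 0" using that flip_less[OF j] unfolding nondeg_def by blast
    then show "u j = 0" by (simp add: flip_flip)
  qed
  have new: "new_point r (\<lambda>j. z (flip j)) (\<lambda>j. z' (flip j))" if np: "new_point r z z'"
  proof -
    obtain i where i: "i < r" "\<And>j. j < r \<Longrightarrow> \<exists>k<3. z' (3 * i + k) \<noteq> z (3 * j + k)"
      using np unfolding new_point_def by blast
    have "\<exists>k<3. z' (flip (3 * i + k)) \<noteq> z (flip (3 * j + k))" if j: "j < r" for j
    proof -
      obtain k where k: "k < 3" "z' (3 * i + k) \<noteq> z (3 * j + k)" using i(2)[OF j] by blast
      then have "z' (flip (3 * i + flip k)) \<noteq> z (flip (3 * j + flip k))"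
        using flip_add(1)[of "flip k"] flip_add(2)[of k] by (simp add: flip_flip)
      then show ?thesis using flip_add(2)[OF k(1)] by blast
    qed
    then show ?thesis using i(1) unfolding new_point_def by blast
  qed
  have "witness b r (prod.swap ` S) (\<lambda>j. z (flip j)) (\<lambda>j. z' (flip j))"
    using w(3) nd new flip_less unfolding witness_def by (auto simp: phi)
  moreover have "card (prod.swap ` S) = 3 * r" 
    using w(2) card_image[of prod.swap S] by (simp add: inj_on_def prod_eq_iff)
  ultimately show ?thesis using w(1) unfolding has_witness_def by blast
qed

text \<open>Twice the signed area of the triangle, that is, the determinant of the matrix with rows
  \<open>(1, a, b)\<close> for its vertices.\<close>

definition area :: "nat \<times> nat \<Rightarrow> nat \<times> nat \<Rightarrow> nat \<times> nat \<Rightarrow> int" where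
  "area s1 s2 s3 = (int (fst s2) - int (fst s1)) * (int (snd s3) - int (snd s1))
     - (int (fst s3) - int (fst s1)) * (int (snd s2) - int (snd s1))"

text \<open>At the point with all entries 1 the Jacobian has the rows \<open>(1, a, b)\<close>, so
  its determinant is \<open>area\<close>, which stays nonzero in characteristic zero.\<close>

lemma has_witness_triangle:
  assumes "area s1 s2 s3 \<noteq> 0"
  shows "has_witness TYPE('a::field_char_0) False {s1, s2, s3}"
proof -
  have "nondeg 1 {s1, s2, s3} (\<lambda>_. 1 :: 'a)"
    unfolding nondeg_def
  proof (intro allI impI)
    fix u :: "nat \<Rightarrow> 'a" and j :: nat
    assume u: "\<forall>s\<in>{s1, s2, s3}. dphi 1 (\<lambda>_. 1) u s = 0" and j: "j < 3 * 1"
    define x y where "x s = (of_nat (fst s) :: 'a)" and "y s = (of_nat (snd s) :: 'a)" for s :: "nat \<times> nat"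
    have eq: "u 0 + x s * u 1 + y s * u 2 = 0" if "s \<in> {s1, s2, s3}" for s
      using u that by (auto simp: dphi_def x_def y_def numeral_2_eq_2)
    have eqs: "u 0 + x s1 * u 1 + y s1 * u 2 = 0" "u 0 + x s2 * u 1 + y s2 * u 2 = 0" "u 0 + x s3 * u 1 + y s3 * u 2 = 0"
      by (rule eq, simp)+
    have D: "of_int (area s1 s2 s3) = (x s2 - x s1) * (y s3 - y s1) - (x s3 - x s1) * (y s2 - y s1)"
      by (simp add: area_def x_def y_def)
    have D0: "of_int (area s1 s2 s3) \<noteq> (0 :: 'a)" using assms by simp
    have "of_int (area s1 s2 s3) * u 1 =
        (y s3 - y s1) * ((u 0 + x s2 * u 1 + y s2 * u 2) - (u 0 + x s1 * u 1 + y s1 * u 2))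
      - (y s2 - y s1) * ((u 0 + x s3 * u 1 + y s3 * u 2) - (u 0 + x s1 * u 1 + y s1 * u 2))"
      unfolding D by (simp add: algebra_simps)
    then have "of_int (area s1 s2 s3) * u 1 = 0" unfolding eqs by simp
    then have u1: "u 1 = 0" using D0 by simp
    have "of_int (area s1 s2 s3) * u 2 =
        (x s2 - x s1) * ((u 0 + x s3 * u 1 + y s3 * u 2) - (u 0 + x s1 * u 1 + y s1 * u 2))
      - (x s3 - x s1) * ((u 0 + x s2 * u 1 + y s2 * u 2) - (u 0 + x s1 * u 1 + y s1 * u 2))"
      unfolding D by (simp add: algebra_simps)
    then have "of_int (area s1 s2 s3) * u 2 = 0" unfolding eqs by simp
    then have u2: "u 2 = 0" using D0 by simp
    have "u 0 = 0" using eq[of s1] u1 u2 by simp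
    moreover have "j = 0 \<or> j = 1 \<or> j = 2" using j by auto
    ultimately show "u j = 0" using u1 u2 by auto
  qed
  then have "witness False 1 {s1, s2, s3} (\<lambda>_. 1 :: 'a) (\<lambda>_. 1)" by (simp add: witness_def)
  moreover have "card {s1, s2, s3} = 3"
    using assms by (auto simp: area_def card_insert_if)
  ultimately show ?thesis unfolding has_witness_def
    by (intro conjI exI[of _ 1] exI[of _ "\<lambda>_. 1"]) simp_all
qed

definition peeled :: "((nat \<times> nat) \<times> (nat \<times> nat) \<times> (nat \<times> nat)) \<times> int \<times> int \<times> int \<Rightarrow> (nat \<times> nat) list" where
  "peeled = (\<lambda>((s1, s2, s3), _). [s1, s2, s3])"

text \<open>Each step cuts a triangle off the remaining exponents by the line \<open>affine w0 w1 w2 = 0\<close>.\<close>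

primrec peels :: "(((nat \<times> nat) \<times> (nat \<times> nat) \<times> (nat \<times> nat)) \<times> int \<times> int \<times> int) list \<Rightarrow> (nat \<times> nat) list \<Rightarrow> bool" where
  "peels [] base \<longleftrightarrow> True"
| "peels (t # ts) base \<longleftrightarrow> (case t of ((s1, s2, s3), w0, w1, w2) \<Rightarrow> area s1 s2 s3 \<noteq> 0 \<and>
     (\<forall>s\<in>set [s1, s2, s3]. affine w0 w1 w2 s > 0) \<and> (\<forall>s\<in>set (concat (map peeled ts) @ base). affine w0 w1 w2 s < 0)) \<and>
     peels ts base"

lemma has_witness_peels:
  assumes "has_witness TYPE('a::{alg_closed_field, field_char_0}) b (set base)" "peels ts base"
  shows "has_witness TYPE('a) b (set (concat (map peeled ts) @ base))"
  using assms(2)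
proof (induction ts)
  case Nil
  then show ?case using assms(1) by simp
next
  case (Cons t ts)
  obtain s1 s2 s3 w0 w1 w2 where t: "t = ((s1, s2, s3), w0, w1, w2)" by (cases t) auto
  have "has_witness TYPE('a) b ({s1, s2, s3} \<union> set (concat (map peeled ts) @ base))"
  proof (rule has_witness_union)
    show "has_witness TYPE('a) False {s1, s2, s3}"
      using Cons.prems by (intro has_witness_triangle) (simp add: t)
    show "has_witness TYPE('a) b (set (concat (map peeled ts) @ base))" using Cons by simp
  qed (use Cons.prems in \<open>auto simp: t\<close>)
  moreover have "set (concat (map peeled (t # ts)) @ base) = {s1, s2, s3} \<union> set (concat (map peeled ts) @ base)"
    by (auto simp: t peeled_def)
  ultimately show ?case by simp
qed

text \<open>Four of the six exponents lie on a line and the other two on the adjacent parallel lines. The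
  former determine two points up to a residual coordinate, and the latter give a quadratic equation for it.\<close>

definition hexad :: "(nat \<times> nat) list" where
  "hexad = [(0, 0), (0, 1), (0, 2), (1, 2), (2, 3), (3, 4)]"

lemma all_less_6: "(\<forall>j<6. P j) \<longleftrightarrow> P 0 \<and> P 1 \<and> P 2 \<and> P 3 \<and> P 4 \<and> P (5::nat)"
  by (simp add: numeral_eq_Suc All_less_Suc) blast

lemma has_witness_hexad: "has_witness TYPE('a::field_char_0) True (set hexad)"
proof -
  \<comment> \<open>The exponents \<open>(0, 1)\<close>, \<open>(1, 2)\<close>,
    \<open>(2, 3)\<close>, \<open>(3, 4)\<close> see only \<open>c * y\<close> and
    \<open>x * y\<close>, here 2, 2 for one point and 2, 4 for the other. The last two equations are
    \<open>2 / y1 + 2 / y2 = 3\<close> and \<open>2 * y1 + 2 * y2 = 6\<close>, so \<open>y1\<close>,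
    \<open>y2\<close> are 1 and 2 in either order: \<open>z\<close> takes one order and
    \<open>z'\<close> the other.\<close>
  define z :: "nat \<Rightarrow> 'a" where "z = (!) [2, 2, 1, 1, 2, 2]"
  define z' :: "nat \<Rightarrow> 'a" where "z' = (!) [1, 1, 2, 2, 4, 1]"
  have zv: "z 0 = 2" "z (Suc 0) = 2" "z 2 = 1" "z 3 = 1" "z 4 = 2" "z 5 = 2"
    and zv': "z' 0 = 1" "z' (Suc 0) = 1" "z' 2 = 2" "z' 3 = 2" "z' 4 = 4" "z' 5 = 1"
    by (simp_all add: z_def z'_def)
  have sum2: "(\<Sum>i<2. f i) = f 0 + f (1::nat)" for f :: "nat \<Rightarrow> 'a"
    by (simp add: numeral_2_eq_2)
  have nd: "nondeg 2 (set hexad) z"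
    unfolding nondeg_def
  proof (rule allI, rule impI)
    fix u :: "nat \<Rightarrow> 'a" assume u: "\<forall>s\<in>set hexad. dphi 2 z u s = 0"
    have e: "u 0 + u 3 = 0" "u 0 + 2 * u 2 + 2 * u 3 + u 5 = 0" "u 0 + 4 * u 2 + 4 * u 3 + 4 * u 5 = 0" "2 * u 0 + 2 * u 1 + 8 * u 2 + 8 * u 3 + 4 * u 4 + 8 * u 5 = 0" "4 * u 0 + 8 * u 1 + 24 * u 2 + 32 * u 3 + 32 * u 4 + 48 * u 5 = 0" "8 * u 0 + 24 * u 1 + 64 * u 2 + 128 * u 3 + 192 * u 4 + 256 * u 5 = 0"
      using u by (simp_all add: hexad_def dphi_def sum2 zv numeral_2_eq_2[symmetric] algebra_simps)
    \<comment> \<open>The multipliers are a row of the inverse Jacobian matrix with denominators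
      cleared; the integer left on the left-hand side is invertible in characteristic zero. The
      other unknowns are treated alike.\<close>
    have "6 * u 0 = 8 * (u 0 + u 3) - 24 * (u 0 + 2 * u 2 + 2 * u 3 + u 5) + 2 * (u 0 + 4 * u 2 + 4 * u 3 + 4 * u 5) + 24 * (2 * u 0 + 2 * u 1 + 8 * u 2 + 8 * u 3 + 4 * u 4 + 8 * u 5) - 9 * (4 * u 0 + 8 * u 1 + 24 * u 2 + 32 * u 3 + 32 * u 4 + 48 * u 5) + 1 * (8 * u 0 + 24 * u 1 + 64 * u 2 + 128 * u 3 + 192 * u 4 + 256 * u 5)"
      by (simp add: algebra_simps)
    then have u0: "u 0 = 0" unfolding e by simp
    have "24 * u 1 = 32 * (u 0 + u 3) - 96 * (u 0 + 2 * u 2 + 2 * u 3 + u 5) + 8 * (u 0 + 4 * u 2 + 4 * u 3 + 4 * u 5) + 48 * (2 * u 0 + 2 * u 1 + 8 * u 2 + 8 * u 3 + 4 * u 4 + 8 * u 5) - 12 * (4 * u 0 + 8 * u 1 + 24 * u 2 + 32 * u 3 + 32 * u 4 + 48 * u 5) + 1 * (8 * u 0 + 24 * u 1 + 64 * u 2 + 128 * u 3 + 192 * u 4 + 256 * u 5)"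
      by (simp add: algebra_simps)
    then have u1: "u 1 = 0" unfolding e by simp
    have "24 * u 2 = - 16 * (u 0 + u 3) - 4 * (u 0 + 4 * u 2 + 4 * u 3 + 4 * u 5) + 24 * (2 * u 0 + 2 * u 1 + 8 * u 2 + 8 * u 3 + 4 * u 4 + 8 * u 5) - 9 * (4 * u 0 + 8 * u 1 + 24 * u 2 + 32 * u 3 + 32 * u 4 + 48 * u 5) + 1 * (8 * u 0 + 24 * u 1 + 64 * u 2 + 128 * u 3 + 192 * u 4 + 256 * u 5)"
      by (simp add: algebra_simps)
    then have u2: "u 2 = 0" unfolding e by simp
    have "6 * u 3 = - 2 * (u 0 + u 3) + 24 * (u 0 + 2 * u 2 + 2 * u 3 + u 5) - 2 * (u 0 + 4 * u 2 + 4 * u 3 + 4 * u 5) - 24 * (2 * u 0 + 2 * u 1 + 8 * u 2 + 8 * u 3 + 4 * u 4 + 8 * u 5) + 9 * (4 * u 0 + 8 * u 1 + 24 * u 2 + 32 * u 3 + 32 * u 4 + 48 * u 5) - 1 * (8 * u 0 + 24 * u 1 + 64 * u 2 + 128 * u 3 + 192 * u 4 + 256 * u 5)"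
      by (simp add: algebra_simps)
    then have u3: "u 3 = 0" unfolding e by simp
    have "48 * u 4 = - 32 * (u 0 + u 3) + 96 * (u 0 + 2 * u 2 + 2 * u 3 + u 5) - 32 * (u 0 + 4 * u 2 + 4 * u 3 + 4 * u 5) - 36 * (2 * u 0 + 2 * u 1 + 8 * u 2 + 8 * u 3 + 4 * u 4 + 8 * u 5) + 12 * (4 * u 0 + 8 * u 1 + 24 * u 2 + 32 * u 3 + 32 * u 4 + 48 * u 5) - 1 * (8 * u 0 + 24 * u 1 + 64 * u 2 + 128 * u 3 + 192 * u 4 + 256 * u 5)"
      by (simp add: algebra_simps)
    then have u4: "u 4 = 0" unfolding e by simp
    have "12 * u 5 = 8 * (u 0 + u 3) - 36 * (u 0 + 2 * u 2 + 2 * u 3 + u 5) + 8 * (u 0 + 4 * u 2 + 4 * u 3 + 4 * u 5) + 24 * (2 * u 0 + 2 * u 1 + 8 * u 2 + 8 * u 3 + 4 * u 4 + 8 * u 5) - 9 * (4 * u 0 + 8 * u 1 + 24 * u 2 + 32 * u 3 + 32 * u 4 + 48 * u 5) + 1 * (8 * u 0 + 24 * u 1 + 64 * u 2 + 128 * u 3 + 192 * u 4 + 256 * u 5)"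
      by (simp add: algebra_simps)
    then have u5: "u 5 = 0" unfolding e by simp
    show "\<forall>j<3 * 2. u j = 0" using u0 u1 u2 u3 u4 u5 by (simp add: all_less_6)
  qed
  have nd': "nondeg 2 (set hexad) z'"
    unfolding nondeg_def
  proof (rule allI, rule impI)
    fix u :: "nat \<Rightarrow> 'a" assume u: "\<forall>s\<in>set hexad. dphi 2 z' u s = 0"
    have e: "u 0 + u 3 = 0" "2 * u 0 + u 2 + u 3 + 2 * u 5 = 0" "4 * u 0 + 4 * u 2 + u 3 + 4 * u 5 = 0" "4 * u 0 + 4 * u 1 + 4 * u 2 + 4 * u 3 + 2 * u 4 + 16 * u 5 = 0" "8 * u 0 + 16 * u 1 + 12 * u 2 + 16 * u 3 + 16 * u 4 + 96 * u 5 = 0" "16 * u 0 + 48 * u 1 + 32 * u 2 + 64 * u 3 + 96 * u 4 + 512 * u 5 = 0"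
      using u by (simp_all add: hexad_def dphi_def sum2 zv' numeral_2_eq_2[symmetric] algebra_simps)
    have "6 * u 0 = - 2 * (u 0 + u 3) - 12 * (2 * u 0 + u 2 + u 3 + 2 * u 5) - 2 * (4 * u 0 + 4 * u 2 + u 3 + 4 * u 5) + 24 * (4 * u 0 + 4 * u 1 + 4 * u 2 + 4 * u 3 + 2 * u 4 + 16 * u 5) - 9 * (8 * u 0 + 16 * u 1 + 12 * u 2 + 16 * u 3 + 16 * u 4 + 96 * u 5) + 1 * (16 * u 0 + 48 * u 1 + 32 * u 2 + 64 * u 3 + 96 * u 4 + 512 * u 5)"
      by (simp add: algebra_simps)
    then have u0: "u 0 = 0" unfolding e by simp
    have "48 * u 1 = - 16 * (u 0 + u 3) - 96 * (2 * u 0 + u 2 + u 3 + 2 * u 5) - 16 * (4 * u 0 + 4 * u 2 + u 3 + 4 * u 5) + 144 * (4 * u 0 + 4 * u 1 + 4 * u 2 + 4 * u 3 + 2 * u 4 + 16 * u 5) - 48 * (8 * u 0 + 16 * u 1 + 12 * u 2 + 16 * u 3 + 16 * u 4 + 96 * u 5) + 5 * (16 * u 0 + 48 * u 1 + 32 * u 2 + 64 * u 3 + 96 * u 4 + 512 * u 5)"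
      by (simp add: algebra_simps)
    then have u1: "u 1 = 0" unfolding e by simp
    have "12 * u 2 = 8 * (u 0 + u 3) + 8 * (4 * u 0 + 4 * u 2 + u 3 + 4 * u 5) - 24 * (4 * u 0 + 4 * u 1 + 4 * u 2 + 4 * u 3 + 2 * u 4 + 16 * u 5) + 9 * (8 * u 0 + 16 * u 1 + 12 * u 2 + 16 * u 3 + 16 * u 4 + 96 * u 5) - 1 * (16 * u 0 + 48 * u 1 + 32 * u 2 + 64 * u 3 + 96 * u 4 + 512 * u 5)"
      by (simp add: algebra_simps)
    then have u2: "u 2 = 0" unfolding e by simp
    have "6 * u 3 = 8 * (u 0 + u 3) + 12 * (2 * u 0 + u 2 + u 3 + 2 * u 5) + 2 * (4 * u 0 + 4 * u 2 + u 3 + 4 * u 5) - 24 * (4 * u 0 + 4 * u 1 + 4 * u 2 + 4 * u 3 + 2 * u 4 + 16 * u 5) + 9 * (8 * u 0 + 16 * u 1 + 12 * u 2 + 16 * u 3 + 16 * u 4 + 96 * u 5) - 1 * (16 * u 0 + 48 * u 1 + 32 * u 2 + 64 * u 3 + 96 * u 4 + 512 * u 5)"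
      by (simp add: algebra_simps)
    then have u3: "u 3 = 0" unfolding e by simp
    have "24 * u 4 = 64 * (u 0 + u 3) - 192 * (2 * u 0 + u 2 + u 3 + 2 * u 5) + 16 * (4 * u 0 + 4 * u 2 + u 3 + 4 * u 5) + 156 * (4 * u 0 + 4 * u 1 + 4 * u 2 + 4 * u 3 + 2 * u 4 + 16 * u 5) - 60 * (8 * u 0 + 16 * u 1 + 12 * u 2 + 16 * u 3 + 16 * u 4 + 96 * u 5) + 7 * (16 * u 0 + 48 * u 1 + 32 * u 2 + 64 * u 3 + 96 * u 4 + 512 * u 5)"
      by (simp add: algebra_simps)
    then have u4: "u 4 = 0" unfolding e by simp
    have "24 * u 5 = - 16 * (u 0 + u 3) + 36 * (2 * u 0 + u 2 + u 3 + 2 * u 5) - 4 * (4 * u 0 + 4 * u 2 + u 3 + 4 * u 5) - 24 * (4 * u 0 + 4 * u 1 + 4 * u 2 + 4 * u 3 + 2 * u 4 + 16 * u 5) + 9 * (8 * u 0 + 16 * u 1 + 12 * u 2 + 16 * u 3 + 16 * u 4 + 96 * u 5) - 1 * (16 * u 0 + 48 * u 1 + 32 * u 2 + 64 * u 3 + 96 * u 4 + 512 * u 5)"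
      by (simp add: algebra_simps)
    then have u5: "u 5 = 0" unfolding e by simp
    show "\<forall>j<3 * 2. u j = 0" using u0 u1 u2 u3 u4 u5 by (simp add: all_less_6)
  qed
  have "\<forall>s\<in>set hexad. phi 2 z' s = phi 2 z s"
    by (simp add: hexad_def phi_def sum2 zv zv' numeral_2_eq_2[symmetric])
  moreover have "\<forall>j<3 * 2. z j \<noteq> 0 \<and> z' j \<noteq> 0" by (simp add: all_less_6 zv zv')
  moreover have "new_point 2 z z'"
    unfolding new_point_def
  proof (rule exI[of _ 0], rule conjI)
    have "\<exists>k<3. z' (3 * 0 + k) \<noteq> z (3 * 0 + k)" by (rule exI[of _ 0]) (simp add: zv zv')
    moreover have "\<exists>k<3. z' (3 * 0 + k) \<noteq> z (3 * 1 + k)" by (rule exI[of _ 1]) (simp add: zv zv')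
    ultimately show "\<forall>j<2. \<exists>k<3. z' (3 * 0 + k) \<noteq> z (3 * j + k)"
      by (simp only: numeral_2_eq_2 All_less_Suc) simp
  qed simp
  ultimately have "witness True 2 (set hexad) z z'" using nd nd' by (simp add: witness_def)
  moreover have "card (set hexad) = 3 * 2" by (simp add: hexad_def)
  ultimately show ?thesis unfolding has_witness_def by blast
qed

section \<open>Assembling rectangles from blocks\<close>

abbreviation rect :: "nat \<Rightarrow> nat \<Rightarrow> nat \<Rightarrow> nat \<Rightarrow> (nat \<times> nat) set" where
  "rect a a' b b' \<equiv> {a..<a'} \<times> {b..<b'}"

lemma has_witness_rect_base:
  assumes "peels ts hexad" "set (concat (map peeled ts) @ hexad) = set (List.product [0..<m] [0..<n])"
  shows "has_witness TYPE('a::{alg_closed_field, field_char_0}) True (rect 0 m 0 n)"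
  using has_witness_peels[OF has_witness_hexad assms(1)] unfolding assms(2)
  by (simp add: atLeast_upt lessThan_atLeast0)

text \<open>The 24 exponents are the hexad and six triangles, each listed with an integral form that
  is positive on it and negative on all that remains. Both conditions are finite
  computations.\<close>

lemma has_witness_4_6: "has_witness TYPE('a::{alg_closed_field, field_char_0}) True (rect 0 4 0 6)"
  by (rule has_witness_rect_base[where ts = "[(((0, 4), (0, 5), (1, 5)), - 7, - 2, 2), (((1, 4), (2, 5), (3, 5)), - 13, - 2, 4), (((0, 3), (1, 3), (2, 4)), - 13, - 4, 6), (((2, 0), (3, 0), (3, 1)), - 3, 2, - 2), (((2, 1), (3, 2), (3, 3)), - 5, 4, - 2), (((1, 0), (1, 1), (2, 2)), - 1, 8, - 6)]"]) code_simp+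

lemma has_witness_5_6: "has_witness TYPE('a::{alg_closed_field, field_char_0}) True (rect 0 5 0 6)"
  by (rule has_witness_rect_base[where ts = "[(((3, 0), (4, 0), (4, 1)), - 5, 2, - 2), (((3, 1), (4, 2), (4, 3)), - 9, 4, - 2), (((0, 4), (0, 5), (1, 5)), - 7, - 2, 2), (((1, 0), (2, 0), (2, 1)), - 1, 4, - 6), (((1, 4), (2, 5), (3, 5)), - 13, - 2, 4), (((3, 2), (3, 3), (4, 4)), - 5, 6, - 4), (((0, 3), (1, 3), (2, 4)), - 17, - 6, 8), (((1, 1), (2, 2), (4, 5)), - 1, 8, - 6)]"]) code_simp+

text \<open>The 45 exponents are the hexad and thirteen triangles. Blocks of six exponents cannot
  lead here from the two smaller rectangles, whose sizes 24 and 30 are divisible by 6.\<close>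

lemma has_witness_5_9: "has_witness TYPE('a::{alg_closed_field, field_char_0}) True (rect 0 5 0 9)"
  by (rule has_witness_rect_base[where ts = "[(((3, 8), (4, 7), (4, 8)), - 21, 2, 2), (((1, 8), (2, 8), (3, 7)), - 33, 2, 4), (((3, 6), (4, 5), (4, 6)), - 41, 6, 4), (((3, 0), (4, 0), (4, 1)), - 5, 2, - 2), (((3, 5), (4, 3), (4, 4)), - 49, 10, 4), (((1, 0), (2, 0), (3, 1)), - 1, 2, - 4), (((0, 8), (1, 7), (2, 7)), - 29, 2, 4), (((3, 2), (3, 3), (4, 2)), - 11, 6, - 2), (((1, 1), (2, 1), (2, 2)), - 1, 8, - 6), (((0, 6), (0, 7), (1, 6)), - 21, - 2, 4), (((0, 5), (1, 5), (2, 6)), - 17, - 2, 4), (((0, 3), (0, 4), (1, 4)), - 9, - 6, 4), (((1, 3), (2, 4), (2, 5)), - 13, - 4, 6)]"]) code_simp+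

lemma has_witness_rect_right:
  assumes "has_witness TYPE('a::{alg_closed_field, field_char_0}) b (rect a m c d)"
    "has_witness TYPE('a) False (rect m a' c d)" "a \<le> m" "m \<le> a'"
  shows "has_witness TYPE('a) b (rect a a' c d)"
proof -
  \<comment> \<open>The separating form is twice \<open>x - (m - 1/2)\<close>, whose zero line runs
    between two columns.\<close>
  have "has_witness TYPE('a) b (rect m a' c d \<union> rect a m c d)"
    by (rule has_witness_union[OF assms(2,1), of "1 - 2 * int m" 2 0]) (auto simp: affine_def)
  moreover have "rect m a' c d \<union> rect a m c d = rect a a' c d" using assms(3,4) by auto
  ultimately show ?thesis by simp
qed

lemma has_witness_rect_top:
  assumes "has_witness TYPE('a::{alg_closed_field, field_char_0}) b (rect a a' c m)"
    "has_witness TYPE('a) False (rect a a' m d)" "c \<le> m" "m \<le> d"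
  shows "has_witness TYPE('a) b (rect a a' c d)"
proof -
  have "has_witness TYPE('a) b (rect a a' m d \<union> rect a a' c m)"
    by (rule has_witness_union[OF assms(2,1), of "1 - 2 * int m" 0 2]) (auto simp: affine_def)
  moreover have "rect a a' m d \<union> rect a a' c m = rect a a' c d" using assms(3,4) by auto
  ultimately show ?thesis by simp
qed

lemma has_witness_rect_2_3:
  "has_witness TYPE('a::{alg_closed_field, field_char_0}) False (rect a (a + 2) b (b + 3))"
proof -
  \<comment> \<open>The block is cut along the antidiagonal
    \<open>x + y = a + b + 3/2\<close>.\<close>
  have "has_witness TYPE('a) False ({(a, b), (a, b + 1), (a + 1, b)} \<union> {(a, b + 2), (a + 1, b + 1), (a + 1, b + 2)})"
    by (rule has_witness_union[OF has_witness_triangle has_witness_triangle, of _ _ _ _ _ _ "3 + 2 * int a + 2 * int b" "- 2" "- 2"])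
       (auto simp: area_def affine_def)
  moreover have "{(a, b), (a, b + 1), (a + 1, b)} \<union> {(a, b + 2), (a + 1, b + 1), (a + 1, b + 2)} = rect a (a + 2) b (b + 3)"
    by (auto simp: eval_nat_numeral less_Suc_eq le_Suc_eq)
  ultimately show ?thesis by simp
qed

lemma has_witness_rect_3_2:
  "has_witness TYPE('a::{alg_closed_field, field_char_0}) False (rect a (a + 3) b (b + 2))"
proof -
  have "prod.swap ` rect b (b + 2) a (a + 3) = rect a (a + 3) b (b + 2)"
    by (auto simp: image_iff)
  then show ?thesis using has_witness_swap[OF has_witness_rect_2_3[of b a, where ?'a = 'a]] by simp
qed

lemma has_witness_rect_repeat:
  assumes "\<And>a b. has_witness TYPE('a::{alg_closed_field, field_char_0}) False (rect a (a + p) b (b + q))"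
  shows "has_witness TYPE('a) False (rect a (a + i * p) b (b + j * q))"
proof -
  have col: "has_witness TYPE('a) False (rect a (a + p) b (b + j * q))" for a
  proof (induction j)
    case (Suc j)
    show ?case
      by (rule has_witness_rect_top[OF Suc, of "b + Suc j * q"]) (use assms[of a "b + j * q"] in \<open>auto simp: algebra_simps\<close>)
  qed (simp add: has_witness_empty)
  show ?thesis
  proof (induction i)
    case (Suc i)
    show ?case
      by (rule has_witness_rect_right[OF Suc, of "a + Suc i * p"]) (use col[of "a + i * p"] in \<open>auto simp: algebra_simps\<close>)
  qed (simp add: has_witness_empty)
qed

lemma has_witness_rect_2m_3n:
  "has_witness TYPE('a::{alg_closed_field, field_char_0}) False (rect a (a + 2 * i) b (b + 3 * j))"
  using has_witness_rect_repeat[of 2 3 a i b j, OF has_witness_rect_2_3] by (simp add: mult.commute)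

text \<open>An odd width is 3 plus an even number. Heights divisible by 6 suit both kinds of blocks,
  3 x 2 for the first three columns and 2 x 3 for the others.\<close>

lemma has_witness_rect_6n:
  assumes "m \<ge> 2"
  shows "has_witness TYPE('a::{alg_closed_field, field_char_0}) False (rect a (a + m) b (b + 6 * j))"
proof (cases "even m")
  case True
  then obtain i where "m = 2 * i" by blast
  then show ?thesis using has_witness_rect_2m_3n[of a i b "2 * j", where ?'a = 'a] by (simp add: mult.assoc)
next
  case False
  then have "\<exists>i. m = 3 + 2 * i" using assms by presburger
  then obtain i where m: "m = 3 + 2 * i" ..
  have "has_witness TYPE('a) False (rect a (a + 1 * 3) b (b + (3 * j) * 2))"
    by (rule has_witness_rect_repeat) (rule has_witness_rect_3_2)
  then have 1: "has_witness TYPE('a) False (rect a (a + 3) b (b + 6 * j))" by (simp add: mult.commute mult.left_commute)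
  have 2: "has_witness TYPE('a) False (rect (a + 3) (a + 3 + 2 * i) b (b + 6 * j))"
    using has_witness_rect_2m_3n[of "a + 3" i b "2 * j", where ?'a = 'a] by (simp add: mult.assoc)
  show ?thesis using has_witness_rect_right[OF 1 2] by (simp add: m add.assoc)
qed

text \<open>Columns are added in pairs, so only the parity of \<open>m\<close> matters and the
  widths 4 and 5 suffice. Width 5 in turn grows upwards only in steps of 6, which makes the parity
  of \<open>n\<close> matter there.\<close>

lemma has_witness_rect:
  assumes "m \<ge> 4" "n \<ge> 6" "3 dvd n"
  shows "has_witness TYPE('a::{alg_closed_field, field_char_0}) True (rect 0 m 0 n)"
proof -
  have extend: "has_witness TYPE('a) True (rect 0 m 0 n)"
    if k: "has_witness TYPE('a) True (rect 0 k 0 n)" "k \<le> m" "even (m - k)" for k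
  proof -
    obtain i where i: "m - k = 2 * i" using k(3) by blast
    obtain j where j: "n = 3 * j" using assms(3) by blast
    have "m = k + 2 * i" using k(2) i by linarith
    then have "has_witness TYPE('a) False (rect k m 0 n)"
      using has_witness_rect_2m_3n[of k i 0 j, where ?'a = 'a] j by simp
    then show ?thesis using has_witness_rect_right[OF k(1)] k(2) by blast
  qed
  show ?thesis
  proof (cases "even m")
    case True
    have "\<exists>j. n = 6 + 3 * j" using assms(2,3) by presburger
    then obtain j where n: "n = 6 + 3 * j" ..
    have "has_witness TYPE('a) False (rect 0 4 6 n)"
      using has_witness_rect_2m_3n[of 0 2 6 j, where ?'a = 'a] by (simp add: n)
    then have "has_witness TYPE('a) True (rect 0 4 0 n)"
      using has_witness_rect_top[OF has_witness_4_6, of n] assms(2) by simp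
    then show ?thesis using extend[of 4] assms(1) True by simp
  next
    case False
    then have m: "m \<ge> 5" using assms(1) by presburger
    have "has_witness TYPE('a) True (rect 0 5 0 n)"
    proof (cases "even n")
      case True
      then have "\<exists>j. n = 6 + 6 * j" using assms(2,3) by presburger
      then obtain j where n: "n = 6 + 6 * j" ..
      have "has_witness TYPE('a) False (rect 0 5 6 n)"
        using has_witness_rect_6n[of 5 0 6 j, where ?'a = 'a] by (simp add: n)
      then show ?thesis using has_witness_rect_top[OF has_witness_5_6, of n] assms(2) by simp
    next
      case False
      then have "\<exists>j. n = 9 + 6 * j" using assms(2,3) by presburger
      then obtain j where n: "n = 9 + 6 * j" ..
      have "has_witness TYPE('a) False (rect 0 5 9 n)"
        using has_witness_rect_6n[of 5 0 9 j, where ?'a = 'a] by (simp add: n)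
      then show ?thesis using has_witness_rect_top[OF has_witness_5_9, of n] n by simp
    qed
    then show ?thesis using extend[of 5] m False by simp
  qed
qed

theorem has_witness_grid:
  assumes "4 \<le> d1" "4 \<le> d2" "3 dvd (d1 + 1) * (d2 + 1)"
  shows "has_witness TYPE('a::{alg_closed_field, field_char_0}) True ({..d1} \<times> {..d2})"
proof -
  have rect: "{..d1} \<times> {..d2} = rect 0 (d1 + 1) 0 (d2 + 1)" by auto
  have "prime (3::nat)" by simp
  then have "3 dvd d1 + 1 \<or> 3 dvd d2 + 1" using assms(3) prime_dvd_mult_iff by blast
  then show ?thesis
  proof
    assume "3 dvd d2 + 1"
    then have "d2 + 1 \<ge> 6" using assms(2) by presburger
    then show ?thesis unfolding rect using \<open>3 dvd d2 + 1\<close> assms(1) by (intro has_witness_rect) auto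
  next
    assume "3 dvd d1 + 1"
    then have "d1 + 1 \<ge> 6" using assms(1) by presburger
    then have "has_witness TYPE('a) True (rect 0 (d2 + 1) 0 (d1 + 1))"
      using \<open>3 dvd d1 + 1\<close> assms(2) by (intro has_witness_rect) auto
    moreover have "prod.swap ` rect 0 (d2 + 1) 0 (d1 + 1) = rect 0 (d1 + 1) 0 (d2 + 1)" by (auto simp: image_iff)
    ultimately show ?thesis unfolding rect using has_witness_swap by metis
  qed
qed

section \<open>The generic number of decompositions\<close>

text \<open>Leibniz' formula written as an expression, so that the nonvanishing of a determinant is
  a polynomial condition in the entries. The order in which the permutations are listed is
  immaterial.\<close>

definition pdet :: "nat \<Rightarrow> (nat \<Rightarrow> nat \<Rightarrow> ('v, 'a::comm_ring_1) pexp) \<Rightarrow> ('v, 'a) pexp" where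
  "pdet n M = psum (\<lambda>p. PMul (PC (signof p)) (pprod (\<lambda>i. M i (p i)) [0..<n]))
     (SOME ps. distinct ps \<and> set ps = {p. p permutes {0..<n}})"

lemma perm_list:
  fixes n :: nat
  defines "ps \<equiv> (SOME ps. distinct ps \<and> set ps = {p. p permutes {0..<n}})"
  shows "distinct ps" "set ps = {p. p permutes {0..<n}}"
proof -
  have "\<exists>ps. distinct ps \<and> set ps = {p. p permutes {0..<n}}"
    using finite_distinct_list[OF finite_permutations[of "{0..<n}"]] by auto
  from someI_ex[OF this] show "distinct ps" "set ps = {p. p permutes {0..<n}}" unfolding ps_def by auto
qed

lemma pval_pdet: "pval e (pdet n M) = Determinant.det (Matrix.mat n n (\<lambda>(i, j). pval e (M i j)))"
proof -
  have "pval e (pdet n M) = (\<Sum>p\<in>{p. p permutes {0..<n}}. signof p * (\<Prod>i<n. pval e (M i (p i))))"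
    unfolding pdet_def pval_psum pev.simps pval_pprod prod_list_upt
    by (simp add: sum_list_distinct_conv_sum_set perm_list)
  also have "\<dots> = Determinant.det (Matrix.mat n n (\<lambda>(i, j). pval e (M i j)))"
    unfolding Determinant.det_def
    by (auto simp: atLeast0LessThan permutes_in_image intro!: sum.cong prod.cong arg_cong2[of _ _ _ _ "(*)"])
  finally show ?thesis .
qed

lemma pvars_pdet:
  assumes "\<And>i j. i < n \<Longrightarrow> j < n \<Longrightarrow> pvars (M i j) \<subseteq> V"
  shows "pvars (pdet n M) \<subseteq> V"
proof
  fix v assume "v \<in> pvars (pdet n M)"
  then obtain p i where p: "p permutes {0..<n}" "i < n" "v \<in> pvars (M i (p i))"
    unfolding pdet_def pvars_psum perm_list by (auto simp: pvars_pprod)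
  then have "p i < n" using permutes_in_image[OF p(1), of i] by simp
  then show "v \<in> V" using assms p by blast
qed

text \<open>Injectivity of the Vandermonde matrix by interpolation: the polynomial vanishing at all
  nodes except \<open>t j\<close> isolates \<open>u j\<close>.\<close>

lemma moments_zero:
  fixes t u :: "nat \<Rightarrow> 'a::field"
  assumes "inj_on t {..<r}" "\<And>m. m < r \<Longrightarrow> (\<Sum>j<r. u j * t j ^ m) = 0" "j < r"
  shows "u j = 0"
proof -
  have vanish: "(\<Sum>j<r. u j * poly p (t j)) = 0" if "degree p < r" for p
  proof -
    have "(\<Sum>j<r. u j * poly p (t j)) = (\<Sum>j<r. \<Sum>m\<le>degree p. coeff p m * (u j * t j ^ m))"
      by (simp add: poly_altdef sum_distrib_left mult_ac)
    also have "\<dots> = (\<Sum>m\<le>degree p. coeff p m * (\<Sum>j<r. u j * t j ^ m))"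
      by (subst sum.swap) (simp add: sum_distrib_left)
    also have "\<dots> = 0" using assms(2) that by (intro sum.neutral) auto
    finally show ?thesis .
  qed
  define p where "p = (\<Prod>l\<in>{..<r} - {j}. [:- t l, 1:])"
  have "degree p \<le> (\<Sum>l\<in>{..<r} - {j}. degree [:- t l, 1:])"
    using degree_prod_sum_le[of "{..<r} - {j}" "\<lambda>l. [:- t l, 1:]"] by (simp add: p_def comp_def)
  also have "\<dots> < r" using assms(3) by simp
  finally have "(\<Sum>i<r. u i * poly p (t i)) = 0" by (rule vanish)
  moreover have "(\<Sum>i<r. u i * poly p (t i)) = (\<Sum>i\<in>{j}. u i * poly p (t i))"
    using assms(3) by (intro sum.mono_neutral_right) (auto simp: p_def poly_prod intro!: prod_zero)
  moreover have "poly p (t j) \<noteq> 0"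
    using assms(1,3) by (auto simp: p_def poly_prod inj_on_def)
  ultimately show ?thesis by simp
qed

text \<open>On the curve with coordinates \<open>t ^ p\<close>, \<open>t ^ q\<close> the monomial
  with exponents \<open>ex m\<close> becomes \<open>t ^ m\<close>. The points with
  \<open>t = 0, ..., r - 1\<close> therefore give a Vandermonde matrix, and the determinant is not
  identically zero.\<close>

lemma exists_independence_polynomial:
  assumes ex: "\<forall>m<r. p * fst (ex m) + q * snd (ex m) = m"
  shows "\<exists>h :: (nat, 'a::field_char_0) pexp. pvars h \<subseteq> {..<3 * r} \<and> (\<exists>e. pval e h \<noteq> 0) \<and>
    (\<forall>z. pval z h \<noteq> 0 \<longrightarrow> (\<forall>u. (\<forall>m<r. (\<Sum>j<r. u j * (z (3 * j + 1) ^ fst (ex m) * z (3 * j + 2) ^ snd (ex m))) = 0) \<longrightarrow>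
       (\<forall>j<r. u j = 0)))"
proof -
  define M :: "nat \<Rightarrow> nat \<Rightarrow> (nat, 'a) pexp" where
    "M m j = PMul (ppow (PV (3 * j + 1)) (fst (ex m))) (ppow (PV (3 * j + 2)) (snd (ex m)))" for m j
  have M: "pval z (M m j) = z (3 * j + 1) ^ fst (ex m) * z (3 * j + 2) ^ snd (ex m)" for z m j
    by (simp add: M_def pval_ppow)
  have "pvars (M m j) \<subseteq> {..<3 * r}" if "j < r" for m j
  proof -
    have "pvars (M m j) \<subseteq> {3 * j + 1} \<union> {3 * j + 2}"
      unfolding M_def pvars.simps by (rule Un_mono; rule order_trans[OF pvars_ppow]) simp_all
    also have "\<dots> \<subseteq> {..<3 * r}" using that by auto
    finally show ?thesis .
  qed
  then have vars: "pvars (pdet r M) \<subseteq> {..<3 * r}" by (intro pvars_pdet) auto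
  define z0 :: "nat \<Rightarrow> 'a" where "z0 j = (if j mod 3 = 1 then of_nat (j div 3) ^ p else of_nat (j div 3) ^ q)" for j
  have z0: "z0 (3 * j + 1) = of_nat j ^ p" "z0 (3 * j + 2) = of_nat j ^ q" for j
  proof -
    have "(3 * j + 1) div 3 = j" "(3 * j + 2) div 3 = j" by presburger+
    then show "z0 (3 * j + 1) = of_nat j ^ p" "z0 (3 * j + 2) = of_nat j ^ q"
      unfolding z0_def mod3_simps by simp_all
  qed
  have "pval z0 (pdet r M) \<noteq> 0"
    unfolding pval_pdet
  proof (rule solve_square_system(1))
    fix u :: "nat \<Rightarrow> 'a" assume u: "\<And>m. m < r \<Longrightarrow> (\<Sum>j<r. u j * pval z0 (M m j)) = 0"
    have mom: "(\<Sum>j<r. u j * of_nat j ^ m) = 0" if "m < r" for m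
    proof -
      have "pval z0 (M m j) = of_nat j ^ m" for j
        unfolding M z0 using ex that by (metis power_add power_mult)
      then show ?thesis using u[OF that] by simp
    qed
    show "\<forall>j<r. u j = 0"
      using moments_zero[of "of_nat :: nat \<Rightarrow> 'a" r u] mom by (auto simp: inj_on_def)
  qed
  moreover have "\<forall>j<r. u j = 0" if "pval z (pdet r M) \<noteq> 0"
    "\<forall>m<r. (\<Sum>j<r. u j * (z (3 * j + 1) ^ fst (ex m) * z (3 * j + 2) ^ snd (ex m))) = 0" for z u
    using inj_of_det_nonzero[of r "\<lambda>m j. pval z (M m j)" u] that unfolding pval_pdet M by blast
  ultimately show ?thesis using vars by blast
qed

text \<open>In the inverted coordinate, used for \<open>b = True\<close>, the homogeneous monomial
  of degree \<open>d\<close> with exponent \<open>a\<close> has exponent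
  \<open>d - a\<close>.\<close>

definition cpow :: "nat \<Rightarrow> bool \<Rightarrow> 'a::comm_ring_1 \<Rightarrow> nat \<Rightarrow> 'a" where
  "cpow d b x a = (if b then x ^ (d - a) else x ^ a)"

text \<open>The \<open>r\<close> points impose independent conditions on the polynomials with
  exponents in \<open>S\<close>; their coefficients do not enter.\<close>

definition pindep :: "nat \<Rightarrow> (nat \<times> nat) set \<Rightarrow> (nat \<Rightarrow> 'a::comm_ring_1) \<Rightarrow> bool" where
  "pindep r S z \<longleftrightarrow> (\<forall>u. (\<forall>s\<in>S. (\<Sum>j<r. u j * (z (3 * j + 1) ^ fst s * z (3 * j + 2) ^ snd s)) = 0) \<longrightarrow> (\<forall>j<r. u j = 0))"

lemma pindep_mono: "S \<subseteq> S' \<Longrightarrow> pindep r S z \<Longrightarrow> pindep r S' z"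
  unfolding pindep_def by blast

section \<open>Conditions satisfied by a general tensor\<close>

locale perfect_grid =
  fixes d1 d2 r :: nat
  assumes d1: "4 \<le> d1" and d2: "4 \<le> d2" and perfect: "(d1 + 1) * (d2 + 1) = 3 * r"
begin

definition grid :: "(nat \<times> nat) set" where
  "grid = {..d1} \<times> {..d2}"

lemma finite_grid [simp]: "finite grid" and card_grid: "card grid = 3 * r"
  using perfect by (simp_all add: grid_def)

text \<open>The first two bounds say that the bidegrees \<open>(d1 - 1, d2)\<close> and
  \<open>(d1, d2 - 1)\<close> still have enough monomials for \<open>r\<close> points to impose
  independent conditions.\<close>

lemma r_bounds: "r \<le> d1 * (d2 + 1)" "r \<le> (d1 + 1) * d2" "r > 0"
proof -
  have "(d1 + 1) * (d2 + 1) \<le> (3 * d1) * (d2 + 1)" using d1 by (intro mult_right_mono) auto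
  then have "3 * r \<le> 3 * (d1 * (d2 + 1))" unfolding perfect[symmetric] by (simp only: mult.assoc)
  then show "r \<le> d1 * (d2 + 1)" by simp
  have "(d1 + 1) * (d2 + 1) \<le> (d1 + 1) * (3 * d2)" using d2 by (intro mult_left_mono) auto
  then have "3 * r \<le> 3 * ((d1 + 1) * d2)" unfolding perfect[symmetric] by (simp only: mult.left_commute)
  then show "r \<le> (d1 + 1) * d2" by simp
  show "r > 0" using perfect by (cases r) auto
qed

text \<open>The charts of \<open>P\<^sup>1 \<times> P\<^sup>1\<close> in which the points are taken; on the chart \<open>True\<close> the coordinate
  is inverted, so that \<open>0\<close> is the point at infinity.\<close>

definition phi_chart :: "(nat \<Rightarrow> bool \<times> bool) \<Rightarrow> (nat \<Rightarrow> 'a::comm_ring_1) \<Rightarrow> nat \<times> nat \<Rightarrow> 'a" where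
  "phi_chart \<sigma> z s = (\<Sum>i<r. z (3 * i) * cpow d1 (fst (\<sigma> i)) (z (3 * i + 1)) (fst s) * cpow d2 (snd (\<sigma> i)) (z (3 * i + 2)) (snd s))"

definition fibre :: "(nat \<times> nat \<Rightarrow> 'a::comm_ring_1) \<Rightarrow> (nat \<Rightarrow> 'a) set" where
  "fibre t = {z. (\<forall>j. j \<notin> {..<3 * r} \<longrightarrow> z j = 0) \<and> (\<forall>s\<in>grid. t s = phi r z s)}"

text \<open>Since 0 is the point at infinity of an inverted chart, the single requirement of nonzero
  entries in every chart excludes points at infinity and vanishing coefficients together.\<close>

definition regular :: "(nat \<times> nat \<Rightarrow> 'a::comm_ring_1) \<Rightarrow> bool" where
  "regular t \<longleftrightarrow> (\<forall>\<sigma>\<in>{..<r} \<rightarrow>\<^sub>E UNIV. \<forall>z. (\<forall>s\<in>grid. t s = phi_chart \<sigma> z s) \<longrightarrow> (\<forall>j<3 * r. z j \<noteq> 0)) \<and>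
     (\<forall>z. (\<forall>s\<in>grid. t s = phi r z s) \<longrightarrow> pindep r ({..<d1} \<times> {..d2}) z \<and> pindep r ({..d1} \<times> {..<d2}) z)"

definition pphi_chart :: "(nat \<Rightarrow> bool \<times> bool) \<Rightarrow> nat \<times> nat \<Rightarrow> (nat, 'a::comm_ring_1) pexp" where
  "pphi_chart \<sigma> s = psum (\<lambda>i. PMul (PMul (PV (3 * i)) (ppow (PV (3 * i + 1)) (if fst (\<sigma> i) then d1 - fst s else fst s)))
     (ppow (PV (3 * i + 2)) (if snd (\<sigma> i) then d2 - snd s else snd s))) [0..<r]"

lemma pval_pphc: "pval z (pphi_chart \<sigma> s) = phi_chart \<sigma> z s"
  unfolding pphi_chart_def phi_chart_def pval_psum sum_list_upt by (intro sum.cong) (simp_all add: pval_ppow cpow_def)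

lemma pvars_pphc: "pvars (pphi_chart \<sigma> s) \<subseteq> {..<3 * r}"
  by (auto simp: pphi_chart_def pvars_psum pvars_pprod set_replicate_conv_if split: if_splits)

lemma generic_regular: "generic (regular :: (nat \<times> nat \<Rightarrow> 'a::field_char_0) \<Rightarrow> bool)"
proof -
  note image = hypersurface_image[of "{..<3 * r}" grid]
  have charts: "generic (\<lambda>t :: nat \<times> nat \<Rightarrow> 'a. \<forall>\<sigma>\<in>{..<r} \<rightarrow>\<^sub>E UNIV. \<forall>z. (\<forall>s\<in>grid. t s = phi_chart \<sigma> z s) \<longrightarrow> (\<forall>j<3 * r. z j \<noteq> 0))"
  proof (rule generic_ball)
    fix \<sigma> :: "nat \<Rightarrow> bool \<times> bool"
    \<comment> \<open>The hypersurface to be avoided is the union of all coordinate hyperplanes in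
      the parameter space of the chart.\<close>
    define h :: "(nat, 'a) pexp" where "h = pprod PV [0..<3 * r]"
    have h: "pval z h = (\<Prod>j<3 * r. z j)" for z by (simp add: h_def pval_pprod prod_list_upt)
    have "generic (\<lambda>t :: nat \<times> nat \<Rightarrow> 'a. \<forall>z. (\<forall>s\<in>grid. t s = pval z (pphi_chart \<sigma> s)) \<longrightarrow> pval z h \<noteq> 0)"
    proof (rule image)
      show "pval (\<lambda>_. 1) h \<noteq> 0" by (simp add: h)
      show "pvars h \<subseteq> {..<3 * r}" by (auto simp: h_def pvars_pprod)
    qed (simp_all add: card_grid pvars_pphc)
    then show "generic (\<lambda>t :: nat \<times> nat \<Rightarrow> 'a. \<forall>z. (\<forall>s\<in>grid. t s = phi_chart \<sigma> z s) \<longrightarrow> (\<forall>j<3 * r. z j \<noteq> 0))"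
      by (rule generic_mono) (auto simp: pval_pphc h)
  qed (intro finite_PiE, simp_all)
  have indep: "generic (\<lambda>t :: nat \<times> nat \<Rightarrow> 'a. \<forall>z. (\<forall>s\<in>grid. t s = phi r z s) \<longrightarrow> pindep r S z)"
    if ex: "\<forall>m<r. p * fst (ex m) + q * snd (ex m) = m" "\<forall>m<r. ex m \<in> S" for p q ex S
  proof -
    obtain h :: "(nat, 'a) pexp" where h1: "pvars h \<subseteq> {..<3 * r}" and ex_h: "\<exists>e. pval e h \<noteq> 0" and
      h3: "\<forall>z. pval z h \<noteq> 0 \<longrightarrow> (\<forall>u. (\<forall>m<r. (\<Sum>j<r. u j * (z (3 * j + 1) ^ fst (ex m) * z (3 * j + 2) ^ snd (ex m))) = 0) \<longrightarrow> (\<forall>j<r. u j = 0))"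
      using exists_independence_polynomial[of r p ex q, OF ex(1), where ?'a = 'a] by (elim exE[where P = "\<lambda>h. pvars h \<subseteq> _ \<and> _ h"] conjE)
    obtain e0 where e0: "pval e0 h \<noteq> 0" using ex_h ..
    have "generic (\<lambda>t :: nat \<times> nat \<Rightarrow> 'a. \<forall>z. (\<forall>s\<in>grid. t s = pval z (pphi r (\<lambda>j. j) s)) \<longrightarrow> pval z h \<noteq> 0)"
    proof (rule image)
      show "pvars (pphi r (\<lambda>j. j) s) \<subseteq> {..<3 * r}" for s :: "nat \<times> nat"
        using pvars_pphi[of r "\<lambda>j. j" s] by simp
      show "pval e0 h \<noteq> 0" by (rule e0)
    qed (simp_all add: card_grid h1)
    then show ?thesis
    proof (rule generic_mono, intro allI impI)
      fix t :: "nat \<times> nat \<Rightarrow> 'a" and z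
      assume "\<forall>z. (\<forall>s\<in>grid. t s = pval z (pphi r (\<lambda>j. j) s)) \<longrightarrow> pval z h \<noteq> 0" "\<forall>s\<in>grid. t s = phi r z s"
      then have "pval z h \<noteq> 0" by (simp add: comm_ring_hom.pev_pphi[OF comm_ring_hom_ident])
      then have *: "\<forall>u. (\<forall>m<r. (\<Sum>j<r. u j * (z (3 * j + 1) ^ fst (ex m) * z (3 * j + 2) ^ snd (ex m))) = 0) \<longrightarrow> (\<forall>j<r. u j = 0)"
        using h3 by simp
      show "pindep r S z" unfolding pindep_def
      proof (intro allI impI)
        fix u j assume u: "\<forall>s\<in>S. (\<Sum>j<r. u j * (z (3 * j + 1) ^ fst s * z (3 * j + 2) ^ snd s)) = 0" and j: "j < r"
        have "\<forall>m<r. (\<Sum>j<r. u j * (z (3 * j + 1) ^ fst (ex m) * z (3 * j + 2) ^ snd (ex m))) = 0"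
          using u ex(2) by simp
        then show "u j = 0" using * j by simp
      qed
    qed
  qed
  have i1: "generic (\<lambda>t :: nat \<times> nat \<Rightarrow> 'a. \<forall>z. (\<forall>s\<in>grid. t s = phi r z s) \<longrightarrow> pindep r ({..<d1} \<times> {..d2}) z)"
  proof (rule indep)
    \<comment> \<open>Division with remainder by \<open>d1\<close> numbers the monomials whose first
      exponent stays below \<open>d1\<close>; \<open>r_bounds\<close> keeps the second within
      \<open>d2\<close>.\<close>
    show "\<forall>m<r. 1 * fst (m mod d1, m div d1) + d1 * snd (m mod d1, m div d1) = m" by simp
    have "m div d1 < d2 + 1" if "m < r" for m
      using that r_bounds(1) by (intro less_mult_imp_div_less) (simp add: mult.commute)
    then show "\<forall>m<r. (m mod d1, m div d1) \<in> {..<d1} \<times> {..d2}" using d1 by (simp add: less_Suc_eq_le)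
  qed
  have i2: "generic (\<lambda>t :: nat \<times> nat \<Rightarrow> 'a. \<forall>z. (\<forall>s\<in>grid. t s = phi r z s) \<longrightarrow> pindep r ({..d1} \<times> {..<d2}) z)"
  proof (rule indep)
    show "\<forall>m<r. d2 * fst (m div d2, m mod d2) + 1 * snd (m div d2, m mod d2) = m" by simp
    have "m div d2 < d1 + 1" if "m < r" for m
      using that r_bounds(2) by (intro less_mult_imp_div_less) simp
    then show "\<forall>m<r. (m div d2, m mod d2) \<in> {..d1} \<times> {..<d2}" using d2 by (simp add: less_Suc_eq_le)
  qed
  show ?thesis
    using generic_conj[OF charts generic_conj[OF i1 i2]]
    by (rule generic_mono) (simp add: regular_def)
qed

lemma generic_bounded_fibre:
  "\<exists>B. generic (\<lambda>t :: nat \<times> nat \<Rightarrow> 'a::field_char_0. finite (fibre t) \<and> card (fibre t) \<le> B)"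
proof -
  have "\<exists>B. generic (\<lambda>t :: nat \<times> nat \<Rightarrow> 'a. finite {z. (\<forall>j. j \<notin> {..<3 * r} \<longrightarrow> z j = 0) \<and> (\<forall>s\<in>grid. t s = pval z (pphi r (\<lambda>j. j) s))} \<and>
    card {z. (\<forall>j. j \<notin> {..<3 * r} \<longrightarrow> z j = 0) \<and> (\<forall>s\<in>grid. t s = pval z (pphi r (\<lambda>j. j) s))} \<le> B)"
  proof (rule bounded_fibres)
    show "pvars (pphi r (\<lambda>j. j) s) \<subseteq> {..<3 * r}" for s :: "nat \<times> nat"
      using pvars_pphi[of r "\<lambda>j. j" s] by simp
  qed (simp_all add: card_grid)
  then show ?thesis by (simp add: comm_ring_hom.pev_pphi[OF comm_ring_hom_ident] fibre_def)
qed

text \<open>It is enough to compare in the order \<open>p < q\<close>: for regular tensors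
  \<open>new_point\<close> turns out to mean that the multisets of summands differ, which is
  symmetric.\<close>

definition many :: "nat \<Rightarrow> (nat \<times> nat \<Rightarrow> 'a::comm_ring_1) \<Rightarrow> bool" where
  "many m t \<longleftrightarrow> (\<exists>z. (\<forall>p<m. \<forall>s\<in>grid. phi r (z p) s = t s) \<and> (\<forall>q<m. \<forall>p<q. new_point r (z p) (z q)))"

text \<open>The matrix of the existential formula: \<open>Inl\<close> addresses the coordinates of
  the tensor and \<open>Inr (p, j)\<close> the entries of the p-th solution.\<close>

definition many_body :: "nat \<Rightarrow> (nat \<times> nat + nat \<times> nat \<Rightarrow> 'a::comm_ring_1) \<Rightarrow> bool" where
  "many_body m e \<longleftrightarrow> (\<forall>p\<in>{..<m}. \<forall>s\<in>grid. phi r (\<lambda>j. e (Inr (p, j))) s = e (Inl s)) \<and>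
     (\<forall>q\<in>{..<m}. \<forall>p\<in>{..<q}. \<exists>i\<in>{..<r}. \<forall>j\<in>{..<r}. \<exists>k\<in>{..<3}. e (Inr (q, 3 * i + k)) \<noteq> e (Inr (p, 3 * j + k)))"

lemma dfn_many_body:
  "F.dfn (many_body m :: (nat \<times> nat + nat \<times> nat \<Rightarrow> 'a::{alg_closed_field, field_char_0}) \<Rightarrow> bool) (many_body m)"
proof -
  have phi: "F.dfn (\<lambda>e :: nat \<times> nat + nat \<times> nat \<Rightarrow> 'a. phi r (\<lambda>j. e (Inr (p, j))) s = e (Inl s))
      (\<lambda>e. phi r (\<lambda>j. e (Inr (p, j))) s = e (Inl s))" for p s
    using F.dfn_eq[of "pphi r (\<lambda>j. Inr (p, j)) s" "PV (Inl s)"]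
    by (simp add: F.pev_pphi comm_ring_hom.pev_pphi[OF comm_ring_hom_ident])
  have 1: "F.dfn (\<lambda>e :: nat \<times> nat + nat \<times> nat \<Rightarrow> 'a. \<forall>p\<in>{..<m}. \<forall>s\<in>grid. phi r (\<lambda>j. e (Inr (p, j))) s = e (Inl s))
      (\<lambda>e. \<forall>p\<in>{..<m}. \<forall>s\<in>grid. phi r (\<lambda>j. e (Inr (p, j))) s = e (Inl s))"
    by (intro F.dfn_ball phi) simp_all
  have 2: "F.dfn (\<lambda>e :: nat \<times> nat + nat \<times> nat \<Rightarrow> 'a. \<forall>q\<in>{..<m}. \<forall>p\<in>{..<q}. \<exists>i\<in>{..<r}. \<forall>j\<in>{..<r}. \<exists>k\<in>{..<3}. e (Inr (q, 3 * i + k)) \<noteq> e (Inr (p, 3 * j + k)))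
      (\<lambda>e. \<forall>q\<in>{..<m}. \<forall>p\<in>{..<q}. \<exists>i\<in>{..<r}. \<forall>j\<in>{..<r}. \<exists>k\<in>{..<3}. e (Inr (q, 3 * i + k)) \<noteq> e (Inr (p, 3 * j + k)))"
    by (intro F.dfn_ball F.dfn_bex F.dfn_not F.dfn_var_eq) simp_all
  show ?thesis using F.dfn_and[OF 1 2] unfolding many_body_def[abs_def] .
qed

lemma many_iff:
  fixes e :: "nat \<times> nat + nat \<times> nat \<Rightarrow> 'a::comm_ring_1"
  shows "many m (\<lambda>s. e (Inl s)) \<longleftrightarrow> (\<exists>x. many_body m (override_on e x (Inr ` ({..<m} \<times> {..<3 * r}))))"
proof
  assume "many m (\<lambda>s. e (Inl s))"
  then obtain z where z: "\<forall>p<m. \<forall>s\<in>grid. phi r (z p) s = e (Inl s)" "\<forall>q<m. \<forall>p<q. new_point r (z p) (z q)"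
    unfolding many_def by blast
  define x where "x v = (case v of Inl _ \<Rightarrow> 0 | Inr (p, j) \<Rightarrow> z p j)" for v :: "nat \<times> nat + nat \<times> nat"
  let ?e = "override_on e x (Inr ` ({..<m} \<times> {..<3 * r}))"
  have e: "?e (Inl s) = e (Inl s)" for s by (auto simp: override_on_def)
  have e': "?e (Inr (p, j)) = z p j" if "p < m" "j < 3 * r" for p j
    using that by (auto simp: override_on_def x_def)
  have "phi r (\<lambda>j. ?e (Inr (p, j))) s = e (Inl s)" if "p < m" "s \<in> grid" for p s
    using z(1) that e' phi_cong[of r "\<lambda>j. ?e (Inr (p, j))" "z p" s] by simp
  moreover have "\<exists>i\<in>{..<r}. \<forall>j\<in>{..<r}. \<exists>k\<in>{..<3}. ?e (Inr (q, 3 * i + k)) \<noteq> ?e (Inr (p, 3 * j + k))" if q: "q < m" and p: "p < q" for p q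
  proof -
    obtain i where i: "i < r" "\<And>j. j < r \<Longrightarrow> \<exists>k<3. z q (3 * i + k) \<noteq> z p (3 * j + k)"
      using z(2) q p unfolding new_point_def by blast
    have "\<exists>k\<in>{..<3}. ?e (Inr (q, 3 * i + k)) \<noteq> ?e (Inr (p, 3 * j + k))" if j: "j \<in> {..<r}" for j
    proof -
      obtain k where k: "k < 3" "z q (3 * i + k) \<noteq> z p (3 * j + k)" using i(2) j by blast
      have "3 * i + k < 3 * r" "3 * j + k < 3 * r" using i(1) j k(1) by auto
      then have "?e (Inr (q, 3 * i + k)) \<noteq> ?e (Inr (p, 3 * j + k))" using k(2) q p by (simp add: e' x_def)
      then show ?thesis using k(1) by blast
    qed
    then show ?thesis using i(1) by blast
  qed
  ultimately show "\<exists>x. many_body m (override_on e x (Inr ` ({..<m} \<times> {..<3 * r})))"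
    unfolding many_body_def by (intro exI[of _ x]) (simp add: e)
next
  assume "\<exists>x. many_body m (override_on e x (Inr ` ({..<m} \<times> {..<3 * r})))"
  then obtain x where x: "many_body m (override_on e x (Inr ` ({..<m} \<times> {..<3 * r})))" ..
  define e' where "e' = override_on e x (Inr ` ({..<m} \<times> {..<3 * r}))"
  have e': "e' (Inl s) = e (Inl s)" for s by (auto simp: override_on_def e'_def)
  have body: "many_body m e'" using x by (simp only: e'_def)
  have "\<forall>p<m. \<forall>s\<in>grid. phi r (\<lambda>j. e' (Inr (p, j))) s = e (Inl s)"
    using body e' unfolding many_body_def by auto
  moreover have "\<forall>q<m. \<forall>p<q. new_point r (\<lambda>j. e' (Inr (p, j))) (\<lambda>j. e' (Inr (q, j)))"
    using body unfolding many_body_def new_point_def Ball_def Bex_def lessThan_iff by blast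
  ultimately show "many m (\<lambda>s. e (Inl s))"
    unfolding many_def by (intro exI[of _ "\<lambda>p j. e' (Inr (p, j))"] conjI)
qed

text \<open>Elimination of the solutions makes \<open>many m\<close> quantifier-free. The formula
  may still mention the variables under \<open>Inr\<close>, which \<open>generic_reindex\<close>
  removes.\<close>

lemma generic_many_or_not:
  "generic (many m :: (nat \<times> nat \<Rightarrow> 'a::{alg_closed_field, field_char_0}) \<Rightarrow> bool) \<or> generic (\<lambda>t :: nat \<times> nat \<Rightarrow> 'a. \<not> many m t)"
proof -
  let ?V = "Inr ` ({..<m} \<times> {..<3 * r}) :: (nat \<times> nat + nat \<times> nat) set"
  have "F.dfn (\<lambda>e. \<exists>x. many_body m (override_on e x ?V)) (\<lambda>e. \<exists>x. many_body m (override_on e x ?V))"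
    by (rule F.dfn_exs[OF _ dfn_many_body]) simp
  then obtain \<psi> where \<psi>: "\<And>e :: nat \<times> nat + nat \<times> nat \<Rightarrow> 'a. (\<exists>x. many_body m (override_on e x ?V)) \<longleftrightarrow> qsat (\<lambda>x. x) e \<psi>"
    unfolding F.dfn_def by blast
  have inj: "inj (Inl :: nat \<times> nat \<Rightarrow> nat \<times> nat + nat \<times> nat)" by simp
  have eq: "many m (\<lambda>s. e (Inl s)) \<longleftrightarrow> qsat (\<lambda>x. x) e \<psi>" for e :: "nat \<times> nat + nat \<times> nat \<Rightarrow> 'a"
    unfolding many_iff \<psi> ..
  from generic_dichotomy[of \<psi>] show ?thesis
  proof
    assume "generic (\<lambda>e. qsat (\<lambda>x. x) e \<psi>)"
    then show ?thesis using generic_reindex[OF _ inj, of "\<lambda>e. qsat (\<lambda>x. x) e \<psi>" "many m"] eq by blast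
  next
    assume "generic (\<lambda>e. \<not> qsat (\<lambda>x. x) e \<psi>)"
    then show ?thesis using generic_reindex[OF _ inj, of "\<lambda>e. \<not> qsat (\<lambda>x. x) e \<psi>" "\<lambda>t. \<not> many m t"] eq by blast
  qed
qed

text \<open>Both solutions provided by \<open>has_witness_grid\<close> are lifted along a line through a point where
  the given polynomial does not vanish.\<close>

lemma generic_many_2: "generic (many 2 :: (nat \<times> nat \<Rightarrow> 'a::{alg_closed_field, field_char_0}) \<Rightarrow> bool)"
proof (rule ccontr)
  assume "\<not> ?thesis"
  then have "generic (\<lambda>t :: nat \<times> nat \<Rightarrow> 'a. \<not> many 2 t)" using generic_many_or_not by blast
  then obtain Q and t1 :: "nat \<times> nat \<Rightarrow> 'a" where Q: "pval t1 Q \<noteq> 0" "\<And>t. pval t Q \<noteq> 0 \<Longrightarrow> \<not> many 2 t"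
    unfolding generic_def by blast
  have "3 dvd (d1 + 1) * (d2 + 1)" using perfect by simp
  from has_witness_grid[OF d1 d2 this, where ?'a = 'a]
  obtain r' and z z' :: "nat \<Rightarrow> 'a" where r': "card grid = 3 * r'" and "witness True r' grid z z'"
    unfolding has_witness_def grid_def by blast
  moreover have "r' = r" using r' card_grid by simp
  ultimately have w: "nondeg r grid z" "nondeg r grid z'" "\<And>s. s \<in> grid \<Longrightarrow> phi r z' s = phi r z s" "new_point r z z'"
    unfolding witness_def by auto
  obtain ss where ss: "distinct ss" "set ss = grid" using finite_distinct_list[OF finite_grid] by blast
  have len: "length ss = 3 * r" using distinct_card[OF ss(1)] card_grid ss(2) by simp
  define G :: "nat \<Rightarrow> (nat option, 'a) pexp" where
    "G i = PAdd (pphi r Some (ss ! i)) (PMul (PC (-1)) (PAdd (PC (phi r z (ss ! i))) (PMul (PV None) (PC (t1 (ss ! i) - phi r z (ss ! i))))))" for i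
  have lift: "\<exists>Y. (\<forall>j. fps_nth (Y j) 0 = y j) \<and> (\<forall>i<3 * r. pev fps_const (case_option fps_X Y) (G i) = 0)"
    if y: "nondeg r grid y" "\<And>s. s \<in> grid \<Longrightarrow> phi r y s = phi r z s" for y
  proof (rule hensel_lifting)
    show "pvars (G i) \<subseteq> insert None (Some ` {..<3 * r})" for i
      using pvars_pphi[of r Some "ss ! i"] unfolding G_def pvars.simps by blast
    show "pval (case_option 0 y) (G i) = 0" if "i < 3 * r" for i
    proof -
      have "ss ! i \<in> grid" using that len ss(2) nth_mem[of i ss] by simp
      then show ?thesis using y(2) by (simp add: G_def comm_ring_hom.pev_pphi[OF comm_ring_hom_ident])
    qed
    fix u :: "nat \<Rightarrow> 'a"
    assume u: "\<And>i. i < 3 * r \<Longrightarrow> pdev (\<lambda>x. x) (case_option 0 y) (case_option 0 u) (G i) = 0"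
    have "dphi r y u s = 0" if s: "s \<in> grid" for s
    proof -
      obtain i where i: "i < 3 * r" "ss ! i = s" using s ss(2) len in_set_conv_nth[of s ss] by auto
      then show ?thesis using u[OF i(1)] by (simp add: G_def comm_ring_hom.pdev_pphi[OF comm_ring_hom_ident])
    qed
    then show "\<forall>j<3 * r. u j = 0" using y(1) unfolding nondeg_def by blast
  qed
  obtain Y where Y: "\<And>j. fps_nth (Y j) 0 = z j" "\<And>i. i < 3 * r \<Longrightarrow> pev fps_const (case_option fps_X Y) (G i) = 0"
    using lift[OF w(1)] by auto
  obtain Y' where Y': "\<And>j. fps_nth (Y' j) 0 = z' j" "\<And>i. i < 3 * r \<Longrightarrow> pev fps_const (case_option fps_X Y') (G i) = 0"
    using lift[OF w(2,3)] by auto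
  \<comment> \<open>The line runs from the doubly covered value at parameter 0 to \<open>t1\<close>
    at parameter 1. As \<open>Q\<close> is nonzero at \<open>t1\<close>, it is a nonzero polynomial
    along the line, hence nonzero at the infinitesimal parameter.\<close>
  define T where "T s = fps_of_poly [:phi r z s, t1 s - phi r z s:]" for s
  have T: "T s = fps_const (phi r z s) + fps_X * fps_const (t1 s - phi r z s)" for s
    by (simp add: T_def fps_of_poly_pCons)
  have phiT: "phi r (\<lambda>j. emb (y j)) s = emb (T s)"
    if y: "\<And>i. i < 3 * r \<Longrightarrow> pev fps_const (case_option fps_X y) (G i) = 0" and s: "s \<in> grid" for y s
  proof -
    obtain i where i: "i < 3 * r" "ss ! i = s" using s ss(2) len in_set_conv_nth[of s ss] by auto
    have "pev fps_const (case_option fps_X y) (G i) = phi r y s - T s"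
      by (simp add: G_def i comm_ring_hom.pev_pphi[OF comm_ring_hom_fps_const] T)
    then have "phi r y s = T s" using y[OF i(1)] by simp
    then show ?thesis by (simp flip: comm_ring_hom.hom_phi[OF comm_ring_hom_emb])
  qed
  define e :: "nat \<times> nat + nat \<times> nat \<Rightarrow> 'a fls alg_closure" where
    "e v = (case v of Inl s \<Rightarrow> emb (T s) | Inr (p, j) \<Rightarrow> emb (if p = 0 then Y j else Y' j))" for v
  have "pev fps_const T Q = fps_of_poly (pev (\<lambda>c. [:c:]) (\<lambda>s. [:phi r z s, t1 s - phi r z s:]) Q)"
    by (induction Q) (auto simp: T_def fps_of_poly_add fps_of_poly_mult fps_of_poly_const)
  moreover have "poly (pev (\<lambda>c. [:c:]) (\<lambda>s. [:phi r z s, t1 s - phi r z s:]) Q) 1 \<noteq> 0"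
    unfolding poly_pev_line using Q(1) by simp
  ultimately have "pev fps_const T Q \<noteq> 0" by auto
  then have "pev cemb (\<lambda>s. emb (T s)) Q \<noteq> 0" by (simp flip: pev_emb)
  then have Qe: "pev cemb e (psubst (\<lambda>s. PV (Inl s)) Q) \<noteq> 0" by (simp add: pev_psubst e_def)
  have body: "many_body 2 e"
  proof -
    have "phi r (\<lambda>j. e (Inr (p, j))) s = e (Inl s)" if "s \<in> grid" for p s
      using phiT[OF Y(2) that] phiT[OF Y'(2) that] by (cases "p = 0") (simp_all add: e_def)
    moreover obtain i where i: "i < r" "\<And>j. j < r \<Longrightarrow> \<exists>k<3. z' (3 * i + k) \<noteq> z (3 * j + k)"
      using w(4) unfolding new_point_def by blast
    have "\<exists>k\<in>{..<3}. e (Inr (1, 3 * i + k)) \<noteq> e (Inr (0, 3 * j + k))" if j: "j < r" for j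
    proof -
      obtain k where k: "k < 3" "z' (3 * i + k) \<noteq> z (3 * j + k)" using i(2)[OF j] by blast
      then have "e (Inr (1, 3 * i + k)) \<noteq> e (Inr (0, 3 * j + k))"
        using Y(1)[of "3 * j + k"] Y'(1)[of "3 * i + k"] by (auto simp: e_def)
      then show ?thesis using k(1) by blast
    qed
    moreover have "q = 1 \<and> p = 0" if "q \<in> {..<2}" "p \<in> {..<q}" for p q :: nat using that by auto
    ultimately show ?thesis unfolding many_body_def using i(1) by blast
  qed
  have dfn: "F.dfn (\<lambda>e. \<not> pval e (psubst (\<lambda>s. PV (Inl s)) Q) = 0 \<and> many_body 2 e)
      (\<lambda>e. \<not> pev cemb e (psubst (\<lambda>s. PV (Inl s)) Q) = 0 \<and> many_body 2 e)"
    by (rule F.dfn_and[OF F.dfn_not[OF F.dfn_zero] dfn_many_body])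
  have "\<exists>e. \<not> pval e (psubst (\<lambda>s. PV (Inl s)) Q) = 0 \<and> many_body 2 e"
    using F.transfer_dfn[OF dfn, of e] Qe body by blast
  then obtain e' where e': "pval (\<lambda>s. e' (Inl s)) Q \<noteq> 0" "many_body 2 e'"
    by (auto simp: pev_psubst)
  have "override_on e' e' V = e'" for V by (auto simp: override_on_def)
  then have "many 2 (\<lambda>s. e' (Inl s))" unfolding many_iff using e'(2) by metis
  then show False using Q(2) e'(1) by blast
qed

end

section \<open>Partially symmetric tensors\<close>

context perfect_grid
begin

lemma many_le_card_fibre:
  assumes "many m t" "finite (fibre t)"
  shows "m \<le> card (fibre t)"
proof -
  obtain z where z: "\<forall>p<m. \<forall>s\<in>grid. phi r (z p) s = t s" "\<forall>q<m. \<forall>p<q. new_point r (z p) (z q)"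
    using assms(1) unfolding many_def by (elim exE conjE)
  define y where "y p j = (if j < 3 * r then z p j else 0)" for p j
  have "y ` {..<m} \<subseteq> fibre t"
  proof clarsimp
    fix p assume "p < m"
    have "phi r (y p) s = phi r (z p) s" for s by (rule phi_cong) (simp add: y_def)
    then show "y p \<in> fibre t" using z(1) \<open>p < m\<close> unfolding fibre_def by (simp add: y_def)
  qed
  moreover have "inj_on y {..<m}"
  proof (rule linorder_inj_onI)
    fix p q assume pq: "p < q" "p \<in> {..<m}" "q \<in> {..<m}"
    then have "new_point r (z p) (z q)" using z(2) by simp
    then obtain i where i: "i < r" "\<And>j. j < r \<Longrightarrow> \<exists>k<3. z q (3 * i + k) \<noteq> z p (3 * j + k)"
      unfolding new_point_def by blast
    obtain k where k: "k < 3" "z q (3 * i + k) \<noteq> z p (3 * i + k)" using i by blast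
    then have "y q (3 * i + k) \<noteq> y p (3 * i + k)" using i(1) by (simp add: y_def)
    then show "y p \<noteq> y q" by metis
  qed auto
  ultimately show ?thesis using card_inj_on_le[of y "{..<m}" "fibre t"] assms(2) by simp
qed

text \<open>By maximality of \<nu> the condition \<open>many (Suc \<nu>)\<close> is not generic, and
  the dichotomy turns this into generic failure.\<close>

lemma generic_count:
  "\<exists>\<nu>\<ge>2. generic (\<lambda>t :: nat \<times> nat \<Rightarrow> 'a::{alg_closed_field, field_char_0}.
     regular t \<and> finite (fibre t) \<and> many \<nu> t \<and> \<not> many (Suc \<nu>) t)"
proof -
  obtain B where B: "generic (\<lambda>t :: nat \<times> nat \<Rightarrow> 'a. finite (fibre t) \<and> card (fibre t) \<le> B)"
    using generic_bounded_fibre by blast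
  define P where "P = {m. generic (many m :: (nat \<times> nat \<Rightarrow> 'a) \<Rightarrow> bool)}"
  have le: "m \<le> B" if "m \<in> P" for m
  proof -
    have "generic (many m :: (nat \<times> nat \<Rightarrow> 'a) \<Rightarrow> bool)" using that by (simp add: P_def)
    from generic_ex[OF generic_conj[OF this B]] obtain t :: "nat \<times> nat \<Rightarrow> 'a"
      where "many m t" "finite (fibre t)" "card (fibre t) \<le> B" by (elim exE conjE)
    then show ?thesis using many_le_card_fibre[of m t] by simp
  qed
  have fin: "finite P" using le by (auto intro: finite_subset[of _ "{..B}"])
  have 2: "2 \<in> P" using generic_many_2 by (simp add: P_def)
  define \<nu> where "\<nu> = Max P"
  have "\<nu> \<in> P" unfolding \<nu>_def using fin 2 by (intro Max_in) auto
  have "Suc \<nu> \<notin> P"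
  proof
    assume "Suc \<nu> \<in> P"
    then have "Suc \<nu> \<le> \<nu>" unfolding \<nu>_def using fin by (rule Max_ge[rotated])
    then show False by simp
  qed
  then have "generic (\<lambda>t :: nat \<times> nat \<Rightarrow> 'a. \<not> many (Suc \<nu>) t)"
    using generic_many_or_not[of "Suc \<nu>", where ?'a = 'a] by (simp add: P_def)
  moreover have "generic (many \<nu> :: (nat \<times> nat \<Rightarrow> 'a) \<Rightarrow> bool)" using \<open>\<nu> \<in> P\<close> by (simp add: P_def)
  ultimately have "generic (\<lambda>t :: nat \<times> nat \<Rightarrow> 'a. regular t \<and> (finite (fibre t) \<and> card (fibre t) \<le> B) \<and> many \<nu> t \<and> \<not> many (Suc \<nu>) t)"
    by (intro generic_conj generic_regular B)
  then have "generic (\<lambda>t :: nat \<times> nat \<Rightarrow> 'a. regular t \<and> finite (fibre t) \<and> many \<nu> t \<and> \<not> many (Suc \<nu>) t)"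
    by (rule generic_mono) simp
  moreover have "\<nu> \<ge> 2" unfolding \<nu>_def using fin 2 by (rule Max_ge)
  ultimately show ?thesis by blast
qed

definition cnt1 :: "bool list \<Rightarrow> nat" where "cnt1 xs = card {i \<in> {..<d1}. xs ! i}"
definition cnt2 :: "bool list \<Rightarrow> nat" where "cnt2 xs = card {i \<in> {d1..<d1 + d2}. xs ! i}"

definition word :: "nat \<times> nat \<Rightarrow> bool list" where
  "word s = map (\<lambda>i. if i < d1 then i < fst s else i < d1 + snd s) [0..<d1 + d2]"

text \<open>A partially symmetric tensor depends only on the number of entries \<open>True\<close>
  in each of the two blocks, so a function on \<open>grid\<close> describes it.\<close>

definition tens :: "(nat \<times> nat \<Rightarrow> 'a::field) \<Rightarrow> 'a tensor" where
  "tens t xs = (if length xs = d1 + d2 then t (cnt1 xs, cnt2 xs) else 0)"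

lemma cnt_in_grid: "(cnt1 xs, cnt2 xs) \<in> grid"
proof -
  have "cnt1 xs \<le> card {..<d1}" "cnt2 xs \<le> card {d1..<d1 + d2}"
    unfolding cnt1_def cnt2_def by (intro card_mono; auto)+
  then show ?thesis by (simp add: grid_def)
qed

lemma length_word [simp]: "length (word s) = d1 + d2"
  by (simp add: word_def)

lemma nth_word: "i < d1 + d2 \<Longrightarrow> word s ! i = (if i < d1 then i < fst s else i < d1 + snd s)"
  by (simp add: word_def)

lemma tens_word: "s \<in> grid \<Longrightarrow> tens t (word s) = t s"
proof -
  assume s: "s \<in> grid"
  then have "{i \<in> {..<d1}. word s ! i} = {..<fst s}" "{i \<in> {d1..<d1 + d2}. word s ! i} = {d1..<d1 + snd s}"
    by (auto simp: nth_word grid_def)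
  then show ?thesis by (simp add: tens_def cnt1_def cnt2_def)
qed

lemma tens_eq_iff: "tens t = tens t' \<longleftrightarrow> (\<forall>s\<in>grid. t s = t' s)"
proof
  assume "tens t = tens t'"
  then show "\<forall>s\<in>grid. t s = t' s" using tens_word by metis
next
  assume "\<forall>s\<in>grid. t s = t' s"
  then show "tens t = tens t'" using cnt_in_grid by (auto simp: tens_def fun_eq_iff)
qed

lemma tens_0 [simp]: "tens (\<lambda>s. 0) = 0"
  by (simp add: tens_def fun_eq_iff)

lemma tens_eq_0_iff: "tens t = 0 \<longleftrightarrow> (\<forall>s\<in>grid. t s = 0)"
  using tens_eq_iff[of t "\<lambda>s. 0"] by simp

lemma tscale_tens: "tscale c (tens t) = tens (\<lambda>s. c * t s)"
  by (auto simp: tscale_def tens_def)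

lemma sum_tens: "(\<Sum>i\<in>I. tens (t i)) = tens (\<lambda>s. \<Sum>i\<in>I. t i s)"
  by (auto simp: fun_eq_iff tens_def sum_fun_app)

lemma card_permuted: "\<pi> permutes A \<Longrightarrow> card {i \<in> A. P (\<pi> i)} = card {i \<in> A. P i}"
proof -
  assume p: "\<pi> permutes A"
  have "\<pi> ` {i \<in> A. P (\<pi> i)} = {i \<in> A. P i}"
  proof
    show "\<pi> ` {i \<in> A. P (\<pi> i)} \<subseteq> {i \<in> A. P i}" using permutes_in_image[OF p] by auto
    show "{i \<in> A. P i} \<subseteq> \<pi> ` {i \<in> A. P (\<pi> i)}"
    proof
      fix i assume i: "i \<in> {i \<in> A. P i}"
      then have "i \<in> \<pi> ` A" using permutes_image[OF p] by simp
      then obtain j where "j \<in> A" "\<pi> j = i" by (auto simp only: image_iff)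
      then show "i \<in> \<pi> ` {i \<in> A. P (\<pi> i)}" using i by auto
    qed
  qed
  then show ?thesis using card_image[OF inj_on_subset[OF permutes_inj[OF p] subset_UNIV], of "{i \<in> A. P (\<pi> i)}"] by simp
qed

lemma cnt_permute_list:
  assumes "\<pi> permutes {..<d1} \<or> \<pi> permutes {d1..<d1 + d2}" "length xs = d1 + d2"
  shows "cnt1 (permute_list \<pi> xs) = cnt1 xs" "cnt2 (permute_list \<pi> xs) = cnt2 xs"
proof -
  have nth: "permute_list \<pi> xs ! i = xs ! \<pi> i" if "i < d1 + d2" for i
    using that assms(2) by (simp add: permute_list_def)
  have c1: "cnt1 (permute_list \<pi> xs) = card {i \<in> {..<d1}. xs ! \<pi> i}"
    and c2: "cnt2 (permute_list \<pi> xs) = card {i \<in> {d1..<d1 + d2}. xs ! \<pi> i}"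
    unfolding cnt1_def cnt2_def by (rule arg_cong[of _ _ card], auto simp: nth)+
  from assms(1) have "card {i \<in> {..<d1}. xs ! \<pi> i} = cnt1 xs \<and> card {i \<in> {d1..<d1 + d2}. xs ! \<pi> i} = cnt2 xs"
  proof
    assume p: "\<pi> permutes {..<d1}"
    then have "\<pi> i = i" if "i \<in> {d1..<d1 + d2}" for i using that permutes_not_in[OF p, of i] by simp
    then have "{i \<in> {d1..<d1 + d2}. xs ! \<pi> i} = {i \<in> {d1..<d1 + d2}. xs ! i}" by auto
    then show ?thesis using card_permuted[OF p, of "\<lambda>i. xs ! i"] unfolding cnt1_def cnt2_def by simp
  next
    assume p: "\<pi> permutes {d1..<d1 + d2}"
    then have "\<pi> i = i" if "i \<in> {..<d1}" for i using that permutes_not_in[OF p, of i] by simp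
    then have "{i \<in> {..<d1}. xs ! \<pi> i} = {i \<in> {..<d1}. xs ! i}" by auto
    then show ?thesis using card_permuted[OF p, of "\<lambda>i. xs ! i"] unfolding cnt1_def cnt2_def by simp
  qed
  then show "cnt1 (permute_list \<pi> xs) = cnt1 xs" "cnt2 (permute_list \<pi> xs) = cnt2 xs" using c1 c2 by auto
qed

lemma tens_in_part_sym: "tens t \<in> part_sym_tensors d1 d2"
  unfolding part_sym_tensors_def tensor_space_def
  by (auto simp: tens_def cnt_permute_list)

text \<open>Two bijections between sets of equal size, one for the indices satisfying
  \<open>P\<close> and one for the others, are glued. Used in each block, this brings an index word
  to the standard form \<open>word\<close>.\<close>

lemma exists_sorting_permutation:
  assumes "finite A" "Y \<subseteq> A" "card Y = card {i \<in> A. P i}"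
  shows "\<exists>\<pi>. \<pi> permutes A \<and> (\<forall>i\<in>A. P (\<pi> i) \<longleftrightarrow> i \<in> Y)"
proof -
  let ?Z = "{i \<in> A. P i}"
  have fin: "finite Y" "finite ?Z" using assms by (auto intro: finite_subset)
  obtain f where f: "bij_betw f Y ?Z" using finite_same_card_bij[OF fin assms(3)] by blast
  have "card (A - Y) = card (A - ?Z)" using assms fin by (simp add: card_Diff_subset)
  then obtain g where g: "bij_betw g (A - Y) (A - ?Z)"
    using finite_same_card_bij[of "A - Y" "A - ?Z"] assms(1) by blast
  define \<pi> where "\<pi> i = (if i \<in> Y then f i else if i \<in> A then g i else i)" for i
  have "bij_betw \<pi> Y ?Z" using f by (rule bij_betw_cong[THEN iffD1, rotated]) (simp add: \<pi>_def)
  moreover have "bij_betw \<pi> (A - Y) (A - ?Z)" using g by (rule bij_betw_cong[THEN iffD1, rotated]) (simp add: \<pi>_def)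
  ultimately have "bij_betw \<pi> (Y \<union> (A - Y)) (?Z \<union> (A - ?Z))" by (rule bij_betw_combine) auto
  moreover have "Y \<union> (A - Y) = A" "?Z \<union> (A - ?Z) = A" using assms(2) by auto
  ultimately have "bij_betw \<pi> A A" by simp
  then have "\<pi> permutes A" by (rule bij_imp_permutes) (use assms(2) in \<open>auto simp: \<pi>_def\<close>)
  moreover have "P (\<pi> i) \<longleftrightarrow> i \<in> Y" if i: "i \<in> A" for i
  proof (cases "i \<in> Y")
    case True
    then have "f i \<in> ?Z" using bij_betwE[OF f] by blast
    then show ?thesis using True by (simp add: \<pi>_def)
  next
    case False
    then have "g i \<in> A - ?Z" using bij_betwE[OF g] i by blast
    then show ?thesis using False i by (simp add: \<pi>_def)
  qed
  ultimately show ?thesis by blast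
qed

lemma part_sym_tensor_eq_tens:
  assumes "T \<in> part_sym_tensors d1 d2"
  shows "T = tens (\<lambda>s. T (word s))"
proof
  fix xs
  have sym: "T (permute_list \<pi> xs) = T xs"
    if "\<pi> permutes {..<d1} \<or> \<pi> permutes {d1..<d1 + d2}" "length xs = d1 + d2" for \<pi> xs
    using assms that unfolding part_sym_tensors_def by blast
  show "T xs = tens (\<lambda>s. T (word s)) xs"
  proof (cases "length xs = d1 + d2")
    case False
    then show ?thesis using assms by (simp add: tens_def part_sym_tensors_def tensor_space_def)
  next
    case True
    have g: "cnt1 xs \<le> d1" "cnt2 xs \<le> d2" using cnt_in_grid[of xs] by (auto simp: grid_def)
    have "\<exists>\<pi>. \<pi> permutes {..<d1} \<and> (\<forall>i\<in>{..<d1}. xs ! \<pi> i \<longleftrightarrow> i \<in> {..<cnt1 xs})"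
      by (rule exists_sorting_permutation) (use g in \<open>auto simp: cnt1_def\<close>)
    then obtain \<pi> where p: "\<pi> permutes {..<d1}" "\<And>i. i < d1 \<Longrightarrow> xs ! \<pi> i \<longleftrightarrow> i < cnt1 xs" by auto
    have "\<exists>\<pi>. \<pi> permutes {d1..<d1 + d2} \<and> (\<forall>i\<in>{d1..<d1 + d2}. xs ! \<pi> i \<longleftrightarrow> i \<in> {d1..<d1 + cnt2 xs})"
      by (rule exists_sorting_permutation) (use g in \<open>auto simp: cnt2_def\<close>)
    then obtain \<rho> where q: "\<rho> permutes {d1..<d1 + d2}"
      "\<And>i. d1 \<le> i \<Longrightarrow> i < d1 + d2 \<Longrightarrow> xs ! \<rho> i \<longleftrightarrow> i < d1 + cnt2 xs" by auto
    define ys where "ys = permute_list \<pi> xs"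
    have len: "length ys = d1 + d2" by (simp add: ys_def True)
    have "permute_list \<rho> ys = word (cnt1 xs, cnt2 xs)"
    proof (rule nth_equalityI)
      fix i assume "i < length (permute_list \<rho> ys)"
      then have i: "i < d1 + d2" by (simp add: len)
      show "permute_list \<rho> ys ! i = word (cnt1 xs, cnt2 xs) ! i"
      proof (cases "i < d1")
        case True1: True
        then have "\<rho> i = i" using permutes_not_in[OF q(1), of i] by simp
        then show ?thesis using i True1 p(2)[OF True1] len True
          by (simp add: permute_list_def ys_def nth_word)
      next
        case False
        then have "\<rho> i \<in> {d1..<d1 + d2}" using permutes_in_image[OF q(1), of i] i by simp
        then have "\<pi> (\<rho> i) = \<rho> i" "\<rho> i < d1 + d2" using permutes_not_in[OF p(1), of "\<rho> i"] by auto
        then show ?thesis using i False q(2)[of i] len True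
          by (simp add: permute_list_def ys_def nth_word)
      qed
    qed (simp add: len)
    moreover have "T (permute_list \<rho> ys) = T xs"
      using sym[of \<rho> ys] sym[of \<pi> xs] p(1) q(1) len True by (simp add: ys_def)
    ultimately show ?thesis using True by (simp add: tens_def)
  qed
qed

lemma prod_of_bool_function:
  "finite A \<Longrightarrow> (\<Prod>i\<in>A. f (p i)) = f True ^ card {i \<in> A. p i} * f False ^ (card A - card {i \<in> A. p i})"
  for f :: "bool \<Rightarrow> 'a::comm_monoid_mult"
proof (induction A rule: finite_induct)
  case (insert x A)
  have le: "card {i \<in> A. p i} \<le> card A" using insert(1) by (intro card_mono) auto
  show ?case
  proof (cases "p x")
    case True
    then have "{i \<in> insert x A. p i} = insert x {i \<in> A. p i}" by auto
    then show ?thesis using insert True by (simp add: mult_ac)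
  next
    case False
    then have "{i \<in> insert x A. p i} = {i \<in> A. p i}" by auto
    then show ?thesis using insert False le by (simp add: Suc_diff_le mult_ac)
  qed
qed simp

lemma tensor_product_eq_tens:
  "tensor_product (replicate d1 v @ replicate d2 w) =
     tens (\<lambda>s. v True ^ fst s * v False ^ (d1 - fst s) * (w True ^ snd s * w False ^ (d2 - snd s)))"
proof
  fix xs
  show "tensor_product (replicate d1 v @ replicate d2 w) xs =
     tens (\<lambda>s. v True ^ fst s * v False ^ (d1 - fst s) * (w True ^ snd s * w False ^ (d2 - snd s))) xs"
  proof (cases "length xs = d1 + d2")
    case True
    define F where "F i = ((replicate d1 v @ replicate d2 w) ! i) (xs ! i)" for i
    have "{..<d1 + d2} = {..<d1} \<union> {d1..<d1 + d2}" by auto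
    then have "(\<Prod>i<d1 + d2. F i) = (\<Prod>i\<in>{..<d1} \<union> {d1..<d1 + d2}. F i)" by (simp only:)
    also have "\<dots> = (\<Prod>i<d1. F i) * (\<Prod>i\<in>{d1..<d1 + d2}. F i)" by (rule prod.union_disjoint) auto
    also have "(\<Prod>i<d1. F i) = (\<Prod>i<d1. v (xs ! i))" by (rule prod.cong) (simp_all add: F_def nth_append)
    also have "(\<Prod>i\<in>{d1..<d1 + d2}. F i) = (\<Prod>i\<in>{d1..<d1 + d2}. w (xs ! i))"
      by (rule prod.cong) (auto simp: F_def nth_append)
    finally have "(\<Prod>i<d1 + d2. ((replicate d1 v @ replicate d2 w) ! i) (xs ! i)) =
        (\<Prod>i<d1. v (xs ! i)) * (\<Prod>i\<in>{d1..<d1 + d2}. w (xs ! i))" by (simp only: F_def)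
    then show ?thesis using True
      by (simp add: tensor_product_def tens_def prod_of_bool_function cnt1_def cnt2_def)
  next
    case False
    then show ?thesis by (simp add: tensor_product_def tens_def)
  qed
qed

section \<open>Points of the surface in affine charts\<close>

definition chart_tensor :: "bool \<times> bool \<Rightarrow> 'a::field \<Rightarrow> 'a \<Rightarrow> 'a \<Rightarrow> 'a tensor" where
  "chart_tensor b c x y = tens (\<lambda>s. c * cpow d1 (fst b) x (fst s) * cpow d2 (snd b) y (snd s))"

lemma tscale_chart_tensor: "tscale a (chart_tensor b c x y) = chart_tensor b (a * c) x y"
  by (simp add: chart_tensor_def tscale_tens mult.assoc)

lemma line_tscale: "c \<noteq> 0 \<Longrightarrow> line (tscale c T) = line T"
  unfolding line_def
proof (rule antisym)
  assume c: "c \<noteq> 0"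
  show "tensor.span {tscale c T} \<subseteq> tensor.span {T}"
    by (rule tensor.span_minimal) (auto intro: tensor.span_scale tensor.span_base)
  have "tscale (inverse c) (tscale c T) \<in> tensor.span {tscale c T}"
    by (intro tensor.span_scale tensor.span_base) simp
  then have "T \<in> tensor.span {tscale c T}" using c by simp
  then show "tensor.span {T} \<subseteq> tensor.span {tscale c T}"
    by (intro tensor.span_minimal) auto
qed

text \<open>The inverted chart is used for the point at infinity only, with coordinate 0. This is
  the normalisation that allows \<open>regular\<close> to rule the chart out.\<close>

lemma homogeneous_coordinates:
  fixes v :: "bool \<Rightarrow> 'a::field"
  assumes "v \<noteq> 0"
  shows "\<exists>b \<kappa> x. \<kappa> \<noteq> 0 \<and> (b \<longrightarrow> x = 0) \<and> (\<forall>a\<le>d. v True ^ a * v False ^ (d - a) = \<kappa> * cpow d b x a)"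
proof (cases "v False = 0")
  case False
  have "v True ^ a * v False ^ (d - a) = v False ^ d * cpow d False (v True / v False) a" if "a \<le> d" for a
    using False that by (simp add: cpow_def power_divide power_diff)
  then show ?thesis using False by (intro exI[of _ False] exI[of _ "v False ^ d"] exI[of _ "v True / v False"]) simp
next
  case True
  have "v True \<noteq> 0"
  proof
    assume "v True = 0"
    then have "v b = 0" for b using True by (cases b) auto
    then show False using assms by (auto simp: fun_eq_iff)
  qed
  moreover have "v True ^ a * v False ^ (d - a) = v True ^ d * cpow d True 0 a" if "a \<le> d" for a
    using True that by (cases "a = d") (auto simp: cpow_def)
  ultimately show ?thesis by (intro exI[of _ True] exI[of _ "v True ^ d"] exI[of _ 0]) simp
qed

lemma segre_veronese_chart:
  fixes \<alpha> :: "'a::field tensor set"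
  assumes "\<alpha> \<in> segre_veronese d1 d2"
  shows "\<exists>b x y. \<alpha> = line (chart_tensor b 1 x y) \<and> (fst b \<longrightarrow> x = 0) \<and> (snd b \<longrightarrow> y = 0)"
proof -
  obtain v w :: "bool \<Rightarrow> 'a" where vw: "\<alpha> = line (tensor_product (replicate d1 v @ replicate d2 w))" "v \<noteq> 0" "w \<noteq> 0"
    using assms unfolding segre_veronese_def by blast
  obtain b1 \<kappa>1 x where 1: "\<kappa>1 \<noteq> 0" "b1 \<longrightarrow> x = 0" "\<forall>a\<le>d1. v True ^ a * v False ^ (d1 - a) = \<kappa>1 * cpow d1 b1 x a"
    using homogeneous_coordinates[OF vw(2), of d1] by (elim exE conjE)
  obtain b2 \<kappa>2 y where 2: "\<kappa>2 \<noteq> 0" "b2 \<longrightarrow> y = 0" "\<forall>a\<le>d2. w True ^ a * w False ^ (d2 - a) = \<kappa>2 * cpow d2 b2 y a"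
    using homogeneous_coordinates[OF vw(3), of d2] by (elim exE conjE)
  have "tensor_product (replicate d1 v @ replicate d2 w) = tscale (\<kappa>1 * \<kappa>2) (chart_tensor (b1, b2) 1 x y)"
    unfolding tensor_product_eq_tens tscale_chart_tensor unfolding chart_tensor_def tens_eq_iff
  proof
    fix s assume "s \<in> grid"
    then have "fst s \<le> d1" "snd s \<le> d2" by (auto simp: grid_def)
    then have "v True ^ fst s * v False ^ (d1 - fst s) = \<kappa>1 * cpow d1 b1 x (fst s)"
      "w True ^ snd s * w False ^ (d2 - snd s) = \<kappa>2 * cpow d2 b2 y (snd s)" using 1(3) 2(3) by blast+
    then show "v True ^ fst s * v False ^ (d1 - fst s) * (w True ^ snd s * w False ^ (d2 - snd s)) =
        \<kappa>1 * \<kappa>2 * 1 * cpow d1 (fst (b1, b2)) x (fst s) * cpow d2 (snd (b1, b2)) y (snd s)"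
      by (simp only: fst_conv snd_conv mult_1_right) (simp only: mult_ac)
  qed
  then have "\<alpha> = line (chart_tensor (b1, b2) 1 x y)" using vw(1) 1(1) 2(1) by (simp add: line_tscale)
  then show ?thesis using 1(2) 2(2) by (intro exI[of _ "(b1, b2)"] exI[of _ x] exI[of _ y]) simp
qed

lemma in_line_iff: "T \<in> line T' \<longleftrightarrow> (\<exists>c. T = tscale c T')"
  unfolding line_def tensor.span_singleton by auto

lemma decomposable_chart:
  fixes T :: "'a::field tensor"
  assumes "T \<in> decomposable_tensors d1 d2"
  shows "\<exists>b c x y. T = chart_tensor b c x y \<and> (fst b \<longrightarrow> x = 0) \<and> (snd b \<longrightarrow> y = 0)"
proof -
  obtain b x y where b: "line T = line (chart_tensor b 1 x y)" "fst b \<longrightarrow> x = 0" "snd b \<longrightarrow> y = 0"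
    using assms segre_veronese_chart unfolding decomposable_tensors_def by blast
  have "T \<in> line T" unfolding line_def by (rule tensor.span_base) simp
  then obtain c where "T = tscale c (chart_tensor b 1 x y)" using b(1) in_line_iff by blast
  then have "T = chart_tensor b c x y" by (simp add: tscale_chart_tensor)
  then show ?thesis using b(2,3) by blast
qed

lemma chart_tensor_decomposable:
  fixes c x y :: "'a::field"
  assumes "c \<noteq> 0"
  shows "chart_tensor (False, False) c x y \<in> decomposable_tensors d1 d2" "line (chart_tensor (False, False) c x y) \<in> segre_veronese d1 d2"
proof -
  define v where "v = (\<lambda>b. if b then x else 1)"
  define w where "w = (\<lambda>b. if b then y else 1)"
  have nz: "v \<noteq> 0" "w \<noteq> 0" by (auto simp: v_def w_def fun_eq_iff)
  have "chart_tensor (False, False) c x y = tscale c (tensor_product (replicate d1 v @ replicate d2 w))"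
    unfolding tensor_product_eq_tens tscale_tens unfolding chart_tensor_def tens_eq_iff
    by (simp add: v_def w_def cpow_def mult.assoc)
  then have "line (chart_tensor (False, False) c x y) = line (tensor_product (replicate d1 v @ replicate d2 w))"
    using assms by (simp add: line_tscale)
  then show sv: "line (chart_tensor (False, False) c x y) \<in> segre_veronese d1 d2"
    unfolding segre_veronese_def using nz by blast
  have "(0, 0) \<in> grid" by (simp add: grid_def)
  then have "chart_tensor (False, False) c x y \<noteq> 0" using assms unfolding chart_tensor_def tens_eq_0_iff by (force simp: cpow_def)
  then show "chart_tensor (False, False) c x y \<in> decomposable_tensors d1 d2"
    using sv unfolding decomposable_tensors_def by blast
qed

end

context perfect_grid
begin

section \<open>Decompositions and secant spaces\<close>

lemma pindepD:
  assumes "pindep r S z" "\<And>s. s \<in> S \<Longrightarrow> (\<Sum>j<r. u j * (z (3 * j + 1) ^ fst s * z (3 * j + 2) ^ snd s)) = 0" "j < r"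
  shows "u j = 0"
proof -
  have "(\<forall>s\<in>S. (\<Sum>j<r. u j * (z (3 * j + 1) ^ fst s * z (3 * j + 2) ^ snd s)) = 0) \<longrightarrow> (\<forall>j<r. u j = 0)"
    using assms(1) unfolding pindep_def by (rule spec)
  then show ?thesis using assms(2,3) by simp
qed

definition summand :: "(nat \<Rightarrow> 'a::field) \<Rightarrow> nat \<Rightarrow> 'a tensor" where
  "summand z i = chart_tensor (False, False) (z (3 * i)) (z (3 * i + 1)) (z (3 * i + 2))"

definition summands :: "(nat \<Rightarrow> 'a::field) \<Rightarrow> 'a tensor multiset" where
  "summands z = image_mset (summand z) (mset_set {..<r})"

definition solution :: "(nat \<times> nat \<Rightarrow> 'a::field) \<Rightarrow> (nat \<Rightarrow> 'a) \<Rightarrow> bool" where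
  "solution t z \<longleftrightarrow> (\<forall>s\<in>grid. t s = phi r z s)"

lemma summand_eq_tens: "summand z i = tens (\<lambda>s. z (3 * i) * z (3 * i + 1) ^ fst s * z (3 * i + 2) ^ snd s)"
  by (simp add: summand_def chart_tensor_def cpow_def)

lemma sum_summand: "(\<Sum>i<r. summand z i) = tens (phi r z)"
  unfolding summand_eq_tens sum_tens phi_def ..

lemma sum_tscale_summand: "(\<Sum>i<r. tscale (u i) (summand z i)) =
    tens (\<lambda>s. \<Sum>i<r. (u i * z (3 * i)) * (z (3 * i + 1) ^ fst s * z (3 * i + 2) ^ snd s))"
  unfolding summand_eq_tens tscale_tens sum_tens by (simp add: mult.assoc)

lemma set_summands [simp]: "set_mset (summands z) = summand z ` {..<r}" and size_summands [simp]: "size (summands z) = r"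
  by (simp_all add: summands_def)

lemma sum_summands: "\<Sum>\<^sub># (summands z) = tens (phi r z)"
  using sum_summand[of z] by (simp add: summands_def sum_unfold_sum_mset)

lemma solution_fibre:
  assumes "solution t z"
  shows "\<exists>y\<in>fibre t. summands y = summands z \<and> solution t y"
proof -
  define y where "y j = (if j < 3 * r then z j else 0)" for j
  have phi: "phi r y s = phi r z s" for s by (rule phi_cong) (simp add: y_def)
  have "y \<in> fibre t" using assms phi by (simp add: fibre_def solution_def y_def)
  moreover have "summand y i = summand z i" if "i < r" for i using that by (simp add: summand_def y_def)
  then have "summands y = summands z" unfolding summands_def by (intro image_mset_cong) simp
  moreover have "solution t y" using assms phi by (simp add: solution_def)
  ultimately show ?thesis by blast
qed

context
  fixes t :: "nat \<times> nat \<Rightarrow> 'a::{alg_closed_field, field_char_0}"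
  assumes reg: "regular t"
begin

text \<open>A summand at infinity would have a zero coordinate in its inverted chart, against
  regularity. All charts are therefore the affine ones, and the chart expression is a solution with
  nonzero coefficients.\<close>

lemma chart_solution:
  assumes eq: "tens t = (\<Sum>i<r. chart_tensor (\<sigma> i) (c i) (x i) (y i))"
    and inf: "\<forall>i<r. (fst (\<sigma> i) \<longrightarrow> x i = 0) \<and> (snd (\<sigma> i) \<longrightarrow> y i = 0)"
  shows "\<exists>z. solution t z \<and> (\<forall>i<r. c i \<noteq> 0 \<and> summand z i = chart_tensor (\<sigma> i) (c i) (x i) (y i))"
proof -
  define z where "z j = (if j mod 3 = 0 then c (j div 3) else if j mod 3 = 1 then x (j div 3) else y (j div 3))" for j
  have z: "z (3 * i) = c i" "z (3 * i + 1) = x i" "z (3 * i + 2) = y i" for i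
  proof -
    have "(3 * i) div 3 = i" "(3 * i + 1) div 3 = i" "(3 * i + 2) div 3 = i" by presburger+
    then show "z (3 * i) = c i" "z (3 * i + 1) = x i" "z (3 * i + 2) = y i"
      unfolding z_def mod3_simps by simp_all
  qed
  define \<sigma>' where "\<sigma>' = restrict \<sigma> {..<r}"
  have "tens t = tens (phi_chart \<sigma>' z)"
    unfolding eq chart_tensor_def sum_tens tens_eq_iff phi_chart_def z by (simp add: \<sigma>'_def)
  then have "\<forall>s\<in>grid. t s = phi_chart \<sigma>' z s" by (simp only: tens_eq_iff)
  moreover have "\<sigma>' \<in> {..<r} \<rightarrow>\<^sub>E UNIV" by (simp add: \<sigma>'_def)
  ultimately have nz: "\<forall>j<3 * r. z j \<noteq> 0" using reg unfolding regular_def by blast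
  have nzi: "c i \<noteq> 0" "x i \<noteq> 0" "y i \<noteq> 0" if "i < r" for i
    using nz[rule_format, of "3 * i"] nz[rule_format, of "3 * i + 1"] nz[rule_format, of "3 * i + 2"] that
    unfolding z by auto
  have \<sigma>: "\<sigma> i = (False, False)" if "i < r" for i
    using inf that nzi[OF that] by (cases "\<sigma> i") auto
  have summand: "summand z i = chart_tensor (\<sigma> i) (c i) (x i) (y i)" if "i < r" for i
    unfolding summand_def z \<sigma>[OF that] ..
  then have "tens t = (\<Sum>i<r. summand z i)" unfolding eq by simp
  then have "solution t z" unfolding sum_summand tens_eq_iff solution_def .
  then show ?thesis using nzi summand by blast
qed

lemma solution_nonzero: "solution t z \<Longrightarrow> j < 3 * r \<Longrightarrow> z j \<noteq> 0"
proof -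
  assume z: "solution t z" and j: "j < 3 * r"
  define \<sigma> where "\<sigma> = restrict (\<lambda>_. (False, False)) {..<r}"
  have "phi_chart \<sigma> z s = phi r z s" for s unfolding phi_chart_def phi_def \<sigma>_def by (simp add: cpow_def)
  moreover have "\<sigma> \<in> {..<r} \<rightarrow>\<^sub>E UNIV" by (simp add: \<sigma>_def)
  ultimately show ?thesis using reg z j unfolding regular_def solution_def by simp
qed

lemma solution_pindep:
  assumes "solution t z"
  shows "pindep r ({..<d1} \<times> {..d2}) z" "pindep r ({..d1} \<times> {..<d2}) z" "pindep r grid z"
proof -
  show 1: "pindep r ({..<d1} \<times> {..d2}) z" and "pindep r ({..d1} \<times> {..<d2}) z"
    using reg assms unfolding regular_def solution_def by blast+
  show "pindep r grid z" using 1 by (rule pindep_mono[rotated]) (auto simp: grid_def)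
qed

lemma summand_independent:
  assumes z: "solution t z" and zero: "(\<Sum>i<r. tscale (u i) (summand z i)) = 0" and i: "i < r"
  shows "u i = 0"
proof -
  have "\<forall>s\<in>grid. (\<Sum>i<r. (u i * z (3 * i)) * (z (3 * i + 1) ^ fst s * z (3 * i + 2) ^ snd s)) = 0"
    using zero unfolding sum_tscale_summand tens_eq_0_iff .
  then have "u i * z (3 * i) = 0"
    using pindepD[OF solution_pindep(3)[OF z], of "\<lambda>i. u i * z (3 * i)"] i by simp
  then show ?thesis using solution_nonzero[OF z, of "3 * i"] i by simp
qed

lemma summand_line_inj:
  assumes z: "solution t z" and ij: "i < r" "j < r" and eq: "summand z i = tscale c (summand z j)"
  shows "i = j"
proof (rule ccontr)
  assume "i \<noteq> j"
  define u where "u l = (if l = i then 1 else if l = j then - c else 0)" for l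
  have "(\<Sum>l<r. tscale (u l) (summand z l)) = (\<Sum>l\<in>{i, j}. tscale (u l) (summand z l))"
    using ij by (intro sum.mono_neutral_right) (auto simp: u_def)
  also have "\<dots> = 0" using \<open>i \<noteq> j\<close> eq by (simp add: u_def)
  finally have "u i = 0" using summand_independent[OF z _ ij(1)] by blast
  then show False by (simp add: u_def)
qed

lemma points_distinct:
  assumes z: "solution t z" and ij: "i < r" "j < r"
    and eq: "z (3 * i + 1) = z (3 * j + 1)" "z (3 * i + 2) = z (3 * j + 2)"
  shows "i = j"
proof (rule summand_line_inj[OF z ij])
  show "summand z i = tscale (z (3 * i) / z (3 * j)) (summand z j)"
    using solution_nonzero[OF z, of "3 * j"] ij eq by (simp add: summand_def tscale_chart_tensor)
qed

lemma chart_tensor_inj: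
  fixes c c' x x' y y' :: 'a
  assumes "c \<noteq> 0" "chart_tensor (False, False) c x y = chart_tensor (False, False) c' x' y'"
  shows "c = c' \<and> x = x' \<and> y = y'"
proof -
  have eq: "c * x ^ a * y ^ b = c' * x' ^ a * y' ^ b" if "a \<le> d1" "b \<le> d2" for a b
    using assms(2)[unfolded chart_tensor_def tens_eq_iff, rule_format, of "(a, b)"] that by (simp add: cpow_def grid_def)
  show ?thesis using eq[of 0 0] eq[of 1 0] eq[of 0 1] d1 d2 assms(1) by simp
qed

text \<open>As the points of a solution are distinct, those of \<open>z'\<close> are a permutation
  of those of \<open>z\<close>; independence of the evaluations on \<open>grid\<close> then forces
  equal coefficients.\<close>

lemma matching_points:
  assumes z: "solution t z" "solution t z'"
    and match: "\<And>i. i < r \<Longrightarrow> f i < r \<and> z' (3 * i + 1) = z (3 * f i + 1) \<and> z' (3 * i + 2) = z (3 * f i + 2)"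
  shows "summands z' = summands z \<and> (\<forall>i<r. z' (3 * i) = z (3 * f i))"
proof -
  have inj: "inj_on f {..<r}"
  proof (rule inj_onI)
    fix i j assume ij: "i \<in> {..<r}" "j \<in> {..<r}" "f i = f j"
    show "i = j" by (rule points_distinct[OF z(2)]) (use ij match[of i] match[of j] in auto)
  qed
  have sub: "f ` {..<r} \<subseteq> {..<r}" using match by auto
  have surj: "f ` {..<r} = {..<r}" by (rule endo_inj_surj[OF _ sub inj]) simp
  define g where "g = inv_into {..<r} f"
  have g: "f (g j) = j" "g j < r" if "j < r" for j
    using that surj unfolding g_def by (metis f_inv_into_f lessThan_iff, metis inv_into_into lessThan_iff)
  have gf: "g (f i) = i" if "i < r" for i using that inj unfolding g_def by simp
  have "z (3 * j) - z' (3 * g j) = 0" if j: "j < r" for j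
  proof -
    have "(\<Sum>j<r. (z (3 * j) - z' (3 * g j)) * (z (3 * j + 1) ^ fst s * z (3 * j + 2) ^ snd s)) = 0" if s: "s \<in> grid" for s
    proof -
      have "phi r z' s = (\<Sum>i<r. z' (3 * g (f i)) * (z (3 * f i + 1) ^ fst s * z (3 * f i + 2) ^ snd s))"
        unfolding phi_def using match gf by (intro sum.cong) (simp_all add: mult.assoc)
      also have "\<dots> = (\<Sum>j\<in>f ` {..<r}. z' (3 * g j) * (z (3 * j + 1) ^ fst s * z (3 * j + 2) ^ snd s))"
        using inj by (simp add: sum.reindex)
      finally have "phi r z' s = (\<Sum>j<r. z' (3 * g j) * (z (3 * j + 1) ^ fst s * z (3 * j + 2) ^ snd s))"
        unfolding surj .
      moreover have "phi r z' s = phi r z s" using z s by (simp add: solution_def)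
      ultimately show ?thesis by (simp add: phi_def left_diff_distrib sum_subtractf mult.assoc)
    qed
    then show ?thesis using pindepD[OF solution_pindep(3)[OF z(1)], of "\<lambda>j. z (3 * j) - z' (3 * g j)"] j by simp
  qed
  then have coef: "z' (3 * i) = z (3 * f i)" if "i < r" for i
    using that match[OF that] gf[OF that] by (metis eq_iff_diff_eq_0)
  have "summand z' i = summand z (f i)" if "i < r" for i
    using match[OF that] coef[OF that] by (simp add: summand_def)
  then have "summands z' = image_mset (summand z) (image_mset f (mset_set {..<r}))"
    unfolding summands_def image_mset.compositionality by (intro image_mset_cong) simp
  also have "\<dots> = summands z" unfolding summands_def image_mset_mset_set[OF inj] surj ..
  finally show ?thesis using coef by blast
qed

lemma summands_eq_iff:
  assumes z: "solution t z" "solution t z'"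
  shows "summands z' = summands z \<longleftrightarrow> \<not> new_point r z z'"
proof
  assume eq: "summands z' = summands z"
  show "\<not> new_point r z z'"
  proof
    assume "new_point r z z'"
    then obtain i where i: "i < r" "\<And>j. j < r \<Longrightarrow> \<exists>k<3. z' (3 * i + k) \<noteq> z (3 * j + k)"
      unfolding new_point_def by blast
    have "summand z' i \<in> summand z ` {..<r}" using arg_cong[OF eq, of set_mset] i(1) by auto
    then obtain j where j: "j < r" "summand z' i = summand z j" by auto
    have "z' (3 * i) \<noteq> 0" using solution_nonzero[OF z(2)] i(1) by simp
    from chart_tensor_inj[OF this j(2)[unfolded summand_def]]
    have *: "z' (3 * i) = z (3 * j)" "z' (3 * i + 1) = z (3 * j + 1)" "z' (3 * i + 2) = z (3 * j + 2)" by auto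
    obtain k where k: "k < 3" "z' (3 * i + k) \<noteq> z (3 * j + k)" using i(2)[OF j(1)] by blast
    then consider "k = 0" | "k = 1" | "k = 2" by linarith
    then show False using k(2) * by cases simp_all
  qed
next
  assume "\<not> new_point r z z'"
  then have "\<forall>i\<in>{..<r}. \<exists>j. j < r \<and> (\<forall>k<3. z' (3 * i + k) = z (3 * j + k))"
    unfolding new_point_def by blast
  from bchoice[OF this] obtain f where f: "\<And>i. i < r \<Longrightarrow> f i < r \<and> (\<forall>k<3. z' (3 * i + k) = z (3 * f i + k))"
    by auto
  have "f i < r \<and> z' (3 * i + 1) = z (3 * f i + 1) \<and> z' (3 * i + 2) = z (3 * f i + 2)" if "i < r" for i
  proof -
    have "f i < r" and k: "\<forall>k<3. z' (3 * i + k) = z (3 * f i + k)" using f[OF that] by auto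
    then show ?thesis using k[rule_format, of 1] k[rule_format, of 2] by simp
  qed
  from matching_points[OF z this] show "summands z' = summands z" by blast
qed

lemma decompositions_eq: "decompositions d1 d2 r (tens t) = summands ` {z. solution t z}"
proof
  show "summands ` {z. solution t z} \<subseteq> decompositions d1 d2 r (tens t)"
  proof clarsimp
    fix z assume z: "solution t z"
    have "summand z i \<in> decomposable_tensors d1 d2" if "i < r" for i
      unfolding summand_def using solution_nonzero[OF z, of "3 * i"] that by (intro chart_tensor_decomposable) simp
    moreover have "tens (phi r z) = tens t" using z by (simp add: tens_eq_iff solution_def)
    ultimately show "summands z \<in> decompositions d1 d2 r (tens t)"
      unfolding decompositions_def by (auto simp: sum_summands)
  qed
  show "decompositions d1 d2 r (tens t) \<subseteq> summands ` {z. solution t z}"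
  proof
    fix M assume "M \<in> decompositions d1 d2 r (tens t)"
    then have M: "size M = r" "set_mset M \<subseteq> decomposable_tensors d1 d2" "\<Sum>\<^sub># M = tens t"
      unfolding decompositions_def by auto
    obtain Ts where Ts: "mset Ts = M" using ex_mset by blast
    have len: "length Ts = r" using M(1) Ts by (metis size_mset)
    have "\<forall>i\<in>{..<r}. \<exists>q. Ts ! i = chart_tensor (fst q) (fst (snd q)) (fst (snd (snd q))) (snd (snd (snd q))) \<and>
      (fst (fst q) \<longrightarrow> fst (snd (snd q)) = 0) \<and> (snd (fst q) \<longrightarrow> snd (snd (snd q)) = 0)"
    proof
      fix i assume "i \<in> {..<r}"
      then have "Ts ! i \<in># M" using Ts len by auto
      then have "Ts ! i \<in> decomposable_tensors d1 d2" using M(2) by blast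
      from decomposable_chart[OF this] obtain b c x y
        where "Ts ! i = chart_tensor b c x y" "fst b \<longrightarrow> x = 0" "snd b \<longrightarrow> y = 0" by (elim exE conjE)
      then show "\<exists>q. Ts ! i = chart_tensor (fst q) (fst (snd q)) (fst (snd (snd q))) (snd (snd (snd q))) \<and>
        (fst (fst q) \<longrightarrow> fst (snd (snd q)) = 0) \<and> (snd (fst q) \<longrightarrow> snd (snd (snd q)) = 0)"
        by (intro exI[of _ "(b, c, x, y)"]) simp
    qed
    from bchoice[OF this] obtain q where q: "\<And>i. i < r \<Longrightarrow> Ts ! i = chart_tensor (fst (q i)) (fst (snd (q i))) (fst (snd (snd (q i)))) (snd (snd (snd (q i))))"
      "\<forall>i<r. (fst (fst (q i)) \<longrightarrow> fst (snd (snd (q i))) = 0) \<and> (snd (fst (q i)) \<longrightarrow> snd (snd (snd (q i))) = 0)"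
      by auto
    have "tens t = (\<Sum>i<r. Ts ! i)"
      unfolding M(3)[symmetric] Ts[symmetric] sum_mset_sum_list sum_list_sum_nth len atLeast0LessThan ..
    also have "\<dots> = (\<Sum>i<r. chart_tensor (fst (q i)) (fst (snd (q i))) (fst (snd (snd (q i)))) (snd (snd (snd (q i)))))"
      using q(1) by simp
    finally have eq: "tens t = (\<Sum>i<r. chart_tensor (fst (q i)) (fst (snd (q i))) (fst (snd (snd (q i)))) (snd (snd (snd (q i)))))" .
    obtain z where z: "solution t z"
      and summand: "\<forall>i<r. fst (snd (q i)) \<noteq> 0 \<and> summand z i = chart_tensor (fst (q i)) (fst (snd (q i))) (fst (snd (snd (q i)))) (snd (snd (snd (q i))))"
      using chart_solution[OF eq q(2)] by (elim exE conjE)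
    have summand': "summand z i = Ts ! i" if "i < r" for i using summand q(1)[OF that] that by simp
    have "summands z = image_mset (\<lambda>i. Ts ! i) (mset_set {..<r})"
      unfolding summands_def using summand' by (intro image_mset_cong) simp
    also have "\<dots> = mset (map (\<lambda>i. Ts ! i) [0..<length Ts])"
      by (simp add: len atLeast0LessThan mset_map mset_upt)
    also have "\<dots> = M" unfolding map_nth Ts ..
    finally show "M \<in> summands ` {z. solution t z}" using z by blast
  qed
qed

lemma decompositions_eq_fibre: "decompositions d1 d2 r (tens t) = summands ` fibre t"
proof -
  have "fibre t \<subseteq> {z. solution t z}" by (auto simp: fibre_def solution_def)
  moreover have "summands z \<in> summands ` fibre t" if z: "solution t z" for z
  proof -
    obtain y where "y \<in> fibre t" "summands y = summands z" using solution_fibre[OF z] by blast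
    then show ?thesis by (intro image_eqI[of _ _ y]) simp_all
  qed
  ultimately show ?thesis unfolding decompositions_eq by (intro antisym image_mono image_subsetI) auto
qed

lemma card_decompositions:
  assumes fin: "finite (fibre t)" and many: "many \<nu> t" "\<not> many (Suc \<nu>) t"
  shows "card (decompositions d1 d2 r (tens t)) = \<nu>"
proof (rule antisym)
  have finD: "finite (decompositions d1 d2 r (tens t))" using fin by (simp add: decompositions_eq_fibre)
  obtain z where z: "\<forall>p<\<nu>. \<forall>s\<in>grid. phi r (z p) s = t s" "\<forall>q<\<nu>. \<forall>p<q. new_point r (z p) (z q)"
    using many(1) unfolding many_def by (elim exE conjE)
  have sol: "solution t (z p)" if "p < \<nu>" for p using z(1) that by (simp add: solution_def)
  have "inj_on (\<lambda>p. summands (z p)) {..<\<nu>}"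
  proof (rule linorder_inj_onI)
    fix p q assume "p < q" "p \<in> {..<\<nu>}" "q \<in> {..<\<nu>}"
    then show "summands (z p) \<noteq> summands (z q)" using summands_eq_iff[of "z p" "z q"] sol z(2) by auto
  qed auto
  moreover have "(\<lambda>p. summands (z p)) ` {..<\<nu>} \<subseteq> decompositions d1 d2 r (tens t)"
    using sol by (auto simp: decompositions_eq)
  ultimately show "\<nu> \<le> card (decompositions d1 d2 r (tens t))"
    using card_inj_on_le[OF _ _ finD] by fastforce
  show "card (decompositions d1 d2 r (tens t)) \<le> \<nu>"
  proof (rule ccontr)
    assume "\<not> ?thesis"
    then have "Suc \<nu> \<le> card (decompositions d1 d2 r (tens t))" by simp
    then obtain D where D: "D \<subseteq> decompositions d1 d2 r (tens t)" "card D = Suc \<nu>" "finite D"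
      by (rule obtain_subset_with_card_n)
    obtain h where h: "bij_betw h {..<Suc \<nu>} D"
      using finite_same_card_bij[of "{..<Suc \<nu>}" D] D(2,3) by auto
    have "\<forall>p\<in>{..<Suc \<nu>}. \<exists>y. solution t y \<and> summands y = h p"
      using bij_betwE[OF h] D(1) unfolding decompositions_eq by fastforce
    from bchoice[OF this] obtain y where y: "\<And>p. p < Suc \<nu> \<Longrightarrow> solution t (y p) \<and> summands (y p) = h p" by auto
    have "new_point r (y p) (y q)" if "q < Suc \<nu>" "p < q" for p q
    proof -
      have "h p \<noteq> h q" using bij_betw_imp_inj_on[OF h] that by (auto simp: inj_on_def)
      then show ?thesis using summands_eq_iff[of "y p" "y q"] y[of p] y[of q] that by auto
    qed
    moreover have "\<forall>p<Suc \<nu>. \<forall>s\<in>grid. phi r (y p) s = t s" using y by (simp add: solution_def)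
    ultimately have "many (Suc \<nu>) t" unfolding many_def by (intro exI[of _ y]) blast
    then show False using many(2) by contradiction
  qed
qed

section \<open>Secant spaces of a regular tensor\<close>

lemma span_lines: "tensor.span (\<Union> (line ` A)) = tensor.span (A :: 'a tensor set)"
proof (rule antisym)
  have "line x \<subseteq> tensor.span A" if "x \<in> A" for x
    unfolding line_def using that by (intro tensor.span_mono) simp
  then show "tensor.span (\<Union> (line ` A)) \<subseteq> tensor.span A"
    by (intro tensor.span_minimal) auto
  have "x \<in> line x" for x :: "'a tensor" unfolding line_def by (rule tensor.span_base) simp
  then show "tensor.span A \<subseteq> tensor.span (\<Union> (line ` A))"
    by (intro tensor.span_mono) auto
qed

lemma in_span_image:
  fixes g :: "nat \<Rightarrow> 'a tensor"
  assumes "T \<in> tensor.span (g ` {..<n})"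
  shows "\<exists>u. T = (\<Sum>i<n. tscale (u i) (g i))"
  using assms
proof (induction rule: tensor.span_induct_alt)
  case base
  show ?case by (rule exI[of _ "\<lambda>_. 0"]) simp
next
  case (step c S T)
  obtain i u where i: "i < n" "S = g i" and u: "T = (\<Sum>i<n. tscale (u i) (g i))" using step by blast
  define u' where "u' j = u j + (if j = i then c else 0)" for j
  have "(\<Sum>j<n. tscale (u' j) (g j)) = (\<Sum>j<n. tscale (u j) (g j)) + (\<Sum>j<n. tscale (if j = i then c else 0) (g j))"
    by (simp add: u'_def tensor.scale_left_distrib sum.distrib)
  also have "(\<Sum>j<n. tscale (if j = i then c else 0) (g j)) = (\<Sum>j\<in>{i}. tscale (if j = i then c else 0) (g j))"
    using i(1) by (intro sum.mono_neutral_right) auto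
  also have "\<dots> = tscale c (g i)" by simp
  finally have "(\<Sum>j<n. tscale (u' j) (g j)) = T + tscale c S" by (simp only: u i(2))
  then have "tscale c S + T = (\<Sum>j<n. tscale (u' j) (g j))" by (simp only: add.commute)
  then show ?case by blast
qed

lemma summand_image:
  assumes z: "solution t z"
  shows "inj_on (summand z) {..<r}" "tensor.independent (summand z ` {..<r})" "inj_on (\<lambda>i. line (summand z i)) {..<r}"
proof -
  have line: "i = j" if l: "i < r" "j < r" "line (summand z i) = line (summand z j)" for i j
  proof -
    have "summand z i \<in> line (summand z i)" unfolding line_def by (rule tensor.span_base) simp
    then have "\<exists>c. summand z i = tscale c (summand z j)" unfolding l(3) in_line_iff .
    then show ?thesis using summand_line_inj[OF z l(1,2)] by blast
  qed
  then show "inj_on (\<lambda>i. line (summand z i)) {..<r}" by (auto intro: inj_onI)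
  show inj: "inj_on (summand z) {..<r}"
  proof (rule inj_onI)
    fix i j assume "i \<in> {..<r}" "j \<in> {..<r}" "summand z i = summand z j"
    then show "i = j" using line[of i j] by simp
  qed
  show "tensor.independent (summand z ` {..<r})"
  proof (rule ccontr)
    assume "\<not> tensor.independent (summand z ` {..<r})"
    then obtain u where u: "\<exists>v\<in>summand z ` {..<r}. u v \<noteq> 0" "(\<Sum>v\<in>summand z ` {..<r}. tscale (u v) v) = 0"
      using tensor.dependent_finite[of "summand z ` {..<r}"] by auto
    have "(\<Sum>i<r. tscale (u (summand z i)) (summand z i)) = 0" using u(2) inj by (simp add: sum.reindex)
    then have "u (summand z i) = 0" if "i < r" for i
      using summand_independent[OF z, of "\<lambda>i. u (summand z i)" i] that by blast
    then show False using u(1) by auto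
  qed
qed

text \<open>The span of the points of a solution meets the Segre-Veronese surface only in these points:
  multiplying forms of bidegree one less in a variable by a linear form vanishing at a further
  point of intersection would contradict \<open>solution_pindep\<close>.\<close>

lemma point_in_span:
  assumes z: "solution t z" "solution t z'" and i: "i < r" and span: "summand z' i \<in> tensor.span (summand z ` {..<r})"
  shows "\<exists>j<r. z' (3 * i + 1) = z (3 * j + 1) \<and> z' (3 * i + 2) = z (3 * j + 2)"
proof -
  define c x y where "c = z' (3 * i)" and "x = z' (3 * i + 1)" and "y = z' (3 * i + 2)"
  obtain u where u: "summand z' i = (\<Sum>j<r. tscale (u j) (summand z j))" using in_span_image[OF span] by blast
  define \<beta> where "\<beta> j = u j * z (3 * j)" for j
  have summand: "summand z' i = tens (\<lambda>s. \<Sum>j<r. (u j * z (3 * j)) * (z (3 * j + 1) ^ fst s * z (3 * j + 2) ^ snd s))"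
    using u unfolding sum_tscale_summand .
  have eq: "c * x ^ a * y ^ b = (\<Sum>j<r. \<beta> j * (z (3 * j + 1) ^ a * z (3 * j + 2) ^ b))" if ab: "(a, b) \<in> grid" for a b
    using bspec[OF summand[unfolded summand_eq_tens tens_eq_iff] ab] by (simp add: c_def x_def y_def \<beta>_def mult.assoc)
  \<comment> \<open>The moments of these weights are differences of moments of
    \<open>\<beta>\<close> with first exponents \<open>Suc a\<close> and \<open>a\<close>, and
    cancel by \<open>eq\<close>. The shift needs \<open>Suc a \<le> d1\<close>, hence independence
    in bidegree \<open>(d1 - 1, d2)\<close>.\<close>
  have bx: "\<beta> j * (z (3 * j + 1) - x) = 0" if "j < r" for j
  proof (rule pindepD[OF solution_pindep(1)[OF z(1)] _ that])
    fix s assume s: "s \<in> {..<d1} \<times> {..d2}"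
    obtain a b where ab: "s = (a, b)" by (cases s)
    have "(\<Sum>j<r. \<beta> j * (z (3 * j + 1) - x) * (z (3 * j + 1) ^ a * z (3 * j + 2) ^ b)) =
      (\<Sum>j<r. \<beta> j * (z (3 * j + 1) ^ Suc a * z (3 * j + 2) ^ b)) - x * (\<Sum>j<r. \<beta> j * (z (3 * j + 1) ^ a * z (3 * j + 2) ^ b))"
      by (simp add: sum_distrib_left sum_subtractf[symmetric] algebra_simps)
    also have "\<dots> = c * x ^ Suc a * y ^ b - x * (c * x ^ a * y ^ b)"
      using s ab by (subst (1 2) eq) (auto simp: grid_def)
    finally show "(\<Sum>j<r. \<beta> j * (z (3 * j + 1) - x) * (z (3 * j + 1) ^ fst s * z (3 * j + 2) ^ snd s)) = 0"
      by (simp add: ab)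
  qed
  have by': "\<beta> j * (z (3 * j + 2) - y) = 0" if "j < r" for j
  proof (rule pindepD[OF solution_pindep(2)[OF z(1)] _ that])
    fix s assume s: "s \<in> {..d1} \<times> {..<d2}"
    obtain a b where ab: "s = (a, b)" by (cases s)
    have "(\<Sum>j<r. \<beta> j * (z (3 * j + 2) - y) * (z (3 * j + 1) ^ a * z (3 * j + 2) ^ b)) =
      (\<Sum>j<r. \<beta> j * (z (3 * j + 1) ^ a * z (3 * j + 2) ^ Suc b)) - y * (\<Sum>j<r. \<beta> j * (z (3 * j + 1) ^ a * z (3 * j + 2) ^ b))"
      by (simp add: sum_distrib_left sum_subtractf[symmetric] algebra_simps)
    also have "\<dots> = c * x ^ a * y ^ Suc b - y * (c * x ^ a * y ^ b)"
      using s ab by (subst (1 2) eq) (auto simp: grid_def)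
    finally show "(\<Sum>j<r. \<beta> j * (z (3 * j + 2) - y) * (z (3 * j + 1) ^ fst s * z (3 * j + 2) ^ snd s)) = 0"
      by (simp add: ab)
  qed
  have "c \<noteq> 0" using solution_nonzero[OF z(2)] i by (simp add: c_def)
  \<comment> \<open>The moment with exponents \<open>(0, 0)\<close> is \<open>c\<close>, so some
    weight is nonzero, and its point must agree in both coordinates.\<close>
  then have "(\<Sum>j<r. \<beta> j) \<noteq> 0" using eq[of 0 0] by (simp add: grid_def)
  then obtain j where "j < r" "\<beta> j \<noteq> 0" by (metis (no_types, lifting) lessThan_iff sum.neutral)
  then show ?thesis using bx[of j] by'[of j] by (intro exI[of _ j]) (simp add: x_def y_def)
qed

lemma inj_on_span_decompositions:
  "inj_on (\<lambda>M. tensor.span (set_mset M)) (decompositions d1 d2 r (tens t))"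
  unfolding decompositions_eq
proof (rule inj_onI, clarsimp)
  fix z z' assume z: "solution t z" "solution t z'" and span: "tensor.span (summand z ` {..<r}) = tensor.span (summand z' ` {..<r})"
  have "\<forall>i\<in>{..<r}. \<exists>j. j < r \<and> z' (3 * i + 1) = z (3 * j + 1) \<and> z' (3 * i + 2) = z (3 * j + 2)"
  proof
    fix i assume i: "i \<in> {..<r}"
    then have "summand z' i \<in> tensor.span (summand z ` {..<r})" unfolding span by (intro tensor.span_base) auto
    then show "\<exists>j. j < r \<and> z' (3 * i + 1) = z (3 * j + 1) \<and> z' (3 * i + 2) = z (3 * j + 2)"
      using point_in_span[OF z, of i] i by blast
  qed
  from bchoice[OF this] obtain f
    where f: "\<forall>i\<in>{..<r}. f i < r \<and> z' (3 * i + 1) = z (3 * f i + 1) \<and> z' (3 * i + 2) = z (3 * f i + 2)" ..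
  have "f i < r \<and> z' (3 * i + 1) = z (3 * f i + 1) \<and> z' (3 * i + 2) = z (3 * f i + 2)" if "i < r" for i
    using f that by simp
  from matching_points[OF z this] show "summands z = summands z'" by simp
qed

text \<open>In terms of the points spanning a secant space, all coefficients of the tensor are
  nonzero by regularity. Each spanning point is therefore a summand up to scale, and the space is
  the span of a decomposition.\<close>

lemma secant_spaces_eq:
  assumes k: "r = k + 1"
  shows "secant_spaces_through d1 d2 k (line (tens t)) =
    (\<lambda>M. tensor.span (set_mset M)) ` decompositions d1 d2 r (tens t)"
proof
  show "(\<lambda>M. tensor.span (set_mset M)) ` decompositions d1 d2 r (tens t) \<subseteq> secant_spaces_through d1 d2 k (line (tens t))"
    unfolding decompositions_eq
  proof clarsimp
    fix z assume z: "solution t z"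
    let ?A = "line ` summand z ` {..<r}"
    have "?A \<subseteq> segre_veronese d1 d2"
      using solution_nonzero[OF z] by (auto simp: summand_def intro!: chart_tensor_decomposable(2))
    moreover have "card ?A = k + 1"
      using card_image[OF summand_image(3)[OF z]] k by (simp add: image_image)
    moreover have "tensor.span (summand z ` {..<r}) = tensor.span (\<Union> ?A)" by (simp only: span_lines)
    moreover have "tensor.dim (tensor.span (summand z ` {..<r})) = k + 1"
      using tensor.dim_span_eq_card_independent[OF summand_image(2)[OF z]] card_image[OF summand_image(1)[OF z]] k by simp
    moreover have "line (tens t) \<subseteq> tensor.span (summand z ` {..<r})"
    proof -
      have "tens t = tens (phi r z)" using z by (simp add: tens_eq_iff solution_def)
      then have "tens t = (\<Sum>i<r. summand z i)" by (simp add: sum_summand)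
      also have "\<dots> \<in> tensor.span (summand z ` {..<r})"
        by (intro tensor.span_sum tensor.span_base) auto
      finally show ?thesis unfolding line_def by (intro tensor.span_minimal) auto
    qed
    ultimately show "tensor.span (summand z ` {..<r}) \<in> secant_spaces_through d1 d2 k (line (tens t))"
      unfolding secant_spaces_through_def by blast
  qed
  show "secant_spaces_through d1 d2 k (line (tens t)) \<subseteq> (\<lambda>M. tensor.span (set_mset M)) ` decompositions d1 d2 r (tens t)"
  proof
    fix L assume "L \<in> secant_spaces_through d1 d2 k (line (tens t))"
    then obtain A where A: "A \<subseteq> segre_veronese d1 d2" "card A = k + 1" "L = tensor.span (\<Union>A)" "line (tens t) \<subseteq> L"
      unfolding secant_spaces_through_def by blast
    have "finite A" using A(2) by (metis Suc_eq_plus1 card.infinite nat.distinct(1))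
    then obtain \<alpha> where \<alpha>: "bij_betw \<alpha> {..<r} A"
      using finite_same_card_bij[of "{..<r}" A] A(2) k by auto
    have "\<forall>i\<in>{..<r}. \<exists>q. \<alpha> i = line (chart_tensor (fst q) 1 (fst (snd q)) (snd (snd q))) \<and>
      (fst (fst q) \<longrightarrow> fst (snd q) = 0) \<and> (snd (fst q) \<longrightarrow> snd (snd q) = 0)"
    proof
      fix i assume "i \<in> {..<r}"
      then have "\<alpha> i \<in> segre_veronese d1 d2" using bij_betwE[OF \<alpha>] A(1) by blast
      from segre_veronese_chart[OF this] obtain b x y
        where "\<alpha> i = line (chart_tensor b 1 x y)" "fst b \<longrightarrow> x = 0" "snd b \<longrightarrow> y = 0" by (elim exE conjE)
      then show "\<exists>q. \<alpha> i = line (chart_tensor (fst q) 1 (fst (snd q)) (snd (snd q))) \<and>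
        (fst (fst q) \<longrightarrow> fst (snd q) = 0) \<and> (snd (fst q) \<longrightarrow> snd (snd q) = 0)"
        by (intro exI[of _ "(b, x, y)"]) simp
    qed
    from bchoice[OF this] obtain q where q: "\<forall>i\<in>{..<r}. \<alpha> i = line (chart_tensor (fst (q i)) 1 (fst (snd (q i))) (snd (snd (q i)))) \<and>
      (fst (fst (q i)) \<longrightarrow> fst (snd (q i)) = 0) \<and> (snd (fst (q i)) \<longrightarrow> snd (snd (q i)) = 0)" ..
    define g where "g i = chart_tensor (fst (q i)) 1 (fst (snd (q i))) (snd (snd (q i)))" for i
    have "A = line ` g ` {..<r}"
      using bij_betw_imp_surj_on[OF \<alpha>] q by (auto simp: g_def image_image)
    then have L: "L = tensor.span (g ` {..<r})" using A(3) by (simp only: span_lines)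
    have "tens t \<in> line (tens t)" unfolding line_def by (rule tensor.span_base) simp
    then have "tens t \<in> tensor.span (g ` {..<r})" using A(4) L by blast
    from in_span_image[OF this] obtain u where u: "tens t = (\<Sum>i<r. tscale (u i) (g i))" ..
    have eq: "tens t = (\<Sum>i<r. chart_tensor (fst (q i)) (u i) (fst (snd (q i))) (snd (snd (q i))))"
      unfolding u g_def tscale_chart_tensor by simp
    have inf: "\<forall>i<r. (fst (fst (q i)) \<longrightarrow> fst (snd (q i)) = 0) \<and> (snd (fst (q i)) \<longrightarrow> snd (snd (q i)) = 0)"
      using q by simp
    obtain z where z: "solution t z"
      and summand: "\<forall>i<r. u i \<noteq> 0 \<and> summand z i = chart_tensor (fst (q i)) (u i) (fst (snd (q i))) (snd (snd (q i)))"
      using chart_solution[OF eq inf] by (elim exE conjE)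
    have "line (summand z i) = line (g i)" if "i < r" for i
    proof -
      have "summand z i = tscale (u i) (g i)" using summand that by (simp add: g_def tscale_chart_tensor)
      then show ?thesis using summand that by (simp add: line_tscale)
    qed
    then have "line ` summand z ` {..<r} = line ` g ` {..<r}" by (simp add: image_image)
    then have "L = tensor.span (set_mset (summands z))"
      using span_lines[of "summand z ` {..<r}"] span_lines[of "g ` {..<r}"] L by simp
    moreover have "summands z \<in> decompositions d1 d2 r (tens t)" using z by (auto simp: decompositions_eq)
    ultimately show "L \<in> (\<lambda>M. tensor.span (set_mset M)) ` decompositions d1 d2 r (tens t)" by blast
  qed
qed

lemma card_secant_spaces:
  "r = k + 1 \<Longrightarrow> card (secant_spaces_through d1 d2 k (line (tens t))) = card (decompositions d1 d2 r (tens t))"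
  using card_image[OF inj_on_span_decompositions] by (simp add: secant_spaces_eq)

end

end

section \<open>The Zariski topology\<close>

lemma homogeneous_zero: "homogeneous_poly_fun m (\<lambda>T :: 'a::field tensor. 0)"
proof (induction m)
  case (Suc m)
  from homogeneous_poly_fun.mult[OF homogeneous_poly_fun.coord this] show ?case by simp
qed (rule homogeneous_poly_fun.const)

lemma homogeneous_sum:
  "finite I \<Longrightarrow> (\<And>i. i \<in> I \<Longrightarrow> homogeneous_poly_fun m (f i)) \<Longrightarrow> homogeneous_poly_fun m (\<lambda>T. \<Sum>i\<in>I. f i T)"
  by (induction I rule: finite_induct) (auto intro: homogeneous_zero homogeneous_poly_fun.add)

lemma homogeneous_tscale: "homogeneous_poly_fun m f \<Longrightarrow> f (tscale c T) = c ^ m * f T"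
  by (induction rule: homogeneous_poly_fun.induct) (simp_all add: tscale_def algebra_simps power_add)

definition basic_open :: "'a::field tensor set \<Rightarrow> ('a tensor \<Rightarrow> 'a) \<Rightarrow> 'a tensor set set" where
  "basic_open V f = {p \<in> proj_space V. \<exists>T\<in>p. f T \<noteq> 0}"

text \<open>Basic sets are closed under intersection: nonvanishing of a homogeneous polynomial on a
  projective point can be tested at any generator, and \<open>f * g\<close> is again
  homogeneous.\<close>

lemma zariski_basis:
  assumes "openin (zariski_topology V) W" "p \<in> W"
  shows "\<exists>m f. homogeneous_poly_fun m f \<and> p \<in> basic_open V f \<and> basic_open V f \<subseteq> W"
proof -
  have "generate_topology_on {basic_open V f |f m. homogeneous_poly_fun m f} W"
    using assms(1) unfolding zariski_topology_def openin_topology_generated_by_iff basic_open_def .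
  then show ?thesis using assms(2)
  proof (induction rule: generate_topology_on.induct)
    case (Int A B)
    obtain m f where f: "homogeneous_poly_fun m f" "p \<in> basic_open V f" "basic_open V f \<subseteq> A" using Int by blast
    obtain n g where g: "homogeneous_poly_fun n g" "p \<in> basic_open V g" "basic_open V g \<subseteq> B" using Int by blast
    obtain T where T: "p = line T" "p \<in> proj_space V" using f(2) unfolding basic_open_def proj_space_def by blast
    have "h T \<noteq> 0" if h: "homogeneous_poly_fun l h" "p \<in> basic_open V h" for l h
    proof -
      obtain T' where T': "T' \<in> p" "h T' \<noteq> 0" using h(2) unfolding basic_open_def by blast
      then obtain c where "T' = tscale c T" unfolding T(1) line_def tensor.span_singleton by blast
      then show ?thesis using T'(2) homogeneous_tscale[OF h(1)] by auto
    qed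
    then have "f T * g T \<noteq> 0" using f g by simp
    moreover have "T \<in> p" unfolding T(1) line_def by (rule tensor.span_base) simp
    ultimately have "p \<in> basic_open V (\<lambda>T. f T * g T)" using T(2) unfolding basic_open_def by blast
    moreover have "basic_open V (\<lambda>T. f T * g T) \<subseteq> basic_open V f \<inter> basic_open V g"
      unfolding basic_open_def by auto
    ultimately show ?case using homogeneous_poly_fun.mult[OF f(1) g(1)] f(3) g(3) by blast
  next
    case (UN K)
    then obtain A where "A \<in> K" "p \<in> A" by blast
    then show ?case using UN.IH by blast
  next
    case (Basis A)
    then show ?case by blast
  qed simp
qed

context perfect_grid
begin

lemma in_basic_open_iff:
  assumes "homogeneous_poly_fun m f" "tens t \<noteq> 0"
  shows "line (tens t) \<in> basic_open (part_sym_tensors d1 d2) f \<longleftrightarrow> f (tens t) \<noteq> 0"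
proof
  assume "line (tens t) \<in> basic_open (part_sym_tensors d1 d2) f"
  then obtain T where T: "T \<in> line (tens t)" "f T \<noteq> 0" unfolding basic_open_def by blast
  then obtain c where "T = tscale c (tens t)" unfolding in_line_iff by blast
  then show "f (tens t) \<noteq> 0" using T(2) homogeneous_tscale[OF assms(1)] by auto
next
  assume "f (tens t) \<noteq> 0"
  moreover have "tens t \<in> line (tens t)" unfolding line_def by (rule tensor.span_base) simp
  moreover have "line (tens t) \<in> proj_space (part_sym_tensors d1 d2)"
    unfolding proj_space_def using assms(2) tens_in_part_sym by blast
  ultimately show "line (tens t) \<in> basic_open (part_sym_tensors d1 d2) f" unfolding basic_open_def by blast
qed

lemma in_proj_space: "p \<in> proj_space (part_sym_tensors d1 d2) \<Longrightarrow> \<exists>t. tens t \<noteq> 0 \<and> p = line (tens t)"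
proof -
  assume "p \<in> proj_space (part_sym_tensors d1 d2)"
  then obtain T where T: "T \<in> part_sym_tensors d1 d2" "T \<noteq> 0" "p = line T"
    unfolding proj_space_def by blast
  then show ?thesis using part_sym_tensor_eq_tens[OF T(1)] by (intro exI[of _ "\<lambda>s. T (word s)"]) simp
qed

lemma homogeneous_pexp:
  fixes f :: "'a::field tensor \<Rightarrow> 'a"
  assumes "homogeneous_poly_fun m f"
  shows "\<exists>F. \<forall>t. pval t F = f (tens t)"
  using assms
proof (induction rule: homogeneous_poly_fun.induct)
  case (const c)
  show ?case by (rule exI[of _ "PC c"]) simp
next
  case (coord xs)
  show ?case
    by (rule exI[of _ "if length xs = d1 + d2 then PV (cnt1 xs, cnt2 xs) else PC 0"]) (simp add: tens_def)
next
  case (add m f g)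
  then obtain F G where "\<forall>t. pval t F = f (tens t)" "\<forall>t. pval t G = g (tens t)" by blast
  then show ?case by (intro exI[of _ "PAdd F G"]) simp
next
  case (mult m f n g)
  then obtain F G where "\<forall>t. pval t F = f (tens t)" "\<forall>t. pval t G = g (tens t)" by blast
  then show ?case by (intro exI[of _ "PMul F G"]) simp
qed

text \<open>\<open>along e Q T\<close> is the restriction of \<open>Q\<close> to the line through \<open>0\<close> and \<open>T\<close>, so that its coefficients are
  the homogeneous parts of \<open>Q\<close>; the irrelevant variables outside the grid are frozen at \<open>e\<close>.\<close>

definition along :: "(nat \<times> nat \<Rightarrow> 'a::field) \<Rightarrow> (nat \<times> nat, 'a) pexp \<Rightarrow> 'a tensor \<Rightarrow> 'a poly" where
  "along e Q T = pev (\<lambda>c. [:c:]) (\<lambda>s. if s \<in> grid then [:0, T (word s):] else [:e s:]) Q"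

lemma poly_along: "poly (along e Q T) x = pval (\<lambda>s. if s \<in> grid then x * T (word s) else e s) Q"
  unfolding along_def by (induction Q) auto

lemma homogeneous_coeff_along: "homogeneous_poly_fun m (\<lambda>T. coeff (along e Q T) m)"
proof (induction Q arbitrary: m)
  case (PC c)
  show ?case by (cases m) (auto simp: along_def intro: homogeneous_zero homogeneous_poly_fun.const)
next
  case (PV s)
  have coord: "homogeneous_poly_fun m (\<lambda>T. coeff [:0, T (word s):] m)"
  proof (cases m)
    case (Suc n)
    then show ?thesis
      using homogeneous_poly_fun.coord[of "word s"] by (cases n) (auto intro: homogeneous_zero)
  qed (simp add: homogeneous_zero)
  have const: "homogeneous_poly_fun m (\<lambda>T. coeff [:e s:] m)"
    by (cases m) (auto intro: homogeneous_zero homogeneous_poly_fun.const)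
  show ?case unfolding along_def pev.simps
    using coord const by (cases "s \<in> grid") (simp_all only: if_True if_False)
next
  case (PAdd p q)
  from homogeneous_poly_fun.add[OF PAdd] show ?case by (simp add: along_def)
next
  case (PMul p q)
  have "homogeneous_poly_fun m (\<lambda>T. \<Sum>i\<le>m. coeff (along e p T) i * coeff (along e q T) (m - i))"
  proof (rule homogeneous_sum)
    fix i assume "i \<in> {..m}"
    then show "homogeneous_poly_fun m (\<lambda>T. coeff (along e p T) i * coeff (along e q T) (m - i))"
      using homogeneous_poly_fun.mult[OF PMul(1)[of i] PMul(2)[of "m - i"]] by simp
  qed simp
  then show ?case by (simp add: along_def coeff_mult)
qed

text \<open>The open set is given by a nonzero homogeneous part \<open>f\<close> of
  \<open>Q\<close>. Where \<open>f\<close> does not vanish, \<open>Q\<close> is nonzero on the line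
  through 0 and the tensor, so \<open>P\<close> holds for some nonzero multiple; density is
  irreducibility of affine space.\<close>

lemma for_general_point_if_generic:
  fixes P :: "(nat \<times> nat \<Rightarrow> 'a::field_char_0) \<Rightarrow> bool"
  assumes gen: "generic P"
    and cong: "\<And>t t'. (\<And>s. s \<in> grid \<Longrightarrow> t s = t' s) \<Longrightarrow> P t \<Longrightarrow> P t'"
    and P': "\<And>t c. c \<noteq> 0 \<Longrightarrow> P (\<lambda>s. c * t s) \<Longrightarrow> P' (line (tens t))"
  shows "for_general_point (part_sym_tensors d1 d2) P'"
proof -
  let ?V = "part_sym_tensors d1 d2 :: 'a tensor set"
  obtain Q e where e: "pval e Q \<noteq> 0" and Q: "\<And>t. pval t Q \<noteq> 0 \<Longrightarrow> P t"
    using gen unfolding generic_def by blast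
  have "(\<lambda>s. if s \<in> grid then 1 * tens e (word s) else e s) = e" by (auto simp: tens_word)
  then have "poly (along e Q (tens e)) 1 \<noteq> 0" unfolding poly_along using e by simp
  then have "along e Q (tens e) \<noteq> 0" by auto
  then obtain m where m: "coeff (along e Q (tens e)) m \<noteq> 0" by (auto simp: poly_eq_iff)
  define f where "f T = coeff (along e Q T) m" for T
  have f: "homogeneous_poly_fun m f" unfolding f_def by (rule homogeneous_coeff_along)
  let ?U = "basic_open ?V f"
  have "openin (zariski_topology ?V) ?U"
    unfolding zariski_topology_def basic_open_def by (rule topology_generated_by_Basis) (use f in blast)
  moreover have "zariski_topology ?V closure_of ?U = topspace (zariski_topology ?V)"
  proof (rule antisym[OF closure_of_subset_topspace], rule subsetI)
    fix p assume p: "p \<in> topspace (zariski_topology ?V)"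
    have "\<exists>q. q \<in> ?U \<and> q \<in> W" if W: "p \<in> W" "openin (zariski_topology ?V) W" for W
    proof -
      obtain n g where g: "homogeneous_poly_fun n g" "p \<in> basic_open ?V g" "basic_open ?V g \<subseteq> W"
        using zariski_basis[OF W(2,1)] by blast
      obtain t where t: "tens t \<noteq> 0" "p = line (tens t)"
        using in_proj_space p unfolding topspace_zariski_topology by blast
      obtain s where s: "s \<in> grid" "t s \<noteq> 0" using t(1) unfolding tens_eq_0_iff by blast
      obtain F where F: "\<And>t. pval t F = f (tens t)" using homogeneous_pexp[OF f] by blast
      obtain G where G: "\<And>t. pval t G = g (tens t)" using homogeneous_pexp[OF g(1)] by blast
      have "pval e F \<noteq> 0" using m by (simp add: F f_def)
      \<comment> \<open>The factor \<open>PV s\<close> keeps the common point of nonvanishing away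
        from the zero tensor.\<close>
      moreover have "pval t (PMul G (PV s)) \<noteq> 0" using g t s in_basic_open_iff[OF g(1) t(1)] by (simp add: G)
      ultimately have "\<exists>t'. pval t' F \<noteq> 0 \<and> pval t' (PMul G (PV s)) \<noteq> 0" by (rule pval_mult_nonzero)
      then obtain t' where t': "f (tens t') \<noteq> 0" "g (tens t') \<noteq> 0" "t' s \<noteq> 0" by (auto simp: F G)
      have "tens t' \<noteq> 0" using t'(3) s(1) unfolding tens_eq_0_iff by blast
      then have "line (tens t') \<in> ?U" "line (tens t') \<in> basic_open ?V g"
        using in_basic_open_iff f g(1) t' by blast+
      then show ?thesis using g(3) by blast
    qed
    then show "p \<in> zariski_topology ?V closure_of ?U" using p unfolding in_closure_of by blast
  qed
  moreover have "\<forall>p\<in>?U. P' p"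
  proof
    fix p assume p: "p \<in> ?U"
    then have "p \<in> proj_space ?V" unfolding basic_open_def by blast
    then obtain t where t: "tens t \<noteq> 0" "p = line (tens t)" using in_proj_space by blast
    then have "f (tens t) \<noteq> 0" using p in_basic_open_iff[OF f] by blast
    \<comment> \<open>The factor \<open>[:0, 1:]\<close> ensures that the multiple found is
      nonzero.\<close>
    then have "[:0, 1:] * along e Q (tens t) \<noteq> 0" by (auto simp: f_def)
    then obtain c where "poly ([:0, 1:] * along e Q (tens t)) c \<noteq> 0" using poly_all_0_iff_0 by blast
    then have c: "c \<noteq> 0" "poly (along e Q (tens t)) c \<noteq> 0" by auto
    from Q[OF c(2)[unfolded poly_along]] have "P (\<lambda>s. c * t s)"
      by (rule cong[rotated]) (simp add: tens_word)
    from P'[OF c(1) this] show "P' p" using t(2) by simp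
  qed
  ultimately show ?thesis unfolding for_general_point_def by blast
qed

text \<open>Genericity yields the count for some multiple of a representative; scaling every summand
  extends it to all nonzero vectors of the projective point.\<close>

lemma card_decompositions_tscale:
  assumes "c \<noteq> (0::'a::field)"
  shows "card (decompositions d1 d2 r (tscale c T)) = card (decompositions d1 d2 r T)"
proof (rule bij_betw_same_card)
  have sum: "\<Sum>\<^sub># (image_mset (tscale b) M) = tscale b (\<Sum>\<^sub># M)" for b :: 'a and M
    by (induction M) (simp_all only: image_mset_empty image_mset_add_mset sum_mset.empty sum_mset.add_mset
      tensor.scale_zero_right tensor.scale_right_distrib)
  have dec: "tscale b S \<in> decomposable_tensors d1 d2" if "b \<noteq> 0" "S \<in> decomposable_tensors d1 d2" for b :: 'a and S
    using that by (simp add: decomposable_tensors_def line_tscale)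
  have scale: "image_mset (tscale b) M \<in> decompositions d1 d2 r (tscale b S)"
    if "b \<noteq> 0" "M \<in> decompositions d1 d2 r S" for b :: 'a and M S
    using that dec unfolding decompositions_def by (auto simp: sum)
  have inv: "image_mset (tscale a) (image_mset (tscale b) M) = M" if "a * b = 1" for a b :: 'a and M
    using that by (simp add: image_mset.compositionality comp_def)
  show "bij_betw (image_mset (tscale (inverse c))) (decompositions d1 d2 r (tscale c T)) (decompositions d1 d2 r T)"
  proof (rule bij_betw_byWitness[where f' = "image_mset (tscale c)"])
    show "image_mset (tscale (inverse c)) ` decompositions d1 d2 r (tscale c T) \<subseteq> decompositions d1 d2 r T"
      using scale[of "inverse c" _ "tscale c T"] assms by auto
    show "image_mset (tscale c) ` decompositions d1 d2 r T \<subseteq> decompositions d1 d2 r (tscale c T)"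
      using scale[of c] assms by auto
  qed (use inv assms in auto)
qed

lemma general_number_of_decompositions:
  assumes k: "r = k + 1"
  shows "\<exists>\<nu>\<ge>2. for_general_point
      (part_sym_tensors d1 d2 :: 'a::{alg_closed_field, field_char_0} tensor set)
      (\<lambda>p. card (secant_spaces_through d1 d2 k p) = \<nu> \<and>
           (\<forall>T \<in> p - {0}. card (decompositions d1 d2 r T) = \<nu>))"
proof -
  obtain \<nu> where \<nu>: "\<nu> \<ge> 2" and gen: "generic (\<lambda>t :: nat \<times> nat \<Rightarrow> 'a.
     regular t \<and> finite (fibre t) \<and> many \<nu> t \<and> \<not> many (Suc \<nu>) t)"
    using generic_count by (elim exE conjE)
  have "for_general_point (part_sym_tensors d1 d2 :: 'a tensor set)
      (\<lambda>p. card (secant_spaces_through d1 d2 k p) = \<nu> \<and>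
           (\<forall>T \<in> p - {0}. card (decompositions d1 d2 r T) = \<nu>))"
  proof (rule for_general_point_if_generic[OF gen])
    fix t t' :: "nat \<times> nat \<Rightarrow> 'a"
    assume eq: "\<And>s. s \<in> grid \<Longrightarrow> t s = t' s"
    have "regular t = regular t'" "fibre t = fibre t'" "many n t = many n t'" for n
      unfolding regular_def fibre_def many_def by (simp_all add: eq cong: ball_cong)
    then show "regular t \<and> finite (fibre t) \<and> many \<nu> t \<and> \<not> many (Suc \<nu>) t \<Longrightarrow>
      regular t' \<and> finite (fibre t') \<and> many \<nu> t' \<and> \<not> many (Suc \<nu>) t'" by simp
  next
    fix t :: "nat \<times> nat \<Rightarrow> 'a" and c :: 'a
    let ?t = "\<lambda>s. c * t s"
    assume c: "c \<noteq> 0" and t: "regular ?t \<and> finite (fibre ?t) \<and> many \<nu> ?t \<and> \<not> many (Suc \<nu>) ?t"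
    have tens: "tens ?t = tscale c (tens t)" by (simp add: tscale_tens)
    have card: "card (decompositions d1 d2 r (tens ?t)) = \<nu>" using card_decompositions[of ?t \<nu>] t by blast
    show "card (secant_spaces_through d1 d2 k (line (tens t))) = \<nu> \<and>
           (\<forall>T \<in> line (tens t) - {0}. card (decompositions d1 d2 r T) = \<nu>)"
    proof (intro conjI ballI)
      have "card (secant_spaces_through d1 d2 k (line (tens ?t))) = \<nu>"
        using card_secant_spaces[of ?t k] t k card by simp
      then show "card (secant_spaces_through d1 d2 k (line (tens t))) = \<nu>"
        unfolding tens line_tscale[OF c] .
    next
      fix T assume T: "T \<in> line (tens t) - {0}"
      then obtain b where b: "T = tscale b (tens t)" using in_line_iff[of T] by blast
      then have b0: "b \<noteq> 0" using T by auto
      show "card (decompositions d1 d2 r T) = \<nu>"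
        using card unfolding b tens card_decompositions_tscale[OF c] card_decompositions_tscale[OF b0] .
    qed
  qed
  then show ?thesis using \<nu> by blast
qed

end

theorem corollary1:
  fixes d1 d2 k :: nat
  assumes "4 \<le> d1" and "d1 \<le> d2" and "1 \<le> k"
    and "(d1 + 1) * (d2 + 1) = 3 * (k + 1)"
  shows "\<exists>\<nu>::nat. \<nu> \<ge> 2 \<and>
    for_general_point
      (part_sym_tensors d1 d2 :: 'a::{alg_closed_field, field_char_0} tensor set)
      (\<lambda>p. card (secant_spaces_through d1 d2 k p) = \<nu> \<and>
           (\<forall>T \<in> p - {0}. card (decompositions d1 d2 (k + 1) T) = \<nu>))"
proof -
  interpret perfect_grid d1 d2 "k + 1"
    by unfold_locales (use assms in auto)
  show ?thesis using general_number_of_decompositions[OF refl] .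
qed

end
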